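(* Let $\alpha\in\mathcal R$. Then: (1) If $\alpha$ is continuous, then $L^\alpha(\mathbb T)^\sharp=\mathcal L^{\alpha'}(\mathbb T)$ (under the pairing by integration); i.e., for every bounded linear functional $\phi\in L^\alpha(\mathbb T)^\sharp$ there is $h\in\mathcal L^{\alpha'}(\mathbb T)$ such that $\phi(f)=\int_{\mathbb T}fh\,dm$ for all $f\in L^\alpha(\mathbb T)$, and $\|\phi\|=\alpha'(h)$. (2) If $\alpha$ is continuous, then $\alpha''=\alpha$. (3) If $\alpha$ and $\alpha'$ are both strongly continuous, then $L^\alpha(\mathbb T)^{\sharp\sharp}=L^\alpha(\mathbb T)$ and $H^\alpha(\mathbb T)^{\sharp\sharp}=H^\alpha(\mathbb T)$ (i.e. both spaces are reflexive). (4) If $\alpha\in\mathcal S$, then $L^\alpha(\mathbb T)^{\sharp\sharp}=L^\alpha(\mathbb T)$ (i.e. $L^\alpha(\mathbb T)$ is reflexive) if and only if $\alpha$ and $\alpha'$ are both strongly continuous.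
   Context: $\mathbb T$ is the unit circle and $m$ is normalized arc length (Haar measure) on $\mathbb T$; functions equal a.e. are identified. For $f:\mathbb T\to\mathbb C$ and $w\in\mathbb T$, $f_w(z)=f(\overline wz)$. $\mathcal R$ is the set of rotationally symmetric seminorms, i.e. seminorms $\alpha$ on $L^\infty(\mathbb T)$ with $\alpha(1)=1$, $\alpha(|f|)=\alpha(f)$ and $\alpha(f_w)=\alpha(f)$ for all $f\in L^\infty(\mathbb T)$, $w\in\mathbb T$. $\mathcal S\subset\mathcal R$ is the set of symmetric gauge seminorms: those that moreover satisfy $\alpha(f\circ\phi)=\alpha(f)$ for all invertible measure-preserving maps $\phi:\mathbb T\to\mathbb T$. $\alpha$ is continuous if $\lim_{m(E)\to0^+}\alpha(\chi_E)=0$. For any measurable $f:\mathbb T\to\mathbb C$ put $\alpha(f)=\sup\{\alpha(s):s\text{ a simple function},\ |s|\le|f|\}$. $\mathcal L^\alpha(\mathbb T)$ is the set of measurable $f$ with $\alpha(f)<\infty$; $L^\alpha(\mathbb T)$ is the $\alpha$-closure of $L^\infty(\mathbb T)$ in $\mathcal L^\alpha(\mathbb T)$; $H^\alpha(\mathbb T)$ is the $\alpha$-closed linear span of $\{1,z,z^2,\ldots\}$. $\alpha\in\mathcal R$ is strongly continuous if it is continuous and $L^\alpha(\mathbb T)=\mathcal L^\alpha(\mathbb T)$. The dual norm is $\alpha'(f)=\sup\{|\int_{\mathbb T}fh\,dm|:h\in L^\infty(\mathbb T),\ \alpha(h)\le1\}=\sup\{\int_{\mathbb T}|fh|\,dm:h\in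 L^\infty(\mathbb T),\ \alpha(h)\le1\}$ for $f\in L^\infty(\mathbb T)$, extended to measurable functions by the same supremum over simple functions; $\mathcal L^{\alpha'}(\mathbb T)$, continuity and strong continuity of $\alpha'$ are defined as for $\alpha$, and $\alpha''=(\alpha')'$. $X^\sharp$ denotes the dual of a Banach space $X$. *)

theory Defs
  imports "HOL-Analysis.Analysis"
begin

text \<open>Functions on the circle are total functions \<open>complex \<Rightarrow> complex\<close>; since the space of
  \<open>circle_measure\<close> is the unit circle, measurability, integrals and almost-everywhere statements
  ignore their values elsewhere.  Almost everywhere equal functions are not identified by passing
  to a quotient; seminorms are required to respect almost everywhere equality instead.
  Measurability is Borel measurability on the circle, which loses nothing: every Lebesgue
  measurable function, and every Lebesgue automorphism of the circle, agrees almost everywhere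
  with a Borel one.\<close>

definition circle_measure :: "complex measure" where
  "circle_measure =
     distr (uniform_measure lborel {0..2 * pi}) (restrict_space borel (sphere 0 1)) cis"

definition Linf :: "(complex \<Rightarrow> complex) set" where
  "Linf = {f \<in> borel_measurable circle_measure.
             \<exists>C::real. AE z in circle_measure. cmod (f z) \<le> C}"

definition circle_automorphism :: "(complex \<Rightarrow> complex) \<Rightarrow> bool" where
  "circle_automorphism \<phi> \<longleftrightarrow>
     bij_betw \<phi> (sphere 0 1) (sphere 0 1) \<and>
     \<phi> \<in> measurable circle_measure circle_measure \<and>
     inv_into (sphere 0 1) \<phi> \<in> measurable circle_measure circle_measure \<and>
     distr circle_measure circle_measure \<phi> = circle_measure"

text \<open>Gauges take values in \<open>ennreal\<close> so that the dual gauge and the extension to all measurable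
  functions are always defined.  Only the values of \<open>\<alpha>\<close> on \<open>Linf\<close> are ever relevant.\<close>

definition rot_sym_seminorms :: "((complex \<Rightarrow> complex) \<Rightarrow> ennreal) set" where
  "rot_sym_seminorms = {\<alpha>.
     (\<forall>f\<in>Linf. \<forall>g\<in>Linf. (AE z in circle_measure. f z = g z) \<longrightarrow> \<alpha> f = \<alpha> g) \<and>
     (\<forall>f\<in>Linf. \<alpha> f < \<infinity>) \<and>
     (\<forall>f\<in>Linf. \<forall>g\<in>Linf. \<alpha> (\<lambda>z. f z + g z) \<le> \<alpha> f + \<alpha> g) \<and>
     (\<forall>c. \<forall>f\<in>Linf. \<alpha> (\<lambda>z. c * f z) = ennreal (cmod c) * \<alpha> f) \<and>
     \<alpha> (\<lambda>z. 1) = 1 \<and>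
     (\<forall>f\<in>Linf. \<alpha> (\<lambda>z. complex_of_real (cmod (f z))) = \<alpha> f) \<and>
     (\<forall>f\<in>Linf. \<forall>w\<in>sphere 0 1. \<alpha> (\<lambda>z. f (cnj w * z)) = \<alpha> f)}"

definition sym_gauge_seminorms :: "((complex \<Rightarrow> complex) \<Rightarrow> ennreal) set" where
  "sym_gauge_seminorms = {\<alpha> \<in> rot_sym_seminorms.
     \<forall>f\<in>Linf. \<forall>\<phi>. circle_automorphism \<phi> \<longrightarrow> \<alpha> (f \<circ> \<phi>) = \<alpha> f}"

definition gauge_continuous :: "((complex \<Rightarrow> complex) \<Rightarrow> ennreal) \<Rightarrow> bool" where
  "gauge_continuous \<alpha> \<longleftrightarrow>
     (\<forall>\<epsilon>>0. \<exists>\<delta>>0. \<forall>E\<in>sets circle_measure.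
        0 < measure circle_measure E \<and> measure circle_measure E < \<delta> \<longrightarrow>
        \<alpha> (indicator E) < ennreal \<epsilon>)"

definition gauge_ext ::
    "((complex \<Rightarrow> complex) \<Rightarrow> ennreal) \<Rightarrow> (complex \<Rightarrow> complex) \<Rightarrow> ennreal" where
  "gauge_ext \<alpha> f =
     (SUP s \<in> {s. simple_function circle_measure s \<and>
                  (AE z in circle_measure. cmod (s z) \<le> cmod (f z))}. \<alpha> s)"

text \<open>To be used on \<open>Linf\<close> only; on unbounded functions the dual gauge of \<open>\<alpha>\<close> is
  \<open>gauge_ext (dual_gauge \<alpha>)\<close>.  It may be infinite for a discontinuous \<open>\<alpha>\<close>.\<close>

definition dual_gauge ::
    "((complex \<Rightarrow> complex) \<Rightarrow> ennreal) \<Rightarrow> (complex \<Rightarrow> complex) \<Rightarrow> ennreal" where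
  "dual_gauge \<alpha> f =
     (SUP h \<in> {h \<in> Linf. \<alpha> h \<le> 1}. ennreal (cmod (\<integral>z. f z * h z \<partial>circle_measure)))"

definition Lcal :: "((complex \<Rightarrow> complex) \<Rightarrow> ennreal) \<Rightarrow> (complex \<Rightarrow> complex) set" where
  "Lcal \<alpha> = {f \<in> borel_measurable circle_measure. gauge_ext \<alpha> f < \<infinity>}"

definition gauge_closure ::
    "((complex \<Rightarrow> complex) \<Rightarrow> ennreal) \<Rightarrow> (complex \<Rightarrow> complex) set \<Rightarrow> (complex \<Rightarrow> complex) set"
  where
  "gauge_closure \<alpha> A =
     {f \<in> Lcal \<alpha>. \<forall>\<epsilon>>0. \<exists>g\<in>A. gauge_ext \<alpha> (\<lambda>z. f z - g z) < ennreal \<epsilon>}"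

definition Lgauge :: "((complex \<Rightarrow> complex) \<Rightarrow> ennreal) \<Rightarrow> (complex \<Rightarrow> complex) set" where
  "Lgauge \<alpha> = gauge_closure \<alpha> Linf"

definition Hgauge :: "((complex \<Rightarrow> complex) \<Rightarrow> ennreal) \<Rightarrow> (complex \<Rightarrow> complex) set" where
  "Hgauge \<alpha> = gauge_closure \<alpha> {p. \<exists>(c :: nat \<Rightarrow> complex) n. p = (\<lambda>z. \<Sum>k<n. c k * z ^ k)}"

definition strongly_continuous :: "((complex \<Rightarrow> complex) \<Rightarrow> ennreal) \<Rightarrow> bool" where
  "strongly_continuous \<alpha> \<longleftrightarrow> gauge_continuous \<alpha> \<and> Lgauge \<alpha> = Lcal \<alpha>"

text \<open>\<open>V\<close> is a space of complex-valued functions with pointwise operations and \<open>N\<close> a seminorm on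
  it.  A functional on \<open>V\<close> is represented by the function that extends it by \<open>0\<close> outside \<open>V\<close>, so
  the dual is again a space of complex-valued functions and the construction can be iterated.
  Boundedness with respect to \<open>N\<close> makes functionals vanish on the kernel of \<open>N\<close>, so this is also
  the dual of the normed quotient of \<open>V\<close> by that kernel.\<close>

definition dual_space ::
    "('x \<Rightarrow> complex) set \<Rightarrow> (('x \<Rightarrow> complex) \<Rightarrow> ennreal) \<Rightarrow> (('x \<Rightarrow> complex) \<Rightarrow> complex) set" where
  "dual_space V N = {\<phi>.
     (\<forall>f\<in>V. \<forall>g\<in>V. \<phi> (\<lambda>x. f x + g x) = \<phi> f + \<phi> g) \<and>
     (\<forall>c. \<forall>f\<in>V. \<phi> (\<lambda>x. c * f x) = c * \<phi> f) \<and>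
     (\<exists>C::real. \<forall>f\<in>V. ennreal (cmod (\<phi> f)) \<le> ennreal C * N f) \<and>
     (\<forall>f. f \<notin> V \<longrightarrow> \<phi> f = 0)}"

definition dual_norm ::
    "('x \<Rightarrow> complex) set \<Rightarrow> (('x \<Rightarrow> complex) \<Rightarrow> ennreal) \<Rightarrow> (('x \<Rightarrow> complex) \<Rightarrow> complex) \<Rightarrow> ennreal"
  where
  "dual_norm V N \<phi> = (SUP f \<in> {f \<in> V. N f \<le> 1}. ennreal (cmod (\<phi> f)))"

text \<open>Surjectivity of the canonical map from \<open>V\<close> to its bidual.\<close>

definition reflexive_space ::
    "('x \<Rightarrow> complex) set \<Rightarrow> (('x \<Rightarrow> complex) \<Rightarrow> ennreal) \<Rightarrow> bool" where
  "reflexive_space V N \<longleftrightarrow>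
     (\<forall>\<Phi> \<in> dual_space (dual_space V N) (dual_norm V N).
        \<exists>f\<in>V. \<forall>\<phi> \<in> dual_space V N. \<Phi> \<phi> = \<phi> f)"

definition pairing ::
    "(complex \<Rightarrow> complex) set \<Rightarrow> (complex \<Rightarrow> complex) \<Rightarrow> (complex \<Rightarrow> complex) \<Rightarrow> complex" where
  "pairing V h = (\<lambda>f. if f \<in> V then (\<integral>z. f z * h z \<partial>circle_measure) else 0)"

end

theory Submission
  imports Defs "HOL-Probability.Probability_Measure"
begin

text \<open>A functional on \<open>L\<^sup>\<infinity>\<close> dominated by a continuous \<open>\<alpha>\<close> defines a countably additive set
  function, so by Radon--Nikodym it is integration against some \<open>h\<close>.  Applied to a functional
  norming \<open>1\<close> and averaged over rotations, this gives \<open>\<integral>\<bar>f\<bar> \<le> \<alpha> f\<close>, which makes \<open>\<alpha>'\<close> a gauge of the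
  same kind; density then identifies the dual of \<open>L\<^sup>\<alpha>\<close>, and norming functionals give \<open>\<alpha>'' = \<alpha>\<close>.
  Hence, for continuous \<open>\<alpha>\<close>, reflexivity says that every functional on the full space of \<open>\<alpha>'\<close> is
  integration against a function in \<open>L\<^sup>\<alpha>\<close>.  Functionals separating \<open>1\<close> from the order continuous
  part, or an element from the closure of \<open>L\<^sup>\<infinity>\<close>, are singular, so none of them may exist.
  For a symmetric gauge that is not assumed continuous, it remains to see that reflexivity forces
  continuity.  This needs \<open>\<alpha>\<close> to be definite, which holds because a set of small measure can be
  moved into its complement by an automorphism built from countably many rotations.\<close>

section \<open>The Hahn--Banach theorem\<close>

text \<open>Two obstacles shape the proof. First, the axioms do not make \<open>\<alpha>\<close> a
  norm, and \<open>\<alpha>'\<close> need not be finite on \<open>Linf\<close>. The bound of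
  \<integral>|f| by \<open>\<alpha> f\<close> removes both defects at once, but it rests on the
  representation of functionals on \<open>Linf\<close>, which must therefore be proved before
  anything is known about \<open>\<alpha>'\<close>. Second, \<open>\<alpha>'\<close> need not
  inherit continuity from \<open>\<alpha>\<close>, so the dual of \<open>Lgauge \<alpha>\<close> is
  the full space of \<open>\<alpha>'\<close>, whose own dual may contain more than integrals. In the
  symmetric case the dual is not known to consist of functions until continuity is proved, so the
  contradicting element of the bidual is built by hand, as a generalized limit of evaluations.
  Definiteness cannot come from rotations alone: they spread a set of gauge 0 over all but a small
  part of the circle, but a seminorm is only finitely subadditive, and the small rest is left over.
  One automorphism disposes of that rest.\<close>

text \<open>A maximal cone over \<open>K\<close> contains \<open>(f, r)\<close> or \<open>(- f, - r)\<close>, so the infimum of its sections is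
  odd as well as sublinear.\<close>

lemma cone_functional:
  fixes V :: "('x \<Rightarrow> complex) set" and K :: "(('x \<Rightarrow> complex) \<times> real) set"
  assumes V_add: "\<And>f g. f \<in> V \<Longrightarrow> g \<in> V \<Longrightarrow> (\<lambda>x. f x + g x) \<in> V"
    and V_scale: "\<And>c f. f \<in> V \<Longrightarrow> (\<lambda>x. c * f x) \<in> V"
    and K_sub: "\<And>f r. (f, r) \<in> K \<Longrightarrow> f \<in> V"
    and K_add: "\<And>f g r s. (f, r) \<in> K \<Longrightarrow> (g, s) \<in> K \<Longrightarrow> ((\<lambda>x. f x + g x), r + s) \<in> K"
    and K_scale: "\<And>f r t. (f, r) \<in> K \<Longrightarrow> 0 < t \<Longrightarrow> ((\<lambda>x. complex_of_real t * f x), t * r) \<in> K"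
    and K_pos: "\<And>r. ((\<lambda>_. 0), r) \<in> K \<Longrightarrow> 0 \<le> r"
    and K_zero: "\<And>r. 0 \<le> r \<Longrightarrow> ((\<lambda>_. 0), r) \<in> K"
    and K_dom: "\<And>f. f \<in> V \<Longrightarrow> \<exists>r. (f, r) \<in> K"
  obtains l :: "('x \<Rightarrow> complex) \<Rightarrow> real"
  where "\<And>f g. f \<in> V \<Longrightarrow> g \<in> V \<Longrightarrow> l (\<lambda>x. f x + g x) = l f + l g"
    and "\<And>f t. f \<in> V \<Longrightarrow> l (\<lambda>x. complex_of_real t * f x) = t * l f"
    and "\<And>f r. (f, r) \<in> K \<Longrightarrow> l f \<le> r"
proof -
  \<comment> \<open>A pair (f, r) stands for the constraint l f \<le> r. The last clause forbids the
    demand l 0 < 0; it is what bounds the sections below.\<close>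
  define C where "C = {L. K \<subseteq> L \<and> (\<forall>(f, r) \<in> L. f \<in> V) \<and>
      (\<forall>(f, r) \<in> L. \<forall>(g, s) \<in> L. ((\<lambda>x. f x + g x), r + s) \<in> L) \<and>
      (\<forall>(f, r) \<in> L. \<forall>t > 0. ((\<lambda>x. complex_of_real t * f x), t * r) \<in> L) \<and>
      (\<forall>r. ((\<lambda>_. 0), r) \<in> L \<longrightarrow> 0 \<le> r)}"
  have "\<exists>L\<in>C. \<forall>X\<in>C. L \<subseteq> X \<longrightarrow> X = L"
  proof (rule subset_Zorn_nonempty)
    have "K \<in> C"
      using K_sub K_add K_scale K_pos unfolding C_def by blast
    then show "C \<noteq> {}" by blast
  next
    fix D :: "(('x \<Rightarrow> complex) \<times> real) set set"
    assume D: "D \<noteq> {}" "subset.chain C D"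
    have sub: "L \<in> C" if "L \<in> D" for L
      using D that by (auto simp: subset.chain_def)
    have cmp: "L \<subseteq> L' \<or> L' \<subseteq> L" if "L \<in> D" "L' \<in> D" for L L'
      using D that by (auto simp: subset.chain_def)
    have "K \<subseteq> \<Union> D" using D sub unfolding C_def by blast
    moreover have "\<forall>(f, r) \<in> \<Union> D. f \<in> V" using sub unfolding C_def by blast
    moreover have "((\<lambda>x. f x + g x), r + s) \<in> \<Union> D"
      if p: "(f, r) \<in> L1" "L1 \<in> D" "(g, s) \<in> L2" "L2 \<in> D" for f r g s L1 L2
    proof -
      from p cmp[of L1 L2] obtain L' where "L' \<in> D" "(f, r) \<in> L'" "(g, s) \<in> L'" by blast
      then show ?thesis using sub unfolding C_def by blast
    qed
    moreover have "\<forall>(f, r) \<in> \<Union> D. \<forall>t > 0. ((\<lambda>x. complex_of_real t * f x), t * r) \<in> \<Union> D"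
      using sub unfolding C_def by blast
    moreover have "\<forall>r. ((\<lambda>_. 0), r) \<in> \<Union> D \<longrightarrow> 0 \<le> r"
      using sub unfolding C_def by blast
    ultimately show "\<Union> D \<in> C"
      unfolding C_def by blast
  qed
  then obtain L where L: "L \<in> C" and Lmax: "\<And>X. X \<in> C \<Longrightarrow> L \<subseteq> X \<Longrightarrow> X = L"
    by blast
  have KL: "K \<subseteq> L"
    and LV: "\<And>f r. (f, r) \<in> L \<Longrightarrow> f \<in> V"
    and Ladd: "\<And>f g r s. (f, r) \<in> L \<Longrightarrow> (g, s) \<in> L \<Longrightarrow> ((\<lambda>x. f x + g x), r + s) \<in> L"
    and Lscale: "\<And>f r t. (f, r) \<in> L \<Longrightarrow> 0 < t \<Longrightarrow> ((\<lambda>x. complex_of_real t * f x), t * r) \<in> L"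
    and Lpos: "\<And>r. ((\<lambda>_. 0), r) \<in> L \<Longrightarrow> 0 \<le> r"
    using L unfolding C_def by blast+
  have Lup: "(f, s) \<in> L" if "(f, r) \<in> L" "r \<le> s" for f r s
    using Ladd[OF that(1), of "\<lambda>_. 0" "s - r"] K_zero[of "s - r"] KL that by auto
  have Lneg: "0 \<le> r + s" if "(f, r) \<in> L" "((\<lambda>x. - f x), s) \<in> L" for f r s
    using Lpos[of "r + s"] Ladd[OF that] by simp
  have Vneg: "(\<lambda>x. - f x) \<in> V" if "f \<in> V" for f
    using V_scale[OF that, of "-1"] by simp
  have dich: "((\<lambda>x. - f x), - r) \<in> L" if f: "f \<in> V" and nin: "(f, r) \<notin> L" for f r
  proof -
    \<comment> \<open>\<open>X\<close> is the cone generated by \<open>L\<close> and (f, r). Being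
      strictly larger, it violates the last clause: it contains (0, s) with s < 0, so
      \<open>L\<close> contains some (- t f, u) with u + t r < 0, and division by t gives the
      claim.\<close>
    define X where "X = L \<union> {((\<lambda>x. g x + complex_of_real t * f x), s + t * r) |g s t. (g, s) \<in> L \<and> 0 < t}"
    have XI: "(g', s') \<in> X" if "g' = (\<lambda>x. g x + complex_of_real t * f x)" "s' = s + t * r" "(g, s) \<in> L" "0 \<le> t"
      for g' s' g s t
    proof (cases "t = 0")
      case False
      then have "0 < t" using that by simp
      then show ?thesis using that unfolding X_def by blast
    qed (use that in \<open>auto simp: X_def\<close>)
    have XE: "\<exists>g s t. (g, s) \<in> L \<and> 0 \<le> t \<and> g' = (\<lambda>x. g x + complex_of_real t * f x) \<and> s' = s + t * r"
      if gs: "(g', s') \<in> X" for g' s'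
    proof (cases "(g', s') \<in> L")
      case True
      then show ?thesis by (intro exI[of _ g'] exI[of _ s'] exI[of _ "0::real"]) simp
    next
      case False
      then obtain g s t where "(g, s) \<in> L" "0 < t" "g' = (\<lambda>x. g x + complex_of_real t * f x)" "s' = s + t * r"
        using gs unfolding X_def by blast
      then show ?thesis by (intro exI[of _ g] exI[of _ s] exI[of _ t]) simp
    qed
    have "X \<noteq> L"
    proof
      assume "X = L"
      moreover have "(f, r) \<in> X"
        by (rule XI[where g = "\<lambda>_. 0" and s = 0 and t = 1]) (use K_zero[of 0] KL in auto)
      ultimately show False using nin by simp
    qed
    then have "X \<notin> C" using Lmax[of X] by (auto simp: X_def)
    moreover have "K \<subseteq> X" using KL by (auto simp: X_def)
    moreover have "\<forall>(g, s) \<in> X. g \<in> V"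
    proof clarify
      fix g s assume "(g, s) \<in> X"
      then obtain g1 s1 t where "(g1, s1) \<in> L" "g = (\<lambda>x. g1 x + complex_of_real t * f x)"
        using XE by blast
      then show "g \<in> V" using V_add[OF LV V_scale[OF f]] by simp
    qed
    moreover have "((\<lambda>x. g x + h x), s + u) \<in> X" if "(g, s) \<in> X" "(h, u) \<in> X" for g h s u
    proof -
      obtain g1 s1 t1 where 1: "(g1, s1) \<in> L" "0 \<le> t1" "g = (\<lambda>x. g1 x + complex_of_real t1 * f x)" "s = s1 + t1 * r"
        using XE[OF \<open>(g, s) \<in> X\<close>] by blast
      obtain g2 s2 t2 where 2: "(g2, s2) \<in> L" "0 \<le> t2" "h = (\<lambda>x. g2 x + complex_of_real t2 * f x)" "u = s2 + t2 * r"
        using XE[OF \<open>(h, u) \<in> X\<close>] by blast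
      show ?thesis
        by (rule XI[OF _ _ Ladd[OF 1(1) 2(1)], of _ "t1 + t2"]) (use 1 2 in \<open>auto simp: algebra_simps\<close>)
    qed
    moreover have "((\<lambda>x. complex_of_real t * g x), t * s) \<in> X" if gs: "(g, s) \<in> X" and t: "0 < t" for g s t
    proof -
      obtain g1 s1 t1 where 1: "(g1, s1) \<in> L" "0 \<le> t1" "g = (\<lambda>x. g1 x + complex_of_real t1 * f x)" "s = s1 + t1 * r"
        using XE[OF gs] by blast
      show ?thesis
        by (rule XI[OF _ _ Lscale[OF 1(1) t], of _ "t * t1"]) (use 1 t in \<open>auto simp: algebra_simps\<close>)
    qed
    ultimately have "\<not> (\<forall>r. ((\<lambda>_. 0), r) \<in> X \<longrightarrow> 0 \<le> r)"
      unfolding C_def by blast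
    then obtain s where s: "((\<lambda>_. 0), s) \<in> X" "s < 0"
      by (auto simp: not_le)
    then have "((\<lambda>_. 0), s) \<notin> L" using Lpos[of s] by auto
    then obtain g u t where g: "(g, u) \<in> L" "0 < t" "(\<lambda>_. 0) = (\<lambda>x. g x + complex_of_real t * f x)" "s = u + t * r"
      using s(1) unfolding X_def by blast
    have "((\<lambda>x. complex_of_real (1 / t) * g x), 1 / t * u) \<in> L"
      using Lscale[OF g(1), of "1 / t"] g(2) by simp
    moreover have "(\<lambda>x. complex_of_real (1 / t) * g x) = (\<lambda>x. - f x)"
    proof
      fix x
      have "g x = - complex_of_real t * f x"
        using fun_cong[OF g(3), of x] by (simp add: eq_neg_iff_add_eq_0)
      then show "complex_of_real (1 / t) * g x = - f x" using g(2) by simp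
    qed
    moreover have "1 / t * u \<le> - r" using g(2,4) s(2) by (simp add: field_simps)
    ultimately show ?thesis using Lup by metis
  qed
  define l where "l f = Inf {r. (f, r) \<in> L}" for f
  have ne: "{r. (f, r) \<in> L} \<noteq> {}" if "f \<in> V" for f
    using K_dom[OF that] KL by blast
  have bdd: "bdd_below {r. (f, r) \<in> L}" if f: "f \<in> V" for f
  proof -
    obtain s where "((\<lambda>x. - f x), s) \<in> L" using K_dom[OF Vneg[OF f]] KL by blast
    then have "- s \<le> r" if "(f, r) \<in> L" for r using Lneg[OF that] by fastforce
    then show ?thesis by (auto intro: bdd_belowI[of _ "- s"])
  qed
  have l_le: "l f \<le> r" if "(f, r) \<in> L" for f r
    unfolding l_def using bdd[OF LV[OF that]] that by (auto intro: cInf_lower)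
  have l_less: "(f, r) \<in> L" if "f \<in> V" "l f < r" for f r
    using cInf_lessD[OF ne[OF that(1)] that(2)[unfolded l_def]] Lup by force
  have sub: "l (\<lambda>x. f x + g x) \<le> l f + l g" if "f \<in> V" "g \<in> V" for f g
  proof (rule field_le_epsilon)
    fix e :: real assume e: "0 < e"
    have "((\<lambda>x. f x + g x), (l f + e / 2) + (l g + e / 2)) \<in> L"
      using e by (intro Ladd l_less that) auto
    then show "l (\<lambda>x. f x + g x) \<le> l f + l g + e" using l_le by fastforce
  qed
  have neg: "l (\<lambda>x. - f x) \<le> - l f" if f: "f \<in> V" for f
  proof (rule field_le_epsilon)
    fix e :: real assume e: "0 < e"
    have "(f, l f - e) \<notin> L" using l_le[of f "l f - e"] e by auto
    then have "((\<lambda>x. - f x), - (l f - e)) \<in> L" using dich[OF f] by blast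
    then show "l (\<lambda>x. - f x) \<le> - l f + e" using l_le by fastforce
  qed
  have scale_le: "l (\<lambda>x. complex_of_real t * f x) \<le> t * l f" if f: "f \<in> V" "0 < t" for f t
  proof (rule field_le_epsilon)
    fix e :: real assume e: "0 < e"
    have "(f, l f + e / t) \<in> L" using l_less[OF f(1)] e f by simp
    from Lscale[OF this f(2)] have "((\<lambda>x. complex_of_real t * f x), t * l f + e) \<in> L"
      using f by (simp add: algebra_simps)
    then show "l (\<lambda>x. complex_of_real t * f x) \<le> t * l f + e" by (rule l_le)
  qed
  have add: "l (\<lambda>x. f x + g x) = l f + l g" if f: "f \<in> V" and g: "g \<in> V" for f g
  proof -
    have "l f = l (\<lambda>x. (f x + g x) + - g x)" by simp
    also have "\<dots> \<le> l (\<lambda>x. f x + g x) + l (\<lambda>x. - g x)"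
      by (intro sub V_add Vneg f g)
    finally show ?thesis using sub[OF f g] neg[OF g] by simp
  qed
  have zero: "l (\<lambda>_. 0) = 0"
    using add[of "\<lambda>_. 0" "\<lambda>_. 0"] LV KL K_zero[of 0] by fastforce
  have neg_eq: "l (\<lambda>x. - f x) = - l f" if f: "f \<in> V" for f
    using add[OF f Vneg[OF f]] zero by simp
  have scale_pos: "l (\<lambda>x. complex_of_real t * f x) = t * l f" if f: "f \<in> V" and t: "0 < t" for f t
  proof -
    have "l (\<lambda>x. complex_of_real (1 / t) * (complex_of_real t * f x)) \<le> 1 / t * l (\<lambda>x. complex_of_real t * f x)"
      by (rule scale_le) (use t V_scale[OF f] in auto)
    then have "l f \<le> 1 / t * l (\<lambda>x. complex_of_real t * f x)"
      using t by simp
    then show ?thesis using scale_le[OF f t] t by (simp add: field_simps)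
  qed
  have scale: "l (\<lambda>x. complex_of_real t * f x) = t * l f" if f: "f \<in> V" for f t
  proof -
    consider "t = 0" | "0 < t" | "t < 0" by linarith
    then show ?thesis
    proof cases
      case 3
      have "l (\<lambda>x. - (complex_of_real (- t) * f x)) = - (- t * l f)"
        using neg_eq[OF V_scale[OF f]] scale_pos[OF f, of "- t"] 3 by simp
      then show ?thesis by simp
    qed (use zero scale_pos f in auto)
  qed
  show thesis
    by (rule that[of l]) (use add scale l_le KL in auto)
qed

section \<open>Seminormed spaces of functions and their functionals\<close>

lemma cmod_eq_mult_phase: "\<exists>c. cmod c = 1 \<and> c * z = complex_of_real (cmod z)"
proof (cases "z = 0")
  case False
  then show ?thesis
    by (intro exI[of _ "cnj z / cmod z"])
      (simp add: norm_divide complex_norm_square[symmetric] power2_eq_square[symmetric] mult.commute[of "cnj z"] divide_simps)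
qed (auto intro: exI[of _ 1])

text \<open>A carrier set of functions instead of a type: \<open>Linf\<close>, the full spaces,
  their closures and the bounded sequences are all treated alike, and a dual space is again a set of
  this kind.\<close>

locale seminormed_functions =
  fixes V :: "('x \<Rightarrow> complex) set" and N :: "('x \<Rightarrow> complex) \<Rightarrow> ennreal"
  assumes add_closed: "\<And>f g. f \<in> V \<Longrightarrow> g \<in> V \<Longrightarrow> (\<lambda>x. f x + g x) \<in> V"
    and scale_closed: "\<And>c f. f \<in> V \<Longrightarrow> (\<lambda>x. c * f x) \<in> V"
    and zero_closed: "(\<lambda>_. 0) \<in> V"
    and seminorm_finite: "\<And>f. f \<in> V \<Longrightarrow> N f < \<infinity>"
    and triangle: "\<And>f g. f \<in> V \<Longrightarrow> g \<in> V \<Longrightarrow> N (\<lambda>x. f x + g x) \<le> N f + N g"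
    and homogeneous: "\<And>c f. f \<in> V \<Longrightarrow> N (\<lambda>x. c * f x) = ennreal (cmod c) * N f"
begin

lemma diff_closed: "f \<in> V \<Longrightarrow> g \<in> V \<Longrightarrow> (\<lambda>x. f x - g x) \<in> V"
  using add_closed[OF _ scale_closed[of g "-1"], of f] by simp

lemma real_triangle: "enn2real (N (\<lambda>x. f x + g x)) \<le> enn2real (N f) + enn2real (N g)"
  if "f \<in> V" "g \<in> V"
  using triangle[OF that] seminorm_finite that
  by (metis enn2real_plus enn2real_mono ennreal_add_less_top infinity_ennreal_def)

lemma real_homogeneous: "enn2real (N (\<lambda>x. c * f x)) = cmod c * enn2real (N f)" if "f \<in> V"
  using homogeneous[OF that] by (simp add: enn2real_mult)

lemma ennreal_real: "ennreal (enn2real (N f)) = N f" if "f \<in> V"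
  using seminorm_finite[OF that] by simp

text \<open>\<open>K\<close> is a cone of prescribed constraints Re (\<phi> f) \<le> r. Adding the
  constraints given by N yields a cone to which \<open>cone_functional\<close> applies, and
  \<open>K_bound\<close> is the compatibility of the two kinds of constraint. Separation and
  extension differ only in the choice of \<open>K\<close>.\<close>

lemma dominated_functional:
  fixes K :: "(('x \<Rightarrow> complex) \<times> real) set"
  assumes K_sub: "\<And>f r. (f, r) \<in> K \<Longrightarrow> f \<in> V"
    and K_add: "\<And>f g r s. (f, r) \<in> K \<Longrightarrow> (g, s) \<in> K \<Longrightarrow> ((\<lambda>x. f x + g x), r + s) \<in> K"
    and K_scale: "\<And>f r t. (f, r) \<in> K \<Longrightarrow> 0 < t \<Longrightarrow> ((\<lambda>x. complex_of_real t * f x), t * r) \<in> K"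
    and K_zero: "((\<lambda>_. 0), 0) \<in> K"
    and K_bound: "\<And>f r. (f, r) \<in> K \<Longrightarrow> - r \<le> enn2real (N f)"
  obtains \<phi> where "\<And>f g. f \<in> V \<Longrightarrow> g \<in> V \<Longrightarrow> \<phi> (\<lambda>x. f x + g x) = \<phi> f + \<phi> g"
    and "\<And>c f. f \<in> V \<Longrightarrow> \<phi> (\<lambda>x. c * f x) = c * \<phi> f"
    and "\<And>f. f \<in> V \<Longrightarrow> cmod (\<phi> f) \<le> enn2real (N f)"
    and "\<And>f r. (f, r) \<in> K \<Longrightarrow> Re (\<phi> f) \<le> r"
proof -
  define p where "p f = enn2real (N f)" for f
  have p0: "0 \<le> p f" for f by (simp add: p_def)
  define L where "L = {((\<lambda>x. f x + g x), r + s) |f g r s. (f, r) \<in> K \<and> g \<in> V \<and> p g \<le> s}"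
  have LI: "(h, t) \<in> L" if "(f, r) \<in> K" "g \<in> V" "p g \<le> s" "h = (\<lambda>x. f x + g x)" "t = r + s" for h t f g r s
    unfolding L_def using that by blast
  have pz: "p (\<lambda>_. 0) = 0"
    using real_homogeneous[OF zero_closed, of 0] by (simp add: p_def)
  have LN: "(g, s) \<in> L" if "g \<in> V" "p g \<le> s" for g s
    by (rule LI[OF K_zero that]) auto
  have LK: "(f, r) \<in> L" if "(f, r) \<in> K" for f r
    by (rule LI[OF that zero_closed, of 0]) (auto simp: pz)
  obtain l where add: "\<And>f g. f \<in> V \<Longrightarrow> g \<in> V \<Longrightarrow> l (\<lambda>x. f x + g x) = l f + l g"
    and scale: "\<And>f t. f \<in> V \<Longrightarrow> l (\<lambda>x. complex_of_real t * f x) = t * l f"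
    and le: "\<And>f r. (f, r) \<in> L \<Longrightarrow> l f \<le> r"
  proof (rule cone_functional[of V L], goal_cases)
    case (1 f g)
    then show ?case using add_closed by blast
  next
    case (2 c f)
    then show ?case using scale_closed by blast
  next
    case (3 f r)
    then show ?case unfolding L_def using K_sub add_closed by blast
  next
    case (4 f g r s)
    then obtain f1 f2 r1 r2 g1 g2 s1 s2 where *: "(f1, r1) \<in> K" "f2 \<in> V" "p f2 \<le> r2"
      "f = (\<lambda>x. f1 x + f2 x)" "r = r1 + r2" "(g1, s1) \<in> K" "g2 \<in> V" "p g2 \<le> s2"
      "g = (\<lambda>x. g1 x + g2 x)" "s = s1 + s2"
      unfolding L_def by blast
    show ?case
      by (rule LI[OF K_add[OF *(1,6)] add_closed[OF *(2,7)], of "r2 + s2"])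
        (use * real_triangle[OF *(2,7)] in \<open>auto simp: p_def algebra_simps\<close>)
  next
    case (5 f r t)
    then obtain f1 f2 r1 r2 where *: "(f1, r1) \<in> K" "f2 \<in> V" "p f2 \<le> r2"
      "f = (\<lambda>x. f1 x + f2 x)" "r = r1 + r2"
      unfolding L_def by blast
    show ?case
      by (rule LI[OF K_scale[OF *(1) 5(3)] scale_closed[OF *(2)], of "complex_of_real t" "t * r2"])
        (use * 5(3) real_homogeneous[OF *(2)] in \<open>auto simp: p_def algebra_simps\<close>)
  next
    case (6 r)
    then obtain f1 f2 r1 r2 where *: "(f1, r1) \<in> K" "f2 \<in> V" "p f2 \<le> r2"
      "(\<lambda>_. 0) = (\<lambda>x. f1 x + f2 x)" "r = r1 + r2"
      unfolding L_def by blast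
    have "f2 = (\<lambda>x. -1 * f1 x)"
      using *(4) by (auto simp: fun_eq_iff eq_neg_iff_add_eq_0 add.commute)
    then have "p f2 = p f1"
      using real_homogeneous[OF K_sub[OF *(1)], of "-1"] by (simp add: p_def)
    then show ?case using K_bound[OF *(1)] *(3,5) by (simp add: p_def)
  next
    case (7 r)
    then show ?case by (intro LN zero_closed) (simp add: pz)
  next
    case (8 f)
    then show ?case using LN by blast
  next
    case (9 l)
    show ?case by (rule 9(1)[of l]) (use 9(2-) in blast)+
  qed
  \<comment> \<open>The complex linear functional with real part l. Rotating \<phi> f to a
    nonnegative number later transfers the bound on l to |\<phi> f| without loss.\<close>
  define \<phi> where "\<phi> f = complex_of_real (l f) - \<i> * complex_of_real (l (\<lambda>x. \<i> * f x))" for f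
  have Re_\<phi>: "Re (\<phi> f) = l f" for f by (simp add: \<phi>_def)
  have \<phi>_add: "\<phi> (\<lambda>x. f x + g x) = \<phi> f + \<phi> g" if "f \<in> V" "g \<in> V" for f g
    using add[OF that] add[OF scale_closed[OF that(1), of \<i>] scale_closed[OF that(2), of \<i>]]
    by (simp add: \<phi>_def algebra_simps)
  have \<phi>_scale: "\<phi> (\<lambda>x. c * f x) = c * \<phi> f" if f: "f \<in> V" for c f
  proof -
    have 1: "l (\<lambda>x. c * f x) = Re c * l f + Im c * l (\<lambda>x. \<i> * f x)" for c
    proof -
      have "l (\<lambda>x. c * f x) = l (\<lambda>x. complex_of_real (Re c) * f x + complex_of_real (Im c) * (\<i> * f x))"
        by (intro arg_cong[of _ _ l] ext) (subst (1) complex_eq[of c], simp add: algebra_simps)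
      also have "\<dots> = Re c * l f + Im c * l (\<lambda>x. \<i> * f x)"
        using f by (simp add: add scale scale_closed)
      finally show ?thesis .
    qed
    have "l (\<lambda>x. \<i> * (c * f x)) = l (\<lambda>x. (\<i> * c) * f x)" by (simp add: mult.assoc)
    then show ?thesis
      using 1[of c] 1[of "\<i> * c"] by (auto simp: \<phi>_def complex_eq_iff algebra_simps)
  qed
  have \<phi>_bound: "cmod (\<phi> f) \<le> enn2real (N f)" if f: "f \<in> V" for f
  proof -
    obtain c where c: "cmod c = 1" "c * \<phi> f = complex_of_real (cmod (\<phi> f))"
      using cmod_eq_mult_phase by blast
    have "cmod (\<phi> f) = Re (\<phi> (\<lambda>x. c * f x))" using \<phi>_scale[OF f, of c] c by simp
    also have "\<dots> \<le> p (\<lambda>x. c * f x)"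
      unfolding Re_\<phi> using scale_closed[OF f] by (intro le LN) auto
    also have "\<dots> = enn2real (N f)" using c real_homogeneous[OF f, of c] by (simp add: p_def)
    finally show ?thesis .
  qed
  show thesis
    by (rule that[of \<phi>]) (use \<phi>_add \<phi>_scale \<phi>_bound le LK in \<open>auto simp: Re_\<phi>\<close>)
qed

lemma dual_spaceI:
  assumes "\<And>f g. f \<in> V \<Longrightarrow> g \<in> V \<Longrightarrow> \<phi> (\<lambda>x. f x + g x) = \<phi> f + \<phi> g"
    and "\<And>c f. f \<in> V \<Longrightarrow> \<phi> (\<lambda>x. c * f x) = c * \<phi> f"
    and "\<And>f. f \<in> V \<Longrightarrow> cmod (\<phi> f) \<le> C * enn2real (N f)" and "0 \<le> C"
  shows "(\<lambda>f. if f \<in> V then \<phi> f else 0) \<in> dual_space V N"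
proof -
  have "ennreal (cmod (\<phi> f)) \<le> ennreal C * N f" if "f \<in> V" for f
    using ennreal_leI[OF assms(3)[OF that]] ennreal_real[OF that] assms(4) by (simp add: ennreal_mult)
  then show ?thesis
    unfolding dual_space_def using assms add_closed scale_closed by auto
qed

text \<open>The constraints are Re (\<phi> w) \<le> 0 on \<open>W\<close> and Re (\<phi> (- f0))
  \<le> - d. The first forces \<phi> w = 0, since w may be multiplied by any phase; compatibility
  with N is the distance hypothesis, scaled by t.\<close>

lemma separate_subspace:
  assumes W: "W \<subseteq> V" "(\<lambda>_. 0) \<in> W" "\<And>f g. f \<in> W \<Longrightarrow> g \<in> W \<Longrightarrow> (\<lambda>x. f x + g x) \<in> W"
      "\<And>c f. f \<in> W \<Longrightarrow> (\<lambda>x. c * f x) \<in> W"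
    and f0: "f0 \<in> V" and d: "0 \<le> d" "\<And>w. w \<in> W \<Longrightarrow> ennreal d \<le> N (\<lambda>x. f0 x - w x)"
  obtains \<phi> where "\<phi> \<in> dual_space V N" "\<And>f. f \<in> V \<Longrightarrow> cmod (\<phi> f) \<le> enn2real (N f)"
    "\<And>w. w \<in> W \<Longrightarrow> \<phi> w = 0" "d \<le> Re (\<phi> f0)"
proof -
  define K where "K = {((\<lambda>x. w x - complex_of_real t * f0 x), - t * d) |w t. w \<in> W \<and> 0 \<le> t}"
  have KI: "(h, s) \<in> K" if "w \<in> W" "0 \<le> t" "h = (\<lambda>x. w x - complex_of_real t * f0 x)" "s = - t * d" for h s w t
    unfolding K_def using that by blast
  have WV: "w \<in> V" if "w \<in> W" for w using W(1) that by blast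
  obtain \<phi> where \<phi>: "\<And>f g. f \<in> V \<Longrightarrow> g \<in> V \<Longrightarrow> \<phi> (\<lambda>x. f x + g x) = \<phi> f + \<phi> g"
    "\<And>c f. f \<in> V \<Longrightarrow> \<phi> (\<lambda>x. c * f x) = c * \<phi> f"
    "\<And>f. f \<in> V \<Longrightarrow> cmod (\<phi> f) \<le> enn2real (N f)"
    "\<And>f r. (f, r) \<in> K \<Longrightarrow> Re (\<phi> f) \<le> r"
  proof (rule dominated_functional[of K], goal_cases)
    case (1 f r)
    then show ?case unfolding K_def using WV diff_closed scale_closed f0 by blast
  next
    case (2 f g r s)
    then obtain w t v u where *: "w \<in> W" "0 \<le> t" "f = (\<lambda>x. w x - complex_of_real t * f0 x)" "r = - t * d"
      "v \<in> W" "0 \<le> u" "g = (\<lambda>x. v x - complex_of_real u * f0 x)" "s = - u * d"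
      unfolding K_def by blast
    show ?case by (rule KI[OF W(3)[OF *(1,5)], of "t + u"]) (use * in \<open>auto simp: algebra_simps\<close>)
  next
    case (3 f r u)
    then obtain w t where *: "w \<in> W" "0 \<le> t" "f = (\<lambda>x. w x - complex_of_real t * f0 x)" "r = - t * d"
      unfolding K_def by blast
    show ?case by (rule KI[OF W(4)[OF *(1)], of "u * t" _ "complex_of_real u"]) (use *(2-) 3(3) in \<open>auto simp: algebra_simps intro: mult_nonneg_nonneg less_imp_le\<close>)
  next
    case 4
    show ?case by (rule KI[OF W(2), of 0]) auto
  next
    case (5 f r)
    then obtain w t where *: "w \<in> W" "0 \<le> t" "f = (\<lambda>x. w x - complex_of_real t * f0 x)" "r = - t * d"
      unfolding K_def by blast
    show ?case
    proof (cases "t = 0")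
      case False
      let ?v = "\<lambda>x. complex_of_real (1 / t) * w x"
      have v: "?v \<in> W" using W(4) *(1) by blast
      have "f = (\<lambda>x. complex_of_real (- t) * (f0 x - ?v x))"
        by (rule ext) (use False in \<open>simp add: *(3) right_diff_distrib\<close>)
      then have "enn2real (N f) = t * enn2real (N (\<lambda>x. f0 x - ?v x))"
        using real_homogeneous[OF diff_closed[OF f0 WV[OF v]], of "complex_of_real (- t)"] *(2) by simp
      moreover have "d \<le> enn2real (N (\<lambda>x. f0 x - ?v x))"
        using d(2)[OF v] ennreal_real[OF diff_closed[OF f0 WV[OF v]]]
        by (metis d(1) enn2real_nonneg ennreal_le_iff)
      ultimately show ?thesis using *(2,4) by (simp add: mult_left_mono)
    qed (use * in auto)
  qed auto
  have "\<phi> w = 0" if w: "w \<in> W" for w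
  proof -
    obtain c where c: "cmod c = 1" "c * \<phi> w = complex_of_real (cmod (\<phi> w))"
      using cmod_eq_mult_phase by blast
    have "((\<lambda>x. c * w x), 0) \<in> K" by (rule KI[OF W(4)[OF w], of 0 _ c]) auto
    then have "Re (\<phi> (\<lambda>x. c * w x)) \<le> 0" by (rule \<phi>(4))
    then show ?thesis using \<phi>(2)[OF WV[OF w], of c] c by simp
  qed
  moreover have "d \<le> Re (\<phi> f0)"
  proof -
    have "((\<lambda>x. -1 * f0 x), - d) \<in> K" by (rule KI[OF W(2), of 1]) auto
    then have "Re (\<phi> (\<lambda>x. -1 * f0 x)) \<le> - d" by (rule \<phi>(4))
    then show ?thesis using \<phi>(2)[OF f0, of "-1"] by simp
  qed
  ultimately show thesis
    using that[of "\<lambda>f. if f \<in> V then \<phi> f else 0"] dual_spaceI[of \<phi> 1] \<phi> WV f0 by auto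
qed

text \<open>Separation from the zero subspace at distance N f0: then |\<phi> f0| \<le> N f0 \<le> Re
  (\<phi> f0), and all three agree.\<close>

lemma norming_functional:
  assumes "f0 \<in> V"
  obtains \<phi> where "\<phi> \<in> dual_space V N" "\<And>f. f \<in> V \<Longrightarrow> cmod (\<phi> f) \<le> enn2real (N f)"
    "\<phi> f0 = enn2real (N f0)"
proof -
  obtain \<phi> where \<phi>: "\<phi> \<in> dual_space V N" "\<And>f. f \<in> V \<Longrightarrow> cmod (\<phi> f) \<le> enn2real (N f)"
    "enn2real (N f0) \<le> Re (\<phi> f0)"
    by (rule separate_subspace[of "{\<lambda>_. 0}" f0 "enn2real (N f0)"])
      (use assms zero_closed ennreal_real in auto)
  moreover have "\<phi> f0 = enn2real (N f0)"
  proof -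
    have "cmod (\<phi> f0) \<le> Re (\<phi> f0)" using \<phi>(2)[OF assms] \<phi>(3) by linarith
    then have "Im (\<phi> f0) = 0"
      using complex_Re_le_cmod[of "\<phi> f0"] cmod_power2[of "\<phi> f0"] by (simp add: order_antisym)
    then have "\<phi> f0 = complex_of_real (Re (\<phi> f0))"
      by (simp add: complex_eq_iff)
    then show ?thesis using \<phi>(2)[OF assms] \<phi>(3)
      by (metis complex_Re_le_cmod order_antisym order_trans)
  qed
  ultimately show thesis using that by blast
qed

text \<open>The constraint cone is the graph of the real part of \<psi>, divided by the bound B
  because \<open>dominated_functional\<close> yields functionals of bound 1; the result is
  multiplied by B again.\<close>

lemma extend_functional:
  assumes W: "W \<subseteq> V" "(\<lambda>_. 0) \<in> W" "\<And>f g. f \<in> W \<Longrightarrow> g \<in> W \<Longrightarrow> (\<lambda>x. f x + g x) \<in> W"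
      "\<And>c f. f \<in> W \<Longrightarrow> (\<lambda>x. c * f x) \<in> W"
    and \<psi>: "\<psi> \<in> dual_space W N"
  obtains \<phi> where "\<phi> \<in> dual_space V N" "\<And>w. w \<in> W \<Longrightarrow> \<phi> w = \<psi> w"
proof -
  have WV: "w \<in> V" if "w \<in> W" for w using W(1) that by blast
  obtain C where \<psi>_add: "\<And>f g. f \<in> W \<Longrightarrow> g \<in> W \<Longrightarrow> \<psi> (\<lambda>x. f x + g x) = \<psi> f + \<psi> g"
    and \<psi>_scale: "\<And>c f. f \<in> W \<Longrightarrow> \<psi> (\<lambda>x. c * f x) = c * \<psi> f"
    and C: "\<And>f. f \<in> W \<Longrightarrow> ennreal (cmod (\<psi> f)) \<le> ennreal C * N f"
    using \<psi> unfolding dual_space_def by blast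
  \<comment> \<open>\<open>C\<close> is an arbitrary real number, possibly 0 or negative; B is a
    bound that can be divided by.\<close>
  define B where "B = max C 1"
  have B: "0 < B" by (simp add: B_def)
  have bound: "cmod (\<psi> w) \<le> B * enn2real (N w)" if w: "w \<in> W" for w
  proof -
    have "ennreal (cmod (\<psi> w)) \<le> ennreal B * N w"
      using C[OF w] by (rule order_trans) (auto intro!: mult_right_mono ennreal_leI simp: B_def)
    also have "\<dots> = ennreal (B * enn2real (N w))"
      using ennreal_real[OF WV[OF w]] B by (simp add: ennreal_mult)
    finally show ?thesis using B by (simp add: ennreal_le_iff)
  qed
  define K where "K = {(w, Re (\<psi> w) / B) |w. w \<in> W}"
  obtain \<phi> where \<phi>: "\<And>f g. f \<in> V \<Longrightarrow> g \<in> V \<Longrightarrow> \<phi> (\<lambda>x. f x + g x) = \<phi> f + \<phi> g"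
    "\<And>c f. f \<in> V \<Longrightarrow> \<phi> (\<lambda>x. c * f x) = c * \<phi> f"
    "\<And>f. f \<in> V \<Longrightarrow> cmod (\<phi> f) \<le> enn2real (N f)"
    "\<And>f r. (f, r) \<in> K \<Longrightarrow> Re (\<phi> f) \<le> r"
  proof (rule dominated_functional[of K], goal_cases)
    case (1 f r)
    then show ?case using WV by (auto simp: K_def)
  next
    case (2 f g r s)
    then show ?case using W(3) \<psi>_add by (auto simp: K_def add_divide_distrib)
  next
    case (3 f r t)
    then show ?case using W(4) \<psi>_scale by (auto simp: K_def)
  next
    case 4
    show ?case using W(2) \<psi>_scale[OF W(2), of 0] by (force simp: K_def)
  next
    case (5 f r)
    then have f: "f \<in> W" and r: "r = Re (\<psi> f) / B" by (auto simp: K_def)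
    have "- Re (\<psi> f) \<le> B * enn2real (N f)"
      using bound[OF f] abs_Re_le_cmod[of "\<psi> f"] by linarith
    then show ?case unfolding r using B by (simp add: field_simps)
  qed auto
  have eq: "B * \<phi> w = \<psi> w" if w: "w \<in> W" for w
  proof -
    \<comment> \<open>Used at c = 1, -1, i and -i, the inequality becomes equality of real and
      imaginary parts.\<close>
    have 1: "B * Re (c * \<phi> w) \<le> Re (c * \<psi> w)" for c
    proof -
      have "Re (\<phi> (\<lambda>x. c * w x)) \<le> Re (\<psi> (\<lambda>x. c * w x)) / B"
        by (rule \<phi>(4)) (use W(4)[OF w] in \<open>auto simp: K_def\<close>)
      then show ?thesis
        using B \<phi>(2)[OF WV[OF w], of c] \<psi>_scale[OF w, of c] by (simp add: field_simps)
    qed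
    show ?thesis
      using 1[of 1] 1[of "-1"] 1[of \<i>] 1[of "- \<i>"] by (simp add: complex_eq_iff)
  qed
  have "(\<lambda>f. if f \<in> V then B * \<phi> f else 0) \<in> dual_space V N"
    by (rule dual_spaceI[of "\<lambda>f. B * \<phi> f" B])
      (use \<phi> B in \<open>auto simp: algebra_simps norm_mult mult_left_mono\<close>)
  then show thesis
    by (rule that) (use eq WV in auto)
qed

end

section \<open>Normalized arc length\<close>

lemma space_circle [simp]: "space circle_measure = sphere 0 1"
  by (simp add: circle_measure_def space_restrict_space)

lemma sets_circle: "sets circle_measure = sets (restrict_space borel (sphere 0 1))"
  by (simp add: circle_measure_def)

lemma measurable_cis: "cis \<in> measurable M (restrict_space borel (sphere 0 1))" if "sets M = sets borel"
  using borel_measurable_continuous_onI[OF continuous_on_cis[OF continuous_on_id]]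
  by (auto intro!: measurable_restrict_space2 simp: measurable_cong_sets[OF that refl])

lemma prob_space_uniform: "prob_space (uniform_measure lborel {0..2 * pi})"
  by (rule prob_space_uniform_measure) (auto simp: ennreal_eq_0_iff not_le)

lemma prob_space_circle: "prob_space circle_measure"
  unfolding circle_measure_def
  by (intro prob_space.prob_space_distr prob_space_uniform measurable_cis) simp

interpretation circle: prob_space circle_measure
  by (rule prob_space_circle)

text \<open>The half-open interval is a fundamental domain of \<open>cis\<close>; its translates can
  be cut and reassembled without overlap.\<close>

lemma nn_integral_circle:
  assumes "f \<in> borel_measurable circle_measure"
  shows "(\<integral>\<^sup>+z. f z \<partial>circle_measure)
           = (\<integral>\<^sup>+x. f (cis x) * indicator {0..<2 * pi} x \<partial>lborel) / ennreal (2 * pi)"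
proof -
  have f: "f \<in> borel_measurable (restrict_space borel (sphere 0 1))"
    using assms unfolding measurable_cong_sets[OF sets_circle refl] .
  have c: "cis \<in> measurable borel (restrict_space borel (sphere 0 1))"
    by (rule measurable_cis) simp
  have "(\<integral>\<^sup>+z. f z \<partial>circle_measure) = (\<integral>\<^sup>+x. f (cis x) \<partial>uniform_measure lborel {0..2 * pi})"
    unfolding circle_measure_def
    using f by (intro nn_integral_distr measurable_cis) (simp_all cong: measurable_cong_sets)
  also have "\<dots> = (\<integral>\<^sup>+x. f (cis x) * indicator {0..2 * pi} x \<partial>lborel) / ennreal (2 * pi)"
    using measurable_compose[OF c f] by (subst nn_integral_uniform_measure) auto
  also have "(\<integral>\<^sup>+x. f (cis x) * indicator {0..2 * pi} x \<partial>lborel)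
      = (\<integral>\<^sup>+x. f (cis x) * indicator {0..<2 * pi} x \<partial>lborel)"
    using AE_lborel_singleton[of "2 * pi"]
    by (intro nn_integral_cong_AE) (auto split: split_indicator)
  finally show ?thesis .
qed

text \<open>Joint measurability makes Fubini available for averages over all rotations.\<close>

lemma measurable_mult_circle:
  "(\<lambda>(w, z). w * z) \<in> measurable (circle_measure \<Otimes>\<^sub>M circle_measure) circle_measure"
proof -
  have i: "(\<lambda>z. z) \<in> borel_measurable circle_measure"
    unfolding measurable_cong_sets[OF sets_circle refl] by (intro measurable_restrict_space1) simp
  have "(\<lambda>p. fst p * snd p) \<in> borel_measurable (circle_measure \<Otimes>\<^sub>M circle_measure)"
    by (intro borel_measurable_times measurable_compose[OF measurable_fst i]
      measurable_compose[OF measurable_snd i])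
  then have "(\<lambda>(w, z). w * z) \<in> measurable (circle_measure \<Otimes>\<^sub>M circle_measure) (restrict_space borel (sphere 0 1))"
    by (intro measurable_restrict_space2) (auto simp: space_pair_measure norm_mult split_beta)
  then show ?thesis unfolding measurable_cong_sets[OF refl sets_circle] .
qed

lemma measurable_rotate:
  assumes "w \<in> sphere 0 1"
  shows "(\<lambda>z. w * z) \<in> measurable circle_measure circle_measure"
  using measurable_Pair2[OF measurable_mult_circle, of w] assms by simp

text \<open>With w = \<open>cis t\<close> the rotation becomes a shift by t. The shifted interval is
  cut at 2 pi, and the part beyond is moved back by one period.\<close>

lemma nn_integral_rotate:
  assumes f: "f \<in> borel_measurable circle_measure" and w: "w \<in> sphere 0 1"
  shows "(\<integral>\<^sup>+z. f (w * z) \<partial>circle_measure) = (\<integral>\<^sup>+z. f z \<partial>circle_measure)"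
proof -
  obtain t where t: "w = cis t" "0 \<le> t" "t < 2 * pi"
    using w complex_unimodular_polar[of w] by (auto simp: cis.code Complex_eq)
  define g where "g x = f (cis x)" for x
  have "f \<in> borel_measurable (restrict_space borel (sphere 0 1))"
    using f unfolding measurable_cong_sets[OF sets_circle refl] .
  from measurable_compose[OF measurable_cis this, of borel]
  have g [measurable]: "g \<in> borel_measurable borel" by (simp add: g_def[abs_def])
  have per: "g (x + 2 * pi) = g x" for x
    by (simp add: g_def cis.code)
  have 1: "(\<integral>\<^sup>+x. g (x + t) * indicator {0..<2 * pi} x \<partial>lborel)
      = (\<integral>\<^sup>+x. g x * indicator {t..<t + 2 * pi} x \<partial>lborel)"
    by (subst nn_integral_real_affine[where c = 1 and t = t])
      (auto simp: add.commute intro!: nn_integral_cong split: split_indicator)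
  also have "\<dots> = (\<integral>\<^sup>+x. g x * indicator {t..<2 * pi} x + g x * indicator {2 * pi..<t + 2 * pi} x \<partial>lborel)"
    using t by (intro nn_integral_cong) (auto split: split_indicator)
  also have "\<dots> = (\<integral>\<^sup>+x. g x * indicator {t..<2 * pi} x \<partial>lborel) + (\<integral>\<^sup>+x. g x * indicator {2 * pi..<t + 2 * pi} x \<partial>lborel)"
    by (intro nn_integral_add) auto
  also have "(\<integral>\<^sup>+x. g x * indicator {2 * pi..<t + 2 * pi} x \<partial>lborel) = (\<integral>\<^sup>+x. g x * indicator {0..<t} x \<partial>lborel)"
    by (subst nn_integral_real_affine[where c = 1 and t = "2 * pi"])
      (auto simp: add.commute[of "2 * pi"] per intro!: nn_integral_cong split: split_indicator)
  also have "(\<integral>\<^sup>+x. g x * indicator {t..<2 * pi} x \<partial>lborel) + (\<integral>\<^sup>+x. g x * indicator {0..<t} x \<partial>lborel)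
      = (\<integral>\<^sup>+x. g x * indicator {t..<2 * pi} x + g x * indicator {0..<t} x \<partial>lborel)"
    by (intro nn_integral_add[symmetric]) auto
  also have "\<dots> = (\<integral>\<^sup>+x. g x * indicator {0..<2 * pi} x \<partial>lborel)"
    using t by (intro nn_integral_cong) (auto split: split_indicator)
  finally show ?thesis
    using measurable_compose[OF measurable_rotate[OF w] f]
    by (simp add: nn_integral_circle f g_def t cis_mult add.commute)
qed

lemma distr_rotate:
  assumes w: "w \<in> sphere 0 1"
  shows "distr circle_measure circle_measure (\<lambda>z. w * z) = circle_measure"
proof (rule measure_eqI)
  fix A assume "A \<in> sets (distr circle_measure circle_measure (\<lambda>z. w * z))"
  then have A: "A \<in> sets circle_measure" by simp
  have "emeasure (distr circle_measure circle_measure (\<lambda>z. w * z)) A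
      = (\<integral>\<^sup>+z. indicator A (w * z) \<partial>circle_measure)"
    using A measurable_rotate[OF w]
    by (subst nn_integral_indicator[symmetric]) (auto simp: nn_integral_distr simp del: nn_integral_indicator)
  also have "\<dots> = emeasure circle_measure A"
    using A by (subst nn_integral_rotate[OF _ w]) auto
  finally show "emeasure (distr circle_measure circle_measure (\<lambda>z. w * z)) A = emeasure circle_measure A" .
qed simp

section \<open>Rotationally symmetric seminorms\<close>

abbreviation \<mu> :: "complex measure" where "\<mu> \<equiv> circle_measure"

lemma borel_measurable_cnj [measurable]: "cnj \<in> borel_measurable borel"
  by (intro borel_measurable_continuous_onI continuous_intros)

section \<open>Bounded measurable functions on the circle\<close>

lemma Linf_measurable [measurable_dest]: "f \<in> Linf \<Longrightarrow> f \<in> borel_measurable \<mu>"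
  by (simp add: Linf_def)

lemma LinfI:
  assumes "f \<in> borel_measurable \<mu>" "AE z in \<mu>. cmod (f z) \<le> C"
  shows "f \<in> Linf"
  using assms by (auto simp: Linf_def)

lemma LinfE:
  assumes "f \<in> Linf"
  obtains C where "0 < C" "AE z in \<mu>. cmod (f z) \<le> C"
proof -
  obtain C where "AE z in \<mu>. cmod (f z) \<le> C" using assms by (auto simp: Linf_def)
  then have "AE z in \<mu>. cmod (f z) \<le> max C 1" by eventually_elim simp
  then show thesis by (rule that[rotated]) simp
qed

lemma Linf_const [simp]: "(\<lambda>_. c) \<in> Linf"
  by (rule LinfI[of _ "cmod c"]) auto

lemma Linf_dominated:
  assumes "f \<in> borel_measurable \<mu>" "g \<in> Linf" "AE z in \<mu>. cmod (f z) \<le> cmod (g z)"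
  shows "f \<in> Linf"
proof -
  obtain C where "AE z in \<mu>. cmod (g z) \<le> C" using LinfE[OF assms(2)] .
  with assms(3) have "AE z in \<mu>. cmod (f z) \<le> C" by eventually_elim simp
  then show ?thesis using assms(1) by (rule LinfI[rotated])
qed

lemma Linf_add [simp]: "(\<lambda>z. f z + g z) \<in> Linf" if f: "f \<in> Linf" and g: "g \<in> Linf"
proof -
  note [measurable] = f g
  obtain C where C: "AE z in \<mu>. cmod (f z) \<le> C" using LinfE[OF f] .
  obtain D where D: "AE z in \<mu>. cmod (g z) \<le> D" using LinfE[OF g] .
  have "AE z in \<mu>. cmod (f z + g z) \<le> C + D"
    using C D by eventually_elim (rule norm_triangle_mono)
  then show ?thesis by (rule LinfI[rotated]) measurable
qed

lemma Linf_mult [simp]: "(\<lambda>z. f z * g z) \<in> Linf" if f: "f \<in> Linf" and g: "g \<in> Linf"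
proof -
  note [measurable] = f g
  obtain C where C: "AE z in \<mu>. cmod (f z) \<le> C" using LinfE[OF f] .
  obtain D where D: "0 < D" "AE z in \<mu>. cmod (g z) \<le> D" using LinfE[OF g] .
  have "AE z in \<mu>. cmod (f z * g z) \<le> C * D"
    using C D(2)
  proof eventually_elim
    case (elim z)
    then have "0 \<le> C" using norm_ge_zero order_trans by blast
    then show ?case using elim by (auto simp: norm_mult intro: mult_mono)
  qed
  then show ?thesis by (rule LinfI[rotated]) measurable
qed

lemma Linf_divide [simp]: "(\<lambda>z. f z / c) \<in> Linf" if "f \<in> Linf"
  using Linf_mult[OF that Linf_const[of "1 / c"]] by simp

lemma Linf_diff [simp]: "(\<lambda>z. f z - g z) \<in> Linf" if "f \<in> Linf" "g \<in> Linf"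
  using Linf_add[OF that(1) Linf_mult[OF Linf_const[of "-1"] that(2)]] by simp

lemma Linf_cmod [simp]: "(\<lambda>z. complex_of_real (cmod (f z))) \<in> Linf" if "f \<in> Linf"
  using that by (intro Linf_dominated[OF _ that]) auto

lemma Linf_indicator [simp]: "indicator A \<in> Linf" if "A \<in> sets \<mu>"
  using that by (intro LinfI[of _ 1]) (auto split: split_indicator)

lemma Linf_simple: "s \<in> Linf" if "simple_function \<mu> s"
proof -
  have "finite (s ` space \<mu>)" using that by (simp add: simple_function_def)
  then have "bdd_above (cmod ` s ` space \<mu>)" by (intro bdd_above_finite finite_imageI[of "s ` space \<mu>"])
  then obtain C where "\<And>z. z \<in> space \<mu> \<Longrightarrow> cmod (s z) \<le> C"
    by (auto simp: bdd_above_def simp del: space_circle)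
  then show ?thesis
    using borel_measurable_simple_function[OF that] by (intro LinfI[of _ C] AE_I2)
qed

lemma Linf_rotate [simp]: "(\<lambda>z. f (w * z)) \<in> Linf" if f: "f \<in> Linf" and w: "w \<in> sphere 0 1"
proof -
  obtain C where C: "AE z in \<mu>. cmod (f z) \<le> C" using LinfE[OF f] .
  have "AE z in distr \<mu> \<mu> (\<lambda>z. w * z). cmod (f z) \<le> C"
    using C unfolding distr_rotate[OF w] .
  then have "AE z in \<mu>. cmod (f (w * z)) \<le> C"
    using Linf_measurable[OF f] by (subst (asm) AE_distr_iff[OF measurable_rotate[OF w]]) measurable
  then show ?thesis
    using measurable_compose[OF measurable_rotate[OF w] Linf_measurable[OF f]] by (rule LinfI[rotated])
qed

lemma integrable_Linf [simp]: "integrable \<mu> f" if f: "f \<in> Linf"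
proof -
  obtain C where C: "AE z in \<mu>. cmod (f z) \<le> C" using LinfE[OF f] .
  then show ?thesis using f by (intro circle.integrable_const_bound[of f C]) auto
qed

lemma integrable_mult_Linf:
  assumes f: "f \<in> Linf" and h: "integrable \<mu> h"
  shows "integrable \<mu> (\<lambda>z. f z * h z)"
proof -
  obtain C where C: "0 < C" "AE z in \<mu>. cmod (f z) \<le> C" using LinfE[OF f] .
  have le: "AE z in \<mu>. norm (f z * h z) \<le> norm (complex_of_real C * h z)"
    using C(2) by eventually_elim (use C(1) in \<open>auto simp: norm_mult intro: mult_right_mono\<close>)
  have "(\<lambda>z. f z * h z) \<in> borel_measurable \<mu>"
    using Linf_measurable[OF f] borel_measurable_integrable[OF h] by (rule borel_measurable_times)
  then show ?thesis
    by (rule Bochner_Integration.integrable_bound[OF integrable_mult_right[OF h, of "complex_of_real C"] _ le])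
qed

lemma simple_approximation:
  assumes f: "f \<in> Linf" and e: "0 < e"
  obtains s where "simple_function \<mu> s" "AE z in \<mu>. cmod (s z) \<le> cmod (f z)"
    "AE z in \<mu>. cmod (f z - s z) \<le> e"
proof -
  note [measurable] = f
  obtain C where C: "0 < C" "AE z in \<mu>. cmod (f z) \<le> C" using LinfE[OF f] .
  \<comment> \<open>Rounding towards 0 on the grid of mesh e / 2: this keeps |s| \<le> |f|, as
    \<open>gauge_ext\<close> requires, and the errors in the real and the imaginary part add up to
    at most e.\<close>
  define q where "q x = sgn x * (of_int \<lfloor>\<bar>x\<bar> / (e / 2)\<rfloor> * (e / 2))" for x :: real
  have q_abs: "\<bar>q x\<bar> = of_int \<lfloor>\<bar>x\<bar> / (e / 2)\<rfloor> * (e / 2)" for x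
    using e by (auto simp: q_def abs_mult sgn_if)
  have fl: "of_int \<lfloor>\<bar>x\<bar> / (e / 2)\<rfloor> * (e / 2) \<le> \<bar>x\<bar>" "\<bar>x\<bar> \<le> of_int \<lfloor>\<bar>x\<bar> / (e / 2)\<rfloor> * (e / 2) + e / 2" for x :: real
  proof -
    have "0 < e / 2" using e by simp
    then show "of_int \<lfloor>\<bar>x\<bar> / (e / 2)\<rfloor> * (e / 2) \<le> \<bar>x\<bar>"
      by (subst pos_le_divide_eq[symmetric]) (auto simp: of_int_floor_le)
    have "\<bar>x\<bar> / (e / 2) \<le> of_int \<lfloor>\<bar>x\<bar> / (e / 2)\<rfloor> + 1" by linarith
    then have "\<bar>x\<bar> \<le> (of_int \<lfloor>\<bar>x\<bar> / (e / 2)\<rfloor> + 1) * (e / 2)"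
      using \<open>0 < e / 2\<close> by (simp only: pos_divide_le_eq)
    then show "\<bar>x\<bar> \<le> of_int \<lfloor>\<bar>x\<bar> / (e / 2)\<rfloor> * (e / 2) + e / 2" by (simp only: distrib_right mult_1)
  qed
  have q_le: "\<bar>q x\<bar> \<le> \<bar>x\<bar>" for x using fl(1) by (simp add: q_abs)
  have q_close: "\<bar>x - q x\<bar> \<le> e / 2" for x
    using fl[of x] by (auto simp: q_def sgn_if abs_if split: if_splits)
  \<comment> \<open>Replacing f by 0 on the null set where it exceeds C gives \<open>s\<close>
    finitely many values everywhere, as \<open>simple_function\<close> demands.\<close>
  define g where "g z = (if cmod (f z) \<le> C then f z else 0)" for z
  have [measurable]: "g \<in> borel_measurable \<mu>" unfolding g_def by measurable
  define s where "s z = Complex (q (Re (g z))) (q (Im (g z)))" for z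
  have "q \<in> borel_measurable borel" unfolding q_def by measurable
  then have [measurable]: "s \<in> borel_measurable \<mu>"
    unfolding s_def Complex_eq by measurable
  define Q where "Q = (\<lambda>k::int. of_int k * (e / 2)) ` {- \<lceil>C / (e / 2)\<rceil>..\<lceil>C / (e / 2)\<rceil>}"
  have qQ: "q x \<in> Q" if "\<bar>x\<bar> \<le> C" for x
  proof -
    define k where "k = \<lfloor>\<bar>x\<bar> / (e / 2)\<rfloor>"
    define m where "m = \<lceil>C / (e / 2)\<rceil>"
    have "\<bar>x\<bar> / (e / 2) \<le> C / (e / 2)" using that e by (intro divide_right_mono) auto
    then have "k \<le> m" unfolding k_def m_def by linarith
    moreover have "0 \<le> k" unfolding k_def using e by simp
    moreover have "q x = of_int (if x = 0 then 0 else if 0 < x then k else - k) * (e / 2)"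
      by (simp add: q_def k_def sgn_if)
    ultimately show ?thesis unfolding Q_def m_def[symmetric]
      by (intro image_eqI[where x = "if x = 0 then 0 else if 0 < x then k else - k"]) auto
  qed
  have "s ` space \<mu> \<subseteq> (\<lambda>(a, b). Complex a b) ` (Q \<times> Q)"
  proof clarify
    fix z
    have "cmod (g z) \<le> C" using C by (simp add: g_def)
    then have "\<bar>Re (g z)\<bar> \<le> C" "\<bar>Im (g z)\<bar> \<le> C"
      using abs_Re_le_cmod abs_Im_le_cmod order_trans by blast+
    then show "s z \<in> (\<lambda>(a, b). Complex a b) ` (Q \<times> Q)" using qQ by (auto simp: s_def)
  qed
  moreover have "finite Q" by (simp add: Q_def)
  ultimately have "finite (s ` space \<mu>)" by (meson finite_SigmaI finite_imageI finite_subset)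
  then have "simple_function \<mu> s" by (intro simple_function_borel_measurable) auto
  moreover have "AE z in \<mu>. cmod (s z) \<le> cmod (f z)"
    using C(2)
  proof eventually_elim
    case (elim z)
    then have "g z = f z" by (simp add: g_def)
    then show ?case unfolding s_def cmod_def
      using power_mono[OF q_le[of "Re (f z)"], of 2] power_mono[OF q_le[of "Im (f z)"], of 2] by simp
  qed
  moreover have "AE z in \<mu>. cmod (f z - s z) \<le> e"
    using C(2)
  proof eventually_elim
    case (elim z)
    then have "g z = f z" by (simp add: g_def)
    then show ?case
      using cmod_le[of "f z - s z"] q_close[of "Re (f z)"] q_close[of "Im (f z)"] by (simp add: s_def)
  qed
  ultimately show thesis by (rule that)
qed

section \<open>Monotonicity of a gauge and its extension to unbounded functions\<close>

locale rot_gauge =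
  fixes \<alpha> :: "(complex \<Rightarrow> complex) \<Rightarrow> ennreal"
  assumes rot_sym: "\<alpha> \<in> rot_sym_seminorms"
begin

lemma gauge_cong: "\<alpha> f = \<alpha> g" if "f \<in> Linf" "g \<in> Linf" "AE z in \<mu>. f z = g z"
  using rot_sym that unfolding rot_sym_seminorms_def by blast

lemma gauge_finite: "\<alpha> f < \<infinity>" if "f \<in> Linf"
  using rot_sym that unfolding rot_sym_seminorms_def by blast

lemma gauge_add: "\<alpha> (\<lambda>z. f z + g z) \<le> \<alpha> f + \<alpha> g" if "f \<in> Linf" "g \<in> Linf"
  using rot_sym that unfolding rot_sym_seminorms_def by blast

lemma gauge_scale: "\<alpha> (\<lambda>z. c * f z) = ennreal (cmod c) * \<alpha> f" if "f \<in> Linf"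
  using rot_sym that unfolding rot_sym_seminorms_def by blast

lemma gauge_one: "\<alpha> (\<lambda>z. 1) = 1"
  using rot_sym unfolding rot_sym_seminorms_def by blast

lemma gauge_cmod: "\<alpha> (\<lambda>z. complex_of_real (cmod (f z))) = \<alpha> f" if "f \<in> Linf"
  using rot_sym that unfolding rot_sym_seminorms_def by blast

lemma gauge_rotate: "\<alpha> (\<lambda>z. f (cnj w * z)) = \<alpha> f" if "f \<in> Linf" "w \<in> sphere 0 1"
  using rot_sym that unfolding rot_sym_seminorms_def by blast

lemma gauge_zero: "\<alpha> (\<lambda>_. 0) = 0"
  using gauge_scale[OF Linf_const, of 0 0] by simp

lemma gauge_const: "\<alpha> (\<lambda>_. c) = ennreal (cmod c)"
  using gauge_scale[OF Linf_const, of c 1] by (simp add: gauge_one)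

sublocale Linf: seminormed_functions Linf \<alpha>
  by unfold_locales (auto simp: gauge_add gauge_scale intro: gauge_finite[unfolded infinity_ennreal_def])

text \<open>A number in \<open>[0, 1]\<close> is the mean of two conjugate unimodular numbers.\<close>

lemma gauge_mono:
  assumes f: "f \<in> Linf" and g: "g \<in> Linf" and le: "AE z in \<mu>. cmod (f z) \<le> cmod (g z)"
  shows "\<alpha> f \<le> \<alpha> g"
proof -
  note [measurable] = f g
  \<comment> \<open>\<open>min\<close> takes effect only on the exceptional null set and makes the
    square root below real everywhere; where g = 0, division by zero gives t = 0.\<close>
  define t where "t z = min 1 (cmod (f z) / cmod (g z))" for z
  have t: "0 \<le> t z" "t z \<le> 1" for z by (auto simp: t_def)
  have [measurable]: "t \<in> borel_measurable \<mu>" unfolding t_def by measurable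
  define v where "v z = Complex (t z) (sqrt (1 - (t z)\<^sup>2))" for z
  have cv: "cmod (v z) = 1" for z
    using t[of z] by (simp add: v_def cmod_def power_le_one)
  have [measurable]: "v \<in> borel_measurable \<mu>" unfolding v_def Complex_eq by measurable
  have [measurable]: "(\<lambda>z. cnj (v z)) \<in> borel_measurable \<mu>"
    by measurable
  define u where "u z = complex_of_real (cmod (g z)) * v z" for z
  have [measurable]: "u \<in> borel_measurable \<mu>" unfolding u_def by measurable
  have u: "u \<in> Linf" "\<alpha> u = \<alpha> g"
  proof -
    show u: "u \<in> Linf" by (rule Linf_dominated[OF _ g]) (auto simp: u_def norm_mult cv)
    have "\<alpha> u = \<alpha> (\<lambda>z. complex_of_real (cmod (u z)))" using gauge_cmod[OF u] by simp
    also have "\<dots> = \<alpha> g" using gauge_cmod[OF g] by (simp add: u_def norm_mult cv)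
    finally show "\<alpha> u = \<alpha> g" .
  qed
  have cu: "(\<lambda>z. cnj (u z)) \<in> Linf" "\<alpha> (\<lambda>z. cnj (u z)) = \<alpha> g"
  proof -
    show cu: "(\<lambda>z. cnj (u z)) \<in> Linf" by (rule Linf_dominated[OF _ u(1)]) (auto simp: u_def norm_mult)
    show "\<alpha> (\<lambda>z. cnj (u z)) = \<alpha> g" using gauge_cmod[OF cu] gauge_cmod[OF u(1)] u(2) by simp
  qed
  have "\<alpha> f = \<alpha> (\<lambda>z. complex_of_real (cmod (f z)))" using gauge_cmod[OF f] by simp
  also have "\<dots> = \<alpha> (\<lambda>z. 1 / 2 * u z + 1 / 2 * cnj (u z))"
  proof (rule gauge_cong)
    show "AE z in \<mu>. complex_of_real (cmod (f z)) = 1 / 2 * u z + 1 / 2 * cnj (u z)"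
      using le
    proof eventually_elim
      case (elim z)
      have "cmod (f z) = cmod (g z) * t z"
        using elim by (cases "g z = 0") (auto simp: t_def min_def divide_simps)
      then show ?case by (simp add: u_def v_def complex_eq_iff)
    qed
    show "(\<lambda>z. 1 / 2 * u z + 1 / 2 * cnj (u z)) \<in> Linf"
      using u cu by simp
  qed (use f in simp)
  also have "\<dots> \<le> \<alpha> (\<lambda>z. 1 / 2 * u z) + \<alpha> (\<lambda>z. 1 / 2 * cnj (u z))"
    using u cu by (intro gauge_add) auto
  also have "\<dots> = ennreal (1 / 2) * \<alpha> g + ennreal (1 / 2) * \<alpha> g"
    using gauge_scale[OF u(1), of "1 / 2"] gauge_scale[OF cu(1), of "1 / 2"] u cu by simp
  also have "\<dots> = (ennreal (1 / 2) + ennreal (1 / 2)) * \<alpha> g"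
    by (simp only: distrib_right)
  also have "\<dots> = \<alpha> g" by (subst ennreal_plus[symmetric]) auto
  finally show ?thesis .
qed

lemma gauge_le_bound:
  assumes "f \<in> Linf" "AE z in \<mu>. cmod (f z) \<le> C"
  shows "\<alpha> f \<le> ennreal C"
proof -
  have "\<alpha> f \<le> \<alpha> (\<lambda>_. complex_of_real (max 0 C))"
    using assms(2) by (intro gauge_mono assms(1)) auto
  then show ?thesis by (simp add: gauge_const max_def ennreal_neg split: if_splits)
qed

text \<open>A simple t with |t| \<le> |s| within e of s costs at most e, so the supremum in
  \<open>gauge_ext\<close> may run over bounded functions. These, unlike simple ones, may be
  multiplied by arbitrary bounded weights, which the triangle inequality exploits.\<close>

lemma gauge_ext_upper:
  assumes s: "s \<in> Linf" and le: "AE z in \<mu>. cmod (s z) \<le> cmod (f z)"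
  shows "\<alpha> s \<le> gauge_ext \<alpha> f"
proof (rule ennreal_le_epsilon)
  fix e :: real assume e: "0 < e"
  obtain t where t: "simple_function \<mu> t" "AE z in \<mu>. cmod (t z) \<le> cmod (s z)"
    "AE z in \<mu>. cmod (s z - t z) \<le> e"
    using simple_approximation[OF s e] .
  note tL = Linf_simple[OF t(1)]
  have "\<alpha> s = \<alpha> (\<lambda>z. t z + (s z - t z))" by simp
  also have "\<dots> \<le> \<alpha> t + \<alpha> (\<lambda>z. s z - t z)" using s tL by (intro gauge_add) auto
  also have "\<alpha> (\<lambda>z. s z - t z) \<le> ennreal e" using s tL t by (intro gauge_le_bound) auto
  also have "\<alpha> t \<le> gauge_ext \<alpha> f"
  proof -
    have "AE z in \<mu>. cmod (t z) \<le> cmod (f z)" using t(2) le by eventually_elim simp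
    then show ?thesis unfolding gauge_ext_def using t(1) by (intro SUP_upper) auto
  qed
  finally show "\<alpha> s \<le> gauge_ext \<alpha> f + ennreal e" by (simp add: add_right_mono)
qed

lemma gauge_ext_least:
  assumes "\<And>s. s \<in> Linf \<Longrightarrow> AE z in \<mu>. cmod (s z) \<le> cmod (f z) \<Longrightarrow> \<alpha> s \<le> C"
  shows "gauge_ext \<alpha> f \<le> C"
  unfolding gauge_ext_def using Linf_simple assms by (auto intro!: SUP_least)

lemma gauge_ext_Linf [simp]: "gauge_ext \<alpha> f = \<alpha> f" if "f \<in> Linf"
  using that by (intro antisym gauge_ext_least gauge_ext_upper gauge_mono) auto

lemma gauge_ext_mono:
  assumes "AE z in \<mu>. cmod (f z) \<le> cmod (g z)"
  shows "gauge_ext \<alpha> f \<le> gauge_ext \<alpha> g"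
proof (rule gauge_ext_least)
  fix s assume s: "s \<in> Linf" "AE z in \<mu>. cmod (s z) \<le> cmod (f z)"
  have "AE z in \<mu>. cmod (s z) \<le> cmod (g z)" using assms s(2) by eventually_elim simp
  then show "\<alpha> s \<le> gauge_ext \<alpha> g" by (rule gauge_ext_upper[OF s(1)])
qed

lemma gauge_ext_cong:
  assumes "AE z in \<mu>. cmod (f z) = cmod (g z)"
  shows "gauge_ext \<alpha> f = gauge_ext \<alpha> g"
  using assms by (intro antisym gauge_ext_mono; eventually_elim) auto

text \<open>A bounded s below |f + g| is split by the weight r = |f| / (|f| + |g|): then s r lies
  below |f| and s (1 - r) below |g|.\<close>

lemma gauge_ext_add:
  assumes [measurable]: "f \<in> borel_measurable \<mu>" "g \<in> borel_measurable \<mu>"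
  shows "gauge_ext \<alpha> (\<lambda>z. f z + g z) \<le> gauge_ext \<alpha> f + gauge_ext \<alpha> g"
proof (rule gauge_ext_least)
  fix s assume s: "s \<in> Linf" "AE z in \<mu>. cmod (s z) \<le> cmod (f z + g z)"
  note [measurable] = s(1)
  define r where "r z = cmod (f z) / (cmod (f z) + cmod (g z))" for z
  have r: "0 \<le> r z" "r z \<le> 1" for z
    unfolding r_def divide_le_eq_1 using norm_ge_zero[of "f z"] norm_ge_zero[of "g z"] by (simp, linarith)
  have [measurable]: "r \<in> borel_measurable \<mu>" unfolding r_def by measurable
  have 1: "(\<lambda>z. complex_of_real (r z)) \<in> Linf" "(\<lambda>z. complex_of_real (1 - r z)) \<in> Linf"
    using r by (auto intro!: LinfI[of _ 1] simp del: of_real_diff)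
  have "\<alpha> s = \<alpha> (\<lambda>z. s z * complex_of_real (r z) + s z * complex_of_real (1 - r z))"
    by (simp add: algebra_simps)
  also have "\<dots> \<le> \<alpha> (\<lambda>z. s z * complex_of_real (r z)) + \<alpha> (\<lambda>z. s z * complex_of_real (1 - r z))"
    using 1 s by (intro gauge_add Linf_mult) auto
  also have "\<alpha> (\<lambda>z. s z * complex_of_real (r z)) \<le> gauge_ext \<alpha> f"
  proof (rule gauge_ext_upper)
    show "AE z in \<mu>. cmod (s z * complex_of_real (r z)) \<le> cmod (f z)"
      using s(2)
    proof eventually_elim
      case (elim z)
      then have "cmod (s z) \<le> cmod (f z) + cmod (g z)" using norm_triangle_le by (meson norm_triangle_ineq order_trans)
      then have "cmod (s z) * r z \<le> (cmod (f z) + cmod (g z)) * r z" using r by (intro mult_right_mono) auto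
      also have "\<dots> \<le> cmod (f z)" by (auto simp: r_def)
      finally show ?case using r by (simp add: norm_mult)
    qed
  qed (use 1 s in auto)
  also have "\<alpha> (\<lambda>z. s z * complex_of_real (1 - r z)) \<le> gauge_ext \<alpha> g"
  proof (rule gauge_ext_upper)
    show "AE z in \<mu>. cmod (s z * complex_of_real (1 - r z)) \<le> cmod (g z)"
      using s(2)
    proof eventually_elim
      case (elim z)
      then have *: "cmod (s z) \<le> cmod (f z) + cmod (g z)" by (meson norm_triangle_ineq order_trans)
      then have "cmod (s z) * (1 - r z) \<le> (cmod (f z) + cmod (g z)) * (1 - r z)" using r by (intro mult_right_mono) auto
      also have "\<dots> \<le> cmod (g z)"
        by (cases "cmod (f z) + cmod (g z) = 0") (auto simp: r_def right_diff_distrib)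
      finally show ?case using r[of z] unfolding norm_mult norm_of_real by simp
    qed
  qed (use 1 s in auto)
  finally show "\<alpha> s \<le> gauge_ext \<alpha> f + gauge_ext \<alpha> g" by (simp add: add_mono)
qed

lemma gauge_ext_scale: "gauge_ext \<alpha> (\<lambda>z. c * f z) = ennreal (cmod c) * gauge_ext \<alpha> f"
proof (cases "c = 0")
  case True
  then show ?thesis by (simp add: gauge_zero)
next
  case False
  have le: "gauge_ext \<alpha> (\<lambda>z. c * f z) \<le> ennreal (cmod c) * gauge_ext \<alpha> f" if c: "c \<noteq> 0" for c f
  proof (rule gauge_ext_least)
    fix s assume s: "s \<in> Linf" "AE z in \<mu>. cmod (s z) \<le> cmod (c * f z)"
    have t: "(\<lambda>z. 1 / c * s z) \<in> Linf" using s by (intro Linf_mult) auto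
    have "AE z in \<mu>. cmod (1 / c * s z) \<le> cmod (f z)"
      using s(2) by eventually_elim (use c in \<open>simp add: norm_mult norm_divide field_simps\<close>)
    then have "\<alpha> (\<lambda>z. 1 / c * s z) \<le> gauge_ext \<alpha> f" by (rule gauge_ext_upper[OF t])
    then have "ennreal (cmod c) * \<alpha> (\<lambda>z. 1 / c * s z) \<le> ennreal (cmod c) * gauge_ext \<alpha> f"
      by (rule mult_left_mono) simp
    then show "\<alpha> s \<le> ennreal (cmod c) * gauge_ext \<alpha> f"
      using gauge_scale[OF t, of c] c by simp
  qed
  have "ennreal (cmod c) * gauge_ext \<alpha> f
      = ennreal (cmod c) * gauge_ext \<alpha> (\<lambda>z. 1 / c * (c * f z))" using False by simp
  also have "\<dots> \<le> ennreal (cmod c) * (ennreal (cmod (1 / c)) * gauge_ext \<alpha> (\<lambda>z. c * f z))"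
    using False by (intro mult_left_mono le) auto
  also have "\<dots> = gauge_ext \<alpha> (\<lambda>z. c * f z)"
    using False by (simp add: mult.assoc[symmetric] ennreal_mult[symmetric] norm_divide)
  finally show ?thesis using le[OF False] by (rule antisym[rotated])
qed

lemma Lcal_measurable: "f \<in> Lcal \<alpha> \<Longrightarrow> f \<in> borel_measurable \<mu>"
  by (simp add: Lcal_def)

lemma Lcal_finite: "f \<in> Lcal \<alpha> \<Longrightarrow> gauge_ext \<alpha> f < \<infinity>"
  by (simp add: Lcal_def)

lemma Linf_Lcal: "f \<in> Linf \<Longrightarrow> f \<in> Lcal \<alpha>"
  by (simp add: Lcal_def Linf_measurable gauge_finite[simplified])

lemma Lcal_dominated:
  assumes "f \<in> Lcal \<alpha>" "g \<in> borel_measurable \<mu>" "AE z in \<mu>. cmod (g z) \<le> cmod (f z)"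
  shows "g \<in> Lcal \<alpha>"
  using assms(1,2) gauge_ext_mono[OF assms(3)] by (auto simp: Lcal_def)

lemma seminormed_functions_Lcal: "seminormed_functions (Lcal \<alpha>) (gauge_ext \<alpha>)"
proof
  fix f g c assume f: "f \<in> Lcal \<alpha>" and g: "g \<in> Lcal \<alpha>"
  show "(\<lambda>x. f x + g x) \<in> Lcal \<alpha>"
    using f g gauge_ext_add[of f g] by (auto simp: Lcal_def ennreal_add_less_top le_less_trans)
qed (auto simp: Lcal_def gauge_ext_scale ennreal_mult_less_top gauge_zero intro: gauge_ext_add)

sublocale Lcal: seminormed_functions "Lcal \<alpha>" "gauge_ext \<alpha>"
  by (rule seminormed_functions_Lcal)

section \<open>Closures with respect to a gauge\<close>

lemma gauge_closure_Lcal: "gauge_closure \<alpha> A \<subseteq> Lcal \<alpha>"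
  by (auto simp: gauge_closure_def)

lemma gauge_closure_approx:
  assumes "f \<in> gauge_closure \<alpha> A" "0 < e"
  obtains g where "g \<in> A" "gauge_ext \<alpha> (\<lambda>z. f z - g z) < ennreal e"
  using assms unfolding gauge_closure_def by blast

lemma gauge_closure_superset: "A \<subseteq> Linf \<Longrightarrow> A \<subseteq> gauge_closure \<alpha> A"
  by (force simp: gauge_closure_def gauge_zero intro: Linf_Lcal)

lemma gauge_closure_mono: "A \<subseteq> B \<Longrightarrow> gauge_closure \<alpha> A \<subseteq> gauge_closure \<alpha> B"
  unfolding gauge_closure_def by blast

lemma gauge_closure_closed:
  assumes A: "A \<subseteq> Linf" and f: "f \<in> Lcal \<alpha>"
    and approx: "\<And>e. 0 < e \<Longrightarrow> \<exists>g \<in> gauge_closure \<alpha> A. gauge_ext \<alpha> (\<lambda>z. f z - g z) < ennreal e"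
  shows "f \<in> gauge_closure \<alpha> A"
  unfolding gauge_closure_def
proof (intro CollectI conjI f allI impI)
  fix e :: real assume e: "0 < e"
  obtain g where g: "g \<in> gauge_closure \<alpha> A" "gauge_ext \<alpha> (\<lambda>z. f z - g z) < ennreal (e / 2)"
    using approx[of "e / 2"] e by auto
  obtain h where h: "h \<in> A" "gauge_ext \<alpha> (\<lambda>z. g z - h z) < ennreal (e / 2)"
    using gauge_closure_approx[OF g(1), of "e / 2"] e by auto
  have m: "f \<in> borel_measurable \<mu>" "g \<in> borel_measurable \<mu>" "h \<in> borel_measurable \<mu>"
    using f g h A gauge_closure_Lcal Lcal_measurable Linf_measurable by blast+
  have "gauge_ext \<alpha> (\<lambda>z. f z - h z) = gauge_ext \<alpha> (\<lambda>z. (f z - g z) + (g z - h z))" by simp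
  also have "\<dots> \<le> gauge_ext \<alpha> (\<lambda>z. f z - g z) + gauge_ext \<alpha> (\<lambda>z. g z - h z)"
    using m by (intro gauge_ext_add) auto
  also have "\<dots> < ennreal (e / 2) + ennreal (e / 2)" by (intro add_strict_mono g h)
  also have "\<dots> = ennreal e" using e by (simp flip: ennreal_plus)
  finally show "\<exists>g\<in>A. gauge_ext \<alpha> (\<lambda>z. f z - g z) < ennreal e" using h by blast
qed

lemma seminormed_functions_closure:
  assumes A: "A \<subseteq> Linf" and zero: "(\<lambda>_. 0) \<in> A"
    and add: "\<And>f g. f \<in> A \<Longrightarrow> g \<in> A \<Longrightarrow> (\<lambda>x. f x + g x) \<in> A"
    and scale: "\<And>c f. f \<in> A \<Longrightarrow> (\<lambda>x. c * f x) \<in> A"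
  shows "seminormed_functions (gauge_closure \<alpha> A) (gauge_ext \<alpha>)"
proof
  have L: "f \<in> Lcal \<alpha>" if "f \<in> gauge_closure \<alpha> A" for f using that gauge_closure_Lcal by blast
  note m = Lcal_measurable[OF L]
  show "(\<lambda>x. f x + g x) \<in> gauge_closure \<alpha> A" if fg: "f \<in> gauge_closure \<alpha> A" "g \<in> gauge_closure \<alpha> A" for f g
    unfolding gauge_closure_def
  proof (intro CollectI conjI allI impI Lcal.add_closed L that)
    fix e :: real assume e: "0 < e"
    obtain h where h: "h \<in> A" "gauge_ext \<alpha> (\<lambda>z. f z - h z) < ennreal (e / 2)"
      using gauge_closure_approx[OF fg(1), of "e / 2"] e by auto
    obtain k where k: "k \<in> A" "gauge_ext \<alpha> (\<lambda>z. g z - k z) < ennreal (e / 2)"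
      using gauge_closure_approx[OF fg(2), of "e / 2"] e by auto
    have mk: "h \<in> borel_measurable \<mu>" "k \<in> borel_measurable \<mu>" using h k A Linf_measurable by blast+
    have "gauge_ext \<alpha> (\<lambda>z. f z + g z - (h z + k z)) = gauge_ext \<alpha> (\<lambda>z. (f z - h z) + (g z - k z))"
      by (simp add: algebra_simps)
    also have "\<dots> \<le> gauge_ext \<alpha> (\<lambda>z. f z - h z) + gauge_ext \<alpha> (\<lambda>z. g z - k z)"
      using m[OF fg(1)] m[OF fg(2)] mk by (intro gauge_ext_add) auto
    also have "\<dots> < ennreal (e / 2) + ennreal (e / 2)" by (intro add_strict_mono h k)
    also have "\<dots> = ennreal e" using e by (simp flip: ennreal_plus)
    finally show "\<exists>h\<in>A. gauge_ext \<alpha> (\<lambda>z. f z + g z - h z) < ennreal e"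
      by (rule bexI[OF _ add[OF h(1) k(1)]])
  qed
  show "(\<lambda>x. c * f x) \<in> gauge_closure \<alpha> A" if f: "f \<in> gauge_closure \<alpha> A" for f c
    unfolding gauge_closure_def
  proof (intro CollectI conjI allI impI Lcal.scale_closed L that)
    fix e :: real assume e: "0 < e"
    \<comment> \<open>The summand 1 keeps the quotient meaningful for c = 0.\<close>
    obtain h where h: "h \<in> A" "gauge_ext \<alpha> (\<lambda>z. f z - h z) < ennreal (e / (cmod c + 1))"
      using gauge_closure_approx[OF f, of "e / (cmod c + 1)"] divide_pos_pos[OF e, of "cmod c + 1"]
      by (metis add_nonneg_pos norm_ge_zero zero_less_one)
    have "gauge_ext \<alpha> (\<lambda>z. c * f z - c * h z) = ennreal (cmod c) * gauge_ext \<alpha> (\<lambda>z. f z - h z)"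
      using gauge_ext_scale[of c "\<lambda>z. f z - h z"] by (simp add: right_diff_distrib)
    also have "\<dots> \<le> ennreal (cmod c) * ennreal (e / (cmod c + 1))"
      using less_imp_le[OF h(2)] by (rule mult_left_mono) simp
    also have "\<dots> = ennreal (cmod c * (e / (cmod c + 1)))"
      using e by (intro ennreal_mult[symmetric] divide_nonneg_nonneg) auto
    also have "\<dots> < ennreal e"
    proof (rule ennreal_lessI[OF e])
      have p: "0 < cmod c + 1" by (simp add: add_nonneg_pos)
      have "cmod c * e < e * (cmod c + 1)" using e by (simp add: algebra_simps)
      then show "cmod c * (e / (cmod c + 1)) < e"
        using p by (simp add: pos_divide_less_eq)
    qed
    finally show "\<exists>h\<in>A. gauge_ext \<alpha> (\<lambda>z. c * f z - h z) < ennreal e"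
      by (rule bexI[OF _ scale[OF h(1)]])
  qed
  show "(\<lambda>_. 0) \<in> gauge_closure \<alpha> A" using zero gauge_closure_superset[OF A] by blast
  show "gauge_ext \<alpha> f < \<infinity>" if "f \<in> gauge_closure \<alpha> A" for f
    using L[OF that] by (rule Lcal.seminorm_finite)
  show "gauge_ext \<alpha> (\<lambda>x. f x + g x) \<le> gauge_ext \<alpha> f + gauge_ext \<alpha> g"
    if "f \<in> gauge_closure \<alpha> A" "g \<in> gauge_closure \<alpha> A" for f g
    using L[OF that(1)] L[OF that(2)] by (rule Lcal.triangle)
  show "gauge_ext \<alpha> (\<lambda>x. c * f x) = ennreal (cmod c) * gauge_ext \<alpha> f" for c f
    by (rule gauge_ext_scale)
qed

sublocale Lgauge: seminormed_functions "Lgauge \<alpha>" "gauge_ext \<alpha>"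
  unfolding Lgauge_def by (intro seminormed_functions_closure) auto

lemma Lgauge_Lcal: "f \<in> Lgauge \<alpha> \<Longrightarrow> f \<in> Lcal \<alpha>"
  using gauge_closure_Lcal by (auto simp: Lgauge_def)

lemma Linf_Lgauge: "f \<in> Linf \<Longrightarrow> f \<in> Lgauge \<alpha>"
  using gauge_closure_superset by (auto simp: Lgauge_def)

text \<open>Multiplying by an indicator does not raise the gauge, so approximations survive
  restriction to a set. This allows functionals to be localized.\<close>

lemma Lgauge_mult_indicator:
  assumes f: "f \<in> Lgauge \<alpha>" and A: "A \<in> sets \<mu>"
  shows "(\<lambda>z. f z * indicator A z) \<in> Lgauge \<alpha>"
  unfolding Lgauge_def gauge_closure_def
proof (intro CollectI conjI allI impI)
  show "(\<lambda>z. f z * indicator A z) \<in> Lcal \<alpha>"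
    using Lcal_measurable[OF Lgauge_Lcal[OF f]] A
    by (intro Lcal_dominated[OF Lgauge_Lcal[OF f]]) (auto split: split_indicator)
  fix e :: real assume "0 < e"
  then obtain g where g: "g \<in> Linf" "gauge_ext \<alpha> (\<lambda>z. f z - g z) < ennreal e"
    using f gauge_closure_approx unfolding Lgauge_def by metis
  have "gauge_ext \<alpha> (\<lambda>z. f z * indicator A z - g z * indicator A z) \<le> gauge_ext \<alpha> (\<lambda>z. f z - g z)"
    by (intro gauge_ext_mono) (auto split: split_indicator)
  then show "\<exists>g\<in>Linf. gauge_ext \<alpha> (\<lambda>z. f z * indicator A z - g z) < ennreal e"
    using g A by (intro bexI[of _ "\<lambda>z. g z * indicator A z"]) auto
qed

text \<open>The difference of f and g has gauge 0, and boundedness makes a functional vanish there.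
  This replaces the passage to classes modulo null sets.\<close>

lemma dual_space_AE_cong:
  assumes \<phi>: "\<phi> \<in> dual_space V (gauge_ext \<alpha>)" and "f \<in> V" "g \<in> V" "AE z in \<mu>. f z = g z"
    and V: "seminormed_functions V (gauge_ext \<alpha>)"
  shows "\<phi> f = \<phi> g"
proof -
  interpret V: seminormed_functions V "gauge_ext \<alpha>" by (rule V)
  have d: "(\<lambda>z. f z + -1 * g z) \<in> V" using assms by (intro V.add_closed V.scale_closed)
  have "AE z in \<mu>. cmod (f z + -1 * g z) = cmod 0" using assms(4) by eventually_elim simp
  from gauge_ext_cong[OF this] have "gauge_ext \<alpha> (\<lambda>z. f z + -1 * g z) = 0" by (simp add: gauge_zero)
  then have "\<phi> (\<lambda>z. f z + -1 * g z) = 0"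
    using \<phi> d unfolding dual_space_def by fastforce
  moreover have "\<phi> (\<lambda>z. f z + -1 * g z) = \<phi> f + -1 * \<phi> g"
  proof -
    have "\<phi> (\<lambda>z. f z + h z) = \<phi> f + \<phi> h" if "h \<in> V" for h
      using \<phi> assms(2) that unfolding dual_space_def by blast
    moreover have "\<phi> (\<lambda>z. -1 * g z) = -1 * \<phi> g"
      using \<phi> assms(3) unfolding dual_space_def by blast
    ultimately show ?thesis using V.scale_closed[OF assms(3), of "-1"] by metis
  qed
  ultimately show ?thesis by simp
qed

end

section \<open>Functionals on bounded functions and the dual gauge\<close>

context seminormed_functions
begin

lemma dual_add: "\<phi> \<in> dual_space V N \<Longrightarrow> f \<in> V \<Longrightarrow> g \<in> V \<Longrightarrow> \<phi> (\<lambda>x. f x + g x) = \<phi> f + \<phi> g"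
  unfolding dual_space_def by blast

lemma dual_scale: "\<phi> \<in> dual_space V N \<Longrightarrow> f \<in> V \<Longrightarrow> \<phi> (\<lambda>x. c * f x) = c * \<phi> f"
  unfolding dual_space_def by blast

lemma dual_diff: "\<phi> \<in> dual_space V N \<Longrightarrow> f \<in> V \<Longrightarrow> g \<in> V \<Longrightarrow> \<phi> (\<lambda>x. f x - g x) = \<phi> f - \<phi> g"
  using dual_add[of \<phi> f "\<lambda>x. -1 * g x"] dual_scale[of \<phi> g "-1"] scale_closed[of g "-1"] by simp

lemma dual_zero: "\<phi> \<in> dual_space V N \<Longrightarrow> \<phi> (\<lambda>_. 0) = 0"
  using dual_scale[OF _ zero_closed, of \<phi> 0] by simp

lemma dual_outside: "\<phi> \<in> dual_space V N \<Longrightarrow> f \<notin> V \<Longrightarrow> \<phi> f = 0"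
  unfolding dual_space_def by blast

lemma dual_sum:
  assumes "\<phi> \<in> dual_space V N" "finite S" "\<And>i. i \<in> S \<Longrightarrow> F i \<in> V"
  shows "(\<lambda>x. \<Sum>i\<in>S. F i x) \<in> V \<and> \<phi> (\<lambda>x. \<Sum>i\<in>S. F i x) = (\<Sum>i\<in>S. \<phi> (F i))"
  using assms(2,3)
proof (induction S rule: finite_induct)
  case empty
  then show ?case using dual_zero[OF assms(1)] zero_closed by simp
next
  case (insert i S)
  then show ?case using dual_add[OF assms(1), of "F i" "\<lambda>x. \<Sum>i\<in>S. F i x"] add_closed by simp
qed

lemma dual_bound:
  assumes "\<phi> \<in> dual_space V N"
  obtains C where "0 < C" "\<And>f. f \<in> V \<Longrightarrow> cmod (\<phi> f) \<le> C * enn2real (N f)"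
proof -
  obtain C :: real where C: "\<And>f. f \<in> V \<Longrightarrow> ennreal (cmod (\<phi> f)) \<le> ennreal C * N f"
    using assms unfolding dual_space_def by blast
  have "cmod (\<phi> f) \<le> max C 1 * enn2real (N f)" if f: "f \<in> V" for f
  proof -
    have "ennreal (cmod (\<phi> f)) \<le> ennreal (max C 1) * N f"
      using C[OF f] by (rule order_trans) (intro mult_right_mono ennreal_leI, auto)
    also have "\<dots> = ennreal (max C 1 * enn2real (N f))"
      using ennreal_real[OF f] by (simp add: ennreal_mult)
    finally show ?thesis by (subst (asm) ennreal_le_iff) (auto intro: mult_nonneg_nonneg)
  qed
  then show thesis by (intro that[of "max C 1"]) auto
qed

lemma dual_space_restrict:
  assumes "\<phi> \<in> dual_space V N" "W \<subseteq> V" "\<And>f g. f \<in> W \<Longrightarrow> g \<in> W \<Longrightarrow> (\<lambda>x. f x + g x) \<in> W"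
      "\<And>c f. f \<in> W \<Longrightarrow> (\<lambda>x. c * f x) \<in> W"
  shows "(\<lambda>f. if f \<in> W then \<phi> f else 0) \<in> dual_space W N"
proof -
  have "\<exists>C::real. \<forall>f\<in>V. ennreal (cmod (\<phi> f)) \<le> ennreal C * N f"
    using assms(1) unfolding dual_space_def by blast
  then obtain C :: real where "\<forall>f\<in>V. ennreal (cmod (\<phi> f)) \<le> ennreal C * N f" ..
  then have "\<exists>C::real. \<forall>f\<in>W. ennreal (cmod (if f \<in> W then \<phi> f else 0)) \<le> ennreal C * N f"
    using assms(2) by (intro exI[of _ C]) auto
  moreover have "\<phi> (\<lambda>x. f x + g x) = \<phi> f + \<phi> g" if "f \<in> W" "g \<in> W" for f g
    using dual_add[OF assms(1)] assms(2) that by blast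
  moreover have "\<phi> (\<lambda>x. c * f x) = c * \<phi> f" if "f \<in> W" for c f
    using dual_scale[OF assms(1)] assms(2) that by blast
  ultimately show ?thesis
    unfolding dual_space_def using assms(3,4) by auto
qed

end

lemma (in rot_gauge) dual_space_AE_cong_Linf:
  assumes \<phi>: "\<phi> \<in> dual_space Linf \<alpha>" and fg: "f \<in> Linf" "g \<in> Linf" "AE z in \<mu>. f z = g z"
  shows "\<phi> f = \<phi> g"
proof -
  obtain C where "\<And>f. f \<in> Linf \<Longrightarrow> cmod (\<phi> f) \<le> C * enn2real (\<alpha> f)"
    using Linf.dual_bound[OF \<phi>] by blast
  from this[of "\<lambda>z. f z - g z"] have "cmod (\<phi> (\<lambda>z. f z - g z)) \<le> C * enn2real (\<alpha> (\<lambda>z. f z - g z))"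
    using fg by simp
  moreover have "\<alpha> (\<lambda>z. f z - g z) = \<alpha> (\<lambda>_. 0)" using fg by (intro gauge_cong) auto
  ultimately show ?thesis using Linf.dual_diff[OF \<phi> fg(1,2)] by (simp add: gauge_zero)
qed

section \<open>Functionals dominated by a continuous gauge are integrals\<close>

locale cont_gauge = rot_gauge +
  assumes continuous: "gauge_continuous \<alpha>"
begin

text \<open>\<open>gauge_continuous\<close> speaks only of sets of positive measure; a null set has
  gauge 0 because the gauge respects almost everywhere equality.\<close>

lemma gauge_indicator_small:
  assumes "0 < e"
  obtains d where "0 < d" "\<And>E. E \<in> sets \<mu> \<Longrightarrow> measure \<mu> E < d \<Longrightarrow> \<alpha> (indicator E) < ennreal e"
proof -
  obtain d where d: "0 < d" "\<And>E. E \<in> sets \<mu> \<Longrightarrow> 0 < measure \<mu> E \<Longrightarrow> measure \<mu> E < d \<Longrightarrow> \<alpha> (indicator E) < ennreal e"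
    using continuous assms unfolding gauge_continuous_def by metis
  have "\<alpha> (indicator E) < ennreal e" if E: "E \<in> sets \<mu>" "measure \<mu> E = 0" for E
  proof -
    have "AE z in \<mu>. z \<notin> E"
      using E by (intro AE_not_in) (simp add: null_sets_def circle.emeasure_eq_measure)
    then have "AE z in \<mu>. (indicator E z :: complex) = 0" by eventually_elim simp
    then have "\<alpha> (indicator E) = \<alpha> (\<lambda>_. 0)" using E by (intro gauge_cong) auto
    then show ?thesis using assms by (simp add: gauge_zero)
  qed
  then show thesis using d that by (metis measure_nonneg order_le_less)
qed

text \<open>Continuity of \<alpha> makes F small on sets of small measure. Hence F tends to 0 along
  sets that decrease to the empty set, which upgrades finite to countable additivity, and F is
  absolutely continuous.\<close>

lemma set_function_density:
  assumes F_nonneg: "\<And>E. E \<in> sets \<mu> \<Longrightarrow> 0 \<le> F E"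
    and F_add: "\<And>A B. A \<in> sets \<mu> \<Longrightarrow> B \<in> sets \<mu> \<Longrightarrow> A \<inter> B = {} \<Longrightarrow> F (A \<union> B) = F A + F B"
    and F_le: "\<And>E. E \<in> sets \<mu> \<Longrightarrow> F E \<le> C * enn2real (\<alpha> (indicator E))" and C: "0 < C"
  obtains k :: "complex \<Rightarrow> real" where "integrable \<mu> k"
    "\<And>E. E \<in> sets \<mu> \<Longrightarrow> F E = (\<integral>z. k z * indicator E z \<partial>\<mu>)"
proof -
  have F_empty: "F {} = 0" using F_add[of "{}" "{}"] by simp
  have F_small: "\<exists>d>0. \<forall>E\<in>sets \<mu>. measure \<mu> E < d \<longrightarrow> F E < e" if e: "0 < e" for e
  proof -
    obtain d where d: "0 < d" "\<And>E. E \<in> sets \<mu> \<Longrightarrow> measure \<mu> E < d \<Longrightarrow> \<alpha> (indicator E) < ennreal (e / C)"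
      using gauge_indicator_small[of "e / C"] e C by auto
    have "F E < e" if E: "E \<in> sets \<mu>" "measure \<mu> E < d" for E
    proof -
      have "enn2real (\<alpha> (indicator E)) < e / C"
        using d(2)[OF E] Linf.ennreal_real[OF Linf_indicator[OF E(1)]]
        by (metis enn2real_nonneg ennreal_less_iff)
      then have "C * enn2real (\<alpha> (indicator E)) < e" using C by (simp add: field_simps)
      then show ?thesis using F_le[OF E(1)] by linarith
    qed
    then show ?thesis using d(1) by blast
  qed
  define \<nu> where "\<nu> = measure_of (space \<mu>) (sets \<mu>) (\<lambda>E. ennreal (F E))"
  have sets_\<nu> [simp]: "sets \<nu> = sets \<mu>" 
    unfolding \<nu>_def by (rule sets.sets_measure_of_eq)
  have ca: "countably_additive (sets \<mu>) (\<lambda>E. ennreal (F E))"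
  proof (rule sets.empty_continuous_imp_countably_additive)
    show "positive (sets \<mu>) (\<lambda>E. ennreal (F E))" by (simp add: positive_def F_empty)
    show "additive (sets \<mu>) (\<lambda>E. ennreal (F E))"
      by (auto simp: additive_def F_add F_nonneg ennreal_plus)
  next
    fix A :: "nat \<Rightarrow> complex set" assume A: "range A \<subseteq> sets \<mu>" "decseq A" "(\<Inter>i. A i) = {}"
    have "(\<lambda>i. measure \<mu> (A i)) \<longlonglongrightarrow> measure \<mu> (\<Inter>i. A i)"
      using A by (intro circle.finite_Lim_measure_decseq)
    then have m: "(\<lambda>i. measure \<mu> (A i)) \<longlonglongrightarrow> 0" using A by simp
    have "(\<lambda>i. F (A i)) \<longlonglongrightarrow> 0"
    proof (rule LIMSEQ_I)
      fix e :: real assume "0 < e"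
      then obtain d where d: "0 < d" "\<forall>E\<in>sets \<mu>. measure \<mu> E < d \<longrightarrow> F E < e" using F_small by blast
      obtain n where "\<And>i. n \<le> i \<Longrightarrow> norm (measure \<mu> (A i) - 0) < d"
        using LIMSEQ_D[OF m d(1)] by blast
      then have "norm (F (A i) - 0) < e" if "n \<le> i" for i
        using d(2) that A(1) F_nonneg by (auto simp: image_subset_iff)
      then show "\<exists>n. \<forall>i\<ge>n. norm (F (A i) - 0) < e" by blast
    qed
    then show "(\<lambda>i. ennreal (F (A i))) \<longlonglongrightarrow> 0"
      using tendsto_ennrealI by fastforce
  qed simp
  have em: "emeasure \<nu> E = ennreal (F E)" if "E \<in> sets \<mu>" for E
    unfolding \<nu>_def
    by (rule emeasure_measure_of_sigma) (use that ca sets.sigma_algebra_axioms[of \<mu>] in \<open>auto simp: positive_def F_empty simp del: space_circle\<close>)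
  have "absolutely_continuous \<mu> \<nu>"
    unfolding absolutely_continuous_def
  proof
    fix E assume "E \<in> null_sets \<mu>"
    then have E: "E \<in> sets \<mu>" "measure \<mu> E = 0" by (auto simp: null_sets_def measure_def)
    have "F E \<le> 0"
    proof (rule field_le_epsilon)
      fix e :: real assume "0 < e"
      then obtain d where "0 < d" "\<forall>E\<in>sets \<mu>. measure \<mu> E < d \<longrightarrow> F E < e" using F_small by blast
      then show "F E \<le> 0 + e" using E by (simp add: less_imp_le)
    qed
    then show "E \<in> null_sets \<nu>" using em[OF E(1)] E by (simp add: null_sets_def ennreal_neg)
  qed
  then obtain f where f [measurable]: "f \<in> borel_measurable \<mu>" and df: "density \<mu> f = \<nu>"
    using circle.Radon_Nikodym[of \<nu>] by auto
  have nn: "(\<integral>\<^sup>+z. f z * indicator E z \<partial>\<mu>) = ennreal (F E)" if "E \<in> sets \<mu>" for E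
    using em[OF that] that by (simp add: df[symmetric] emeasure_density)
  have "(\<integral>\<^sup>+z. f z \<partial>\<mu>) = (\<integral>\<^sup>+z. f z * indicator (space \<mu>) z \<partial>\<mu>)" by (intro nn_integral_cong) simp
  also have "\<dots> < \<infinity>" using nn[OF sets.top] by simp
  finally have fin2: "(\<integral>\<^sup>+z. f z \<partial>\<mu>) < \<infinity>" .
  then have fin: "AE z in \<mu>. f z \<noteq> \<infinity>"
    by (intro nn_integral_noteq_infinite f) simp
  define k where "k z = enn2real (f z)" for z
  have [measurable]: "k \<in> borel_measurable \<mu>" unfolding k_def by measurable
  have kf: "AE z in \<mu>. ennreal (k z) = f z"
    using fin by eventually_elim (simp add: k_def top.not_eq_extremum)
  have nk: "(\<integral>\<^sup>+z. ennreal (k z * indicator E z) \<partial>\<mu>) = (\<integral>\<^sup>+z. f z * indicator E z \<partial>\<mu>)" for E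
    using kf by (intro nn_integral_cong_AE, eventually_elim) (auto split: split_indicator)
  have "integrable \<mu> k"
  proof (rule integrableI_nonneg)
    have "(\<integral>\<^sup>+z. ennreal (k z) \<partial>\<mu>) = (\<integral>\<^sup>+z. f z \<partial>\<mu>)" using kf by (intro nn_integral_cong_AE)
    then show "(\<integral>\<^sup>+z. ennreal (k z) \<partial>\<mu>) < \<infinity>" using fin2 by simp
  qed (auto simp: k_def)
  moreover have "F E = (\<integral>z. k z * indicator E z \<partial>\<mu>)" if E: "E \<in> sets \<mu>" for E
  proof -
    have "(\<integral>z. k z * indicator E z \<partial>\<mu>) = enn2real (\<integral>\<^sup>+z. ennreal (k z * indicator E z) \<partial>\<mu>)"
      using E by (intro integral_eq_nn_integral) (auto simp: k_def)
    also have "\<dots> = F E" using nn[OF E] nk[of E] F_nonneg[OF E] by simp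
    finally show ?thesis by simp
  qed
  ultimately show thesis by (rule that)
qed

text \<open>\<open>\<psi> E\<close> below is the total variation of \<open>Re \<circ> \<phi>\<close> on \<open>E\<close>; adding it to
  \<open>Re (\<phi> (indicator E))\<close> gives a nonnegative set function, so no Hahn decomposition is needed.\<close>

lemma Re_functional_density:
  assumes \<phi>: "\<phi> \<in> dual_space Linf \<alpha>"
  obtains k :: "complex \<Rightarrow> real" where "integrable \<mu> k"
    "\<And>E. E \<in> sets \<mu> \<Longrightarrow> Re (\<phi> (indicator E)) = (\<integral>z. k z * indicator E z \<partial>\<mu>)"
proof -
  obtain C where C: "0 < C" "\<And>f. f \<in> Linf \<Longrightarrow> cmod (\<phi> f) \<le> C * enn2real (\<alpha> f)"
    using Linf.dual_bound[OF \<phi>] by blast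
  \<comment> \<open>The unit ball of the functions carried by E, up to null sets. Indicators split
    it over disjoint sets and addition glues it back together, which is why \<psi> is
    additive.\<close>
  define S where "S E = {g \<in> Linf. AE z in \<mu>. cmod (g z) \<le> indicator E z}" for E :: "complex set"
  define \<psi> where "\<psi> E = (SUP g \<in> S E. Re (\<phi> g))" for E
  have le: "Re (\<phi> g) \<le> C * enn2real (\<alpha> (indicator E))" if "E \<in> sets \<mu>" "g \<in> S E" for E g
  proof -
    have "AE z in \<mu>. cmod (g z) \<le> cmod (indicator E z)" "g \<in> Linf"
      using that by (auto simp: S_def split: split_indicator elim: eventually_mono)
    then have "\<alpha> g \<le> \<alpha> (indicator E)" using that by (intro gauge_mono) auto
    then have "enn2real (\<alpha> g) \<le> enn2real (\<alpha> (indicator E))"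
      using gauge_finite that by (intro enn2real_mono) auto
    then have "C * enn2real (\<alpha> g) \<le> C * enn2real (\<alpha> (indicator E))" using C by simp
    then show ?thesis using C(2)[OF \<open>g \<in> Linf\<close>] complex_Re_le_cmod[of "\<phi> g"] by linarith
  qed
  have S0: "(\<lambda>_. 0) \<in> S E" for E by (simp add: S_def)
  have bdd: "bdd_above ((\<lambda>g. Re (\<phi> g)) ` S E)" if "E \<in> sets \<mu>" for E
    using le[OF that] by (auto intro!: bdd_aboveI)
  have up: "Re (\<phi> g) \<le> \<psi> E" if "E \<in> sets \<mu>" "g \<in> S E" for g E
    unfolding \<psi>_def using bdd that by (intro cSUP_upper)
  have low: "\<psi> E \<le> c" if "\<And>g. g \<in> S E \<Longrightarrow> Re (\<phi> g) \<le> c" for E c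
    unfolding \<psi>_def using S0 that by (intro cSUP_least) auto
  have \<psi>0: "0 \<le> \<psi> E" if "E \<in> sets \<mu>" for E
    using up[OF that S0] Linf.dual_zero[OF \<phi>] by simp
  have \<psi>_le: "\<psi> E \<le> C * enn2real (\<alpha> (indicator E))" if "E \<in> sets \<mu>" for E
    using le[OF that] by (rule low)
  have \<psi>_add: "\<psi> (A \<union> B) = \<psi> A + \<psi> B" if AB: "A \<in> sets \<mu>" "B \<in> sets \<mu>" "A \<inter> B = {}" for A B
  proof (rule antisym)
    show "\<psi> (A \<union> B) \<le> \<psi> A + \<psi> B"
    proof (rule low)
      fix g assume g: "g \<in> S (A \<union> B)"
      then have gL: "g \<in> Linf" and ga: "AE z in \<mu>. cmod (g z) \<le> indicator (A \<union> B) z" by (auto simp: S_def)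
      have gA: "(\<lambda>z. g z * indicator A z) \<in> S A" "(\<lambda>z. g z * indicator B z) \<in> S B"
        using gL ga AB by (auto simp: S_def split: split_indicator elim!: eventually_mono)
      have "\<phi> g = \<phi> (\<lambda>z. g z * indicator A z + g z * indicator B z)"
      proof (rule dual_space_AE_cong_Linf[OF \<phi> gL])
        show "AE z in \<mu>. g z = g z * indicator A z + g z * indicator B z"
          using ga by eventually_elim (use AB in \<open>auto split: split_indicator split_indicator_asm\<close>)
      qed (use gL AB in auto)
      also have "\<dots> = \<phi> (\<lambda>z. g z * indicator A z) + \<phi> (\<lambda>z. g z * indicator B z)"
        using gL AB by (intro Linf.dual_add[OF \<phi>]) auto
      finally show "Re (\<phi> g) \<le> \<psi> A + \<psi> B"
        using up[OF AB(1) gA(1)] up[OF AB(2) gA(2)] by simp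
    qed
  next
    have "\<psi> A \<le> \<psi> (A \<union> B) - \<psi> B"
    proof (rule low)
      fix f assume f: "f \<in> S A"
      have "\<psi> B \<le> \<psi> (A \<union> B) - Re (\<phi> f)"
      proof (rule low)
        fix g assume g: "g \<in> S B"
        have fgL: "f \<in> Linf" "g \<in> Linf" using f g by (auto simp: S_def)
        have "AE z in \<mu>. cmod (f z) \<le> indicator A z" "AE z in \<mu>. cmod (g z) \<le> indicator B z"
          using f g by (auto simp: S_def)
        then have "AE z in \<mu>. cmod (f z + g z) \<le> indicator (A \<union> B) z"
        proof eventually_elim
          case (elim z)
          then have "cmod (f z + g z) \<le> indicator A z + indicator B z" by (rule norm_triangle_mono)
          then show ?case using AB(3) by (auto split: split_indicator split_indicator_asm)
        qed
        then have "(\<lambda>z. f z + g z) \<in> S (A \<union> B)" using fgL by (simp add: S_def)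
        from up[OF _ this] have "Re (\<phi> (\<lambda>z. f z + g z)) \<le> \<psi> (A \<union> B)" using AB by simp
        then show "Re (\<phi> g) \<le> \<psi> (A \<union> B) - Re (\<phi> f)"
          using Linf.dual_add[OF \<phi> fgL] by simp
      qed
      then show "Re (\<phi> f) \<le> \<psi> (A \<union> B) - \<psi> B" by simp
    qed
    then show "\<psi> A + \<psi> B \<le> \<psi> (A \<union> B)" by simp
  qed
  have ind: "indicator E \<in> S E" "(\<lambda>z. -1 * indicator E z) \<in> S E" if "E \<in> sets \<mu>" for E
    using that by (auto simp: S_def split: split_indicator intro!: Linf_mult[OF Linf_const[of "-1"], simplified])
  have \<phi>_add: "Re (\<phi> (indicator (A \<union> B))) = Re (\<phi> (indicator A)) + Re (\<phi> (indicator B))"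
    if AB: "A \<in> sets \<mu>" "B \<in> sets \<mu>" "A \<inter> B = {}" for A B
  proof -
    have "indicator (A \<union> B) = (\<lambda>z. indicator A z + indicator B z :: complex)"
      using AB(3) by (intro ext) (auto split: split_indicator)
    then show ?thesis using Linf.dual_add[OF \<phi> Linf_indicator[OF AB(1)] Linf_indicator[OF AB(2)]] by simp
  qed
  obtain k1 where k1: "integrable \<mu> k1" "\<And>E. E \<in> sets \<mu> \<Longrightarrow> \<psi> E = (\<integral>z. k1 z * indicator E z \<partial>\<mu>)"
    using set_function_density[of \<psi>, OF \<psi>0 \<psi>_add \<psi>_le C(1)] by blast
  \<comment> \<open>Since the negative of \<open>indicator E\<close> lies in \<open>S E\<close>, the
    sum is nonnegative; each of its two terms is at most C times the gauge of the indicator, hence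
    the factor 2.\<close>
  obtain k2 where k2: "integrable \<mu> k2"
    "\<And>E. E \<in> sets \<mu> \<Longrightarrow> \<psi> E + Re (\<phi> (indicator E)) = (\<integral>z. k2 z * indicator E z \<partial>\<mu>)"
  proof (rule set_function_density[of "\<lambda>E. \<psi> E + Re (\<phi> (indicator E))" "2 * C"])
    show "0 \<le> \<psi> E + Re (\<phi> (indicator E))" if E: "E \<in> sets \<mu>" for E
      using up[OF E ind(2)[OF E]] Linf.dual_scale[OF \<phi> Linf_indicator[OF E], of "-1"] by simp
    show "\<psi> E + Re (\<phi> (indicator E)) \<le> 2 * C * enn2real (\<alpha> (indicator E))" if E: "E \<in> sets \<mu>" for E
      using \<psi>_le[OF E] le[OF E ind(1)[OF E]] by simp
  qed (use \<psi>_add \<phi>_add C in auto)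
  show thesis
  proof (rule that[of "\<lambda>z. k2 z - k1 z"])
    fix E assume E: "E \<in> sets \<mu>"
    have "(\<integral>z. (k2 z - k1 z) * indicator E z \<partial>\<mu>) = (\<integral>z. k2 z * indicator E z - k1 z * indicator E z \<partial>\<mu>)"
      by (simp add: left_diff_distrib)
    also have "\<dots> = (\<integral>z. k2 z * indicator E z \<partial>\<mu>) - (\<integral>z. k1 z * indicator E z \<partial>\<mu>)"
      using k1(1) k2(1) E by (intro Bochner_Integration.integral_diff integrable_real_mult_indicator)
    also have "\<dots> = Re (\<phi> (indicator E))" using k1(2)[OF E] k2(2)[OF E] by simp
    finally show "Re (\<phi> (indicator E)) = (\<integral>z. (k2 z - k1 z) * indicator E z \<partial>\<mu>)" by simp
  qed (use k1 k2 in auto)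
qed

end

context cont_gauge
begin

text \<open>Real and imaginary part of \<phi> have densities on indicators; linearity carries the
  formula to simple functions, and both sides are continuous in the sup norm, in which these are
  dense in \<open>Linf\<close>.\<close>

lemma Linf_functional_integral:
  assumes \<phi>: "\<phi> \<in> dual_space Linf \<alpha>"
  obtains h where "integrable \<mu> h" "\<And>f. f \<in> Linf \<Longrightarrow> \<phi> f = (\<integral>z. f z * h z \<partial>\<mu>)"
proof -
  obtain C where C: "0 < C" "\<And>f. f \<in> Linf \<Longrightarrow> cmod (\<phi> f) \<le> C * enn2real (\<alpha> f)"
    using Linf.dual_bound[OF \<phi>] by blast
  obtain k1 :: "complex \<Rightarrow> real" where k1: "integrable \<mu> k1"
    "\<And>E. E \<in> sets \<mu> \<Longrightarrow> Re (\<phi> (indicator E)) = (\<integral>z. k1 z * indicator E z \<partial>\<mu>)"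
    using Re_functional_density[OF \<phi>] by blast
  \<comment> \<open>Re (- i z) = Im z, so the real lemma also yields the density of the imaginary
    part.\<close>
  have "(\<lambda>f. - \<i> * \<phi> f) \<in> dual_space Linf \<alpha>"
    using \<phi> unfolding dual_space_def by (auto simp: norm_mult algebra_simps)
  then obtain k2 :: "complex \<Rightarrow> real" where k2: "integrable \<mu> k2"
    "\<And>E. E \<in> sets \<mu> \<Longrightarrow> Re (- \<i> * \<phi> (indicator E)) = (\<integral>z. k2 z * indicator E z \<partial>\<mu>)"
    using Re_functional_density by blast
  define h where "h z = complex_of_real (k1 z) + \<i> * complex_of_real (k2 z)" for z
  have h: "integrable \<mu> h"
    unfolding h_def using k1(1) k2(1) by (intro Bochner_Integration.integrable_add integrable_mult_right) auto
  have ind: "\<phi> (indicator E) = (\<integral>z. indicator E z * h z \<partial>\<mu>)" if E: "E \<in> sets \<mu>" for E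
  proof -
    have i: "integrable \<mu> (\<lambda>z. complex_of_real (k1 z * indicator E z))"
      "integrable \<mu> (\<lambda>z. complex_of_real (k2 z * indicator E z))"
      using k1(1) k2(1) E by (auto simp del: of_real_mult intro!: integrable_real_mult_indicator)
    have "(\<integral>z. indicator E z * h z \<partial>\<mu>)
        = (\<integral>z. complex_of_real (k1 z * indicator E z) + \<i> * complex_of_real (k2 z * indicator E z) \<partial>\<mu>)"
      by (intro Bochner_Integration.integral_cong) (auto simp: h_def split: split_indicator)
    also have "\<dots> = complex_of_real (\<integral>z. k1 z * indicator E z \<partial>\<mu>) + \<i> * complex_of_real (\<integral>z. k2 z * indicator E z \<partial>\<mu>)"
      using i by (subst Bochner_Integration.integral_add) (auto simp del: of_real_mult)
    also have "\<dots> = \<phi> (indicator E)"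
      using k1(2)[OF E] k2(2)[OF E] by (simp add: complex_eq_iff)
    finally show ?thesis by simp
  qed
  have simple: "\<phi> s = (\<integral>z. s z * h z \<partial>\<mu>)" if s: "simple_function \<mu> s" for s
  proof -
    define S where "S = s ` space \<mu>"
    define A where "A y = s -` {y} \<inter> space \<mu>" for y
    have S: "finite S" and A: "\<And>y. y \<in> S \<Longrightarrow> A y \<in> sets \<mu>"
      using s by (auto simp: simple_function_def S_def A_def)
    have eq: "s z = (\<Sum>y\<in>S. y * indicator (A y) z)" if z: "z \<in> space \<mu>" for z
    proof -
      have "(\<Sum>y\<in>S. y * indicator (A y) z) = (\<Sum>y\<in>S. if y = s z then y else 0)"
        using z by (intro sum.cong) (auto simp: A_def)
      also have "\<dots> = s z" using z S by (auto simp: S_def)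
      finally show ?thesis by simp
    qed
    have AL: "(\<lambda>z. y * indicator (A y) z) \<in> Linf" if "y \<in> S" for y using A[OF that] by simp
    note sum = Linf.dual_sum[OF \<phi> S, of "\<lambda>y z. y * indicator (A y) z", OF AL]
    have "\<phi> s = \<phi> (\<lambda>z. \<Sum>y\<in>S. y * indicator (A y) z)"
      using eq sum Linf_simple[OF s] by (intro dual_space_AE_cong_Linf[OF \<phi>]) auto
    also have "\<dots> = (\<Sum>y\<in>S. y * \<phi> (indicator (A y)))"
      using sum A by (auto intro!: sum.cong Linf.dual_scale[OF \<phi>])
    also have "\<dots> = (\<Sum>y\<in>S. (\<integral>z. y * (indicator (A y) z * h z) \<partial>\<mu>))"
      using ind A by (intro sum.cong) auto
    also have "\<dots> = (\<integral>z. (\<Sum>y\<in>S. y * (indicator (A y) z * h z)) \<partial>\<mu>)"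
      using A h by (intro Bochner_Integration.integral_sum[symmetric] integrable_mult_right integrable_mult_Linf) auto
    also have "\<dots> = (\<integral>z. s z * h z \<partial>\<mu>)"
      using eq by (intro Bochner_Integration.integral_cong) (auto simp: sum_distrib_right mult.assoc)
    finally show ?thesis .
  qed
  have "\<phi> f = (\<integral>z. f z * h z \<partial>\<mu>)" if f: "f \<in> Linf" for f
  proof -
    \<comment> \<open>Both sides are Lipschitz in the sup norm: the functional with constant C,
      because \<alpha> is at most the essential supremum, and the integral with constant
      \<integral>|h|.\<close>
    define D where "D = C + (\<integral>z. cmod (h z) \<partial>\<mu>) + 1"
    have D: "0 < D" unfolding D_def using C(1) by (simp add: add_pos_nonneg)
    have "cmod (\<phi> f - (\<integral>z. f z * h z \<partial>\<mu>)) \<le> 0"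
    proof (rule field_le_epsilon)
      fix e :: real assume e: "0 < e"
      define d where "d = e / D"
      have d: "0 < d" unfolding d_def using e D by simp
      obtain s where s: "simple_function \<mu> s" "AE z in \<mu>. cmod (f z - s z) \<le> d"
        using simple_approximation[OF f d] by blast
      note sL = Linf_simple[OF s(1)]
      have "\<alpha> (\<lambda>z. f z - s z) \<le> ennreal d" using f sL s(2) by (intro gauge_le_bound) auto
      then have "enn2real (\<alpha> (\<lambda>z. f z - s z)) \<le> d" using d by (intro enn2real_leI) auto
      then have "C * enn2real (\<alpha> (\<lambda>z. f z - s z)) \<le> C * d" using C(1) by simp
      then have 1: "cmod (\<phi> f - \<phi> s) \<le> C * d"
        using C(2)[OF Linf_diff[OF f sL]] unfolding Linf.dual_diff[OF \<phi> f sL] by (rule order_trans[rotated])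
      have "(\<integral>z. s z * h z \<partial>\<mu>) - (\<integral>z. f z * h z \<partial>\<mu>) = (\<integral>z. (s z - f z) * h z \<partial>\<mu>)"
        using integrable_mult_Linf[OF f h] integrable_mult_Linf[OF sL h]
        by (simp add: left_diff_distrib)
      also have "cmod \<dots> \<le> (\<integral>z. cmod ((s z - f z) * h z) \<partial>\<mu>)" by (rule integral_norm_bound)
      also have "\<dots> \<le> (\<integral>z. d * cmod (h z) \<partial>\<mu>)"
      proof (rule integral_mono_AE)
        show "integrable \<mu> (\<lambda>z. cmod ((s z - f z) * h z))"
          using f sL h by (intro integrable_norm integrable_mult_Linf) auto
        show "AE z in \<mu>. cmod ((s z - f z) * h z) \<le> d * cmod (h z)"
          using s(2) by eventually_elim (auto simp: norm_mult norm_minus_commute intro: mult_right_mono)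
      qed (use h in auto)
      also have "\<dots> = (\<integral>z. cmod (h z) \<partial>\<mu>) * d" by simp
      finally have 2: "cmod (\<phi> s - (\<integral>z. f z * h z \<partial>\<mu>)) \<le> (\<integral>z. cmod (h z) \<partial>\<mu>) * d"
        unfolding simple[OF s(1)] .
      have "cmod (\<phi> f - (\<integral>z. f z * h z \<partial>\<mu>)) \<le> cmod (\<phi> f - \<phi> s) + cmod (\<phi> s - (\<integral>z. f z * h z \<partial>\<mu>))"
        using norm_triangle_ineq[of "\<phi> f - \<phi> s" "\<phi> s - (\<integral>z. f z * h z \<partial>\<mu>)"] by simp
      also have "\<dots> \<le> D * d" using 1 2 d by (simp add: D_def algebra_simps)
      also have "\<dots> = e" using D by (simp add: d_def)
      finally show "cmod (\<phi> f - (\<integral>z. f z * h z \<partial>\<mu>)) \<le> 0 + e" by simp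
    qed
    then show ?thesis by simp
  qed
  with h show thesis by (rule that)
qed

text \<open>A functional norming the constant \<open>1\<close> is integration against some \<open>h\<close>; averaging over all
  rotations of \<open>f\<close> replaces \<open>h\<close> by its mean \<open>1\<close>.\<close>

lemma integral_cmod_le_gauge:
  assumes f: "f \<in> Linf"
  shows "ennreal (\<integral>z. cmod (f z) \<partial>\<mu>) \<le> \<alpha> f"
proof -
  obtain \<phi> where \<phi>: "\<phi> \<in> dual_space Linf \<alpha>" "\<And>f. f \<in> Linf \<Longrightarrow> cmod (\<phi> f) \<le> enn2real (\<alpha> f)"
    "\<phi> (\<lambda>_. 1) = enn2real (\<alpha> (\<lambda>_. 1))"
    using Linf.norming_functional[of "\<lambda>_. 1"] by auto
  obtain h where h: "integrable \<mu> h" "\<And>f. f \<in> Linf \<Longrightarrow> \<phi> f = (\<integral>z. f z * h z \<partial>\<mu>)"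
    using Linf_functional_integral[OF \<phi>(1)] by blast
  have h1: "(\<integral>z. h z \<partial>\<mu>) = 1" using h(2)[of "\<lambda>_. 1"] \<phi>(3) gauge_one by simp
  have [measurable]: "h \<in> borel_measurable \<mu>" using h by simp
  note [measurable] = f
  obtain C where C: "0 < C" "AE z in \<mu>. cmod (f z) \<le> C" using LinfE[OF f] by blast
  \<comment> \<open>A version of |f| that is bounded everywhere rather than almost everywhere, so
    that C |h| dominates pointwise on the product space.\<close>
  define g where "g z = complex_of_real (min C (cmod (f z)))" for z
  have gm [measurable]: "g \<in> borel_measurable \<mu>" unfolding g_def by measurable
  have gC: "cmod (g z) \<le> C" for z using C by (simp add: g_def)
  have gL: "g \<in> Linf" using gC by (intro LinfI[of _ C]) auto
  have gf: "AE z in \<mu>. g z = complex_of_real (cmod (f z))"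
    using C(2) by eventually_elim (simp add: g_def)
  have \<alpha>g: "\<alpha> g = \<alpha> f"
    using gauge_cong[OF gL Linf_cmod[OF f] gf] gauge_cmod[OF f] by simp
  interpret P: pair_sigma_finite \<mu> \<mu> ..
  define F where "F w z = g (w * z) * h z" for w z
  have [measurable]: "(\<lambda>p. g (fst p * snd p)) \<in> borel_measurable (\<mu> \<Otimes>\<^sub>M \<mu>)"
    using measurable_compose[OF measurable_mult_circle gm] by (simp add: split_beta)
  have Fm: "(\<lambda>(w, z). F w z) \<in> borel_measurable (\<mu> \<Otimes>\<^sub>M \<mu>)"
    unfolding F_def split_beta by measurable
  have Ci: "integrable (\<mu> \<Otimes>\<^sub>M \<mu>) (\<lambda>p. complex_of_real C * h (snd p))"
    using h(1) by (intro P.Fubini_integrable) auto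
  have Fi: "integrable (\<mu> \<Otimes>\<^sub>M \<mu>) (\<lambda>(w, z). F w z)"
    using gC C(1)
    by (intro Bochner_Integration.integrable_bound[OF Ci Fm]) (auto simp: F_def norm_mult intro!: AE_I2 mult_right_mono)
  have inner_w: "(\<integral>w. F w z \<partial>\<mu>) = (\<integral>w. g w \<partial>\<mu>) * h z" if z: "z \<in> space \<mu>" for z
  proof -
    have "(\<integral>w. g w \<partial>\<mu>) = (\<integral>w. g w \<partial>distr \<mu> \<mu> (\<lambda>w. z * w))" using z by (simp add: distr_rotate)
    also have "\<dots> = (\<integral>w. g (z * w) \<partial>\<mu>)" using z measurable_rotate by (intro integral_distr) auto
    finally show ?thesis by (simp add: F_def mult.commute)
  qed
  have inner_z: "cmod (\<integral>z. F w z \<partial>\<mu>) \<le> enn2real (\<alpha> f)" if w: "w \<in> space \<mu>" for w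
  proof -
    have "(\<integral>z. F w z \<partial>\<mu>) = \<phi> (\<lambda>z. g (w * z))"
      using w gL by (simp add: h(2) F_def)
    moreover have "\<alpha> (\<lambda>z. g (w * z)) = \<alpha> g" using gauge_rotate[OF gL, of "cnj w"] w by simp
    ultimately show ?thesis using \<phi>(2)[of "\<lambda>z. g (w * z)"] gL w \<alpha>g by simp
  qed
  \<comment> \<open>For fixed w the inner integral is \<phi> at a rotation of g, hence at most
    \<alpha> f in modulus. For fixed z the mean of g over w does not depend on z, and h contributes
    only its own mean 1.\<close>
  have "(\<integral>w. (\<integral>z. F w z \<partial>\<mu>) \<partial>\<mu>) = (\<integral>z. (\<integral>w. F w z \<partial>\<mu>) \<partial>\<mu>)"
    using P.Fubini_integral[OF Fi] by simp
  also have "\<dots> = (\<integral>z. (\<integral>w. g w \<partial>\<mu>) * h z \<partial>\<mu>)"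
    using inner_w by (intro Bochner_Integration.integral_cong) auto
  also have "\<dots> = (\<integral>z. g z \<partial>\<mu>)" using h1 by simp
  also have "\<dots> = (\<integral>z. complex_of_real (cmod (f z)) \<partial>\<mu>)"
    using gf by (intro integral_cong_AE) auto
  also have "\<dots> = complex_of_real (\<integral>z. cmod (f z) \<partial>\<mu>)" by (rule integral_complex_of_real)
  finally have eq: "(\<integral>w. (\<integral>z. F w z \<partial>\<mu>) \<partial>\<mu>) = complex_of_real (\<integral>z. cmod (f z) \<partial>\<mu>)" .
  have "(\<integral>z. cmod (f z) \<partial>\<mu>) = cmod (\<integral>w. (\<integral>z. F w z \<partial>\<mu>) \<partial>\<mu>)"
    unfolding eq by (simp add: integral_nonneg)
  also have "\<dots> \<le> (\<integral>w. cmod (\<integral>z. F w z \<partial>\<mu>) \<partial>\<mu>)" by (rule integral_norm_bound)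
  also have "\<dots> \<le> (\<integral>w. enn2real (\<alpha> f) \<partial>\<mu>)"
    using inner_z P.integrable_fst[OF Fi] by (intro integral_mono) auto
  also have "\<dots> = enn2real (\<alpha> f)" by (simp add: circle.prob_space[simplified])
  finally show ?thesis using Linf.ennreal_real[OF f] ennreal_leI by metis
qed

lemma gauge_eq_0_iff: "\<alpha> f = 0 \<longleftrightarrow> (AE z in \<mu>. f z = 0)" if f: "f \<in> Linf"
proof
  assume "\<alpha> f = 0"
  then have "(\<integral>z. cmod (f z) \<partial>\<mu>) \<le> 0" using integral_cmod_le_gauge[OF f] by (simp add: ennreal_eq_0_iff)
  then have "(\<integral>z. cmod (f z) \<partial>\<mu>) = 0" by (simp add: antisym)
  then show "AE z in \<mu>. f z = 0"
    using f by (subst (asm) integral_nonneg_eq_0_iff_AE) auto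
next
  assume "AE z in \<mu>. f z = 0"
  then show "\<alpha> f = 0" using gauge_cong[OF f Linf_const, of 0] by (simp add: gauge_zero)
qed

end

text \<open>\<open>phase 0 = 0\<close>, by \<open>0 / 0 = 0\<close>.\<close>

definition phase :: "complex \<Rightarrow> complex" where
  "phase z = cnj z / complex_of_real (cmod z)"

lemma phase_mult: "phase z * z = complex_of_real (cmod z)"
  by (cases "z = 0")
    (auto simp: phase_def complex_norm_square[symmetric] power2_eq_square[symmetric] mult.commute[of "cnj z"] divide_simps)

lemma cmod_phase: "cmod (phase z) \<le> 1"
  by (cases "z = 0") (auto simp: phase_def norm_divide)

lemma borel_measurable_phase [measurable]: "phase \<in> borel_measurable borel"
  unfolding phase_def[abs_def] by measurable

section \<open>The dual gauge of a continuous gauge\<close>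

context rot_gauge
begin

lemma dual_gauge_upper: "ennreal (cmod (\<integral>z. f z * h z \<partial>\<mu>)) \<le> dual_gauge \<alpha> f" if "h \<in> Linf" "\<alpha> h \<le> 1"
  unfolding dual_gauge_def using that by (intro SUP_upper) auto

text \<open>The phase of f is absorbed into the test function, which does not raise its gauge. This
  is why the two suprema that describe the dual norm agree.\<close>

lemma dual_gauge_cmod_upper:
  assumes f: "f \<in> Linf" and h: "h \<in> Linf" "\<alpha> h \<le> 1"
  shows "ennreal (\<integral>z. cmod (f z) * cmod (h z) \<partial>\<mu>) \<le> dual_gauge \<alpha> f"
proof -
  note [measurable] = f h(1)
  define g where "g z = phase (f z) * complex_of_real (cmod (h z))" for z
  have gh: "cmod (g z) \<le> cmod (h z)" for z
    using mult_right_mono[OF cmod_phase norm_ge_zero[of "h z"], of "f z"] by (simp add: g_def norm_mult)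
  have "g \<in> borel_measurable \<mu>" unfolding g_def by measurable
  then have g: "g \<in> Linf" using gh by (intro Linf_dominated[OF _ h(1)]) auto
  have "\<alpha> g \<le> \<alpha> h" using gh by (intro gauge_mono g h) auto
  then have "\<alpha> g \<le> 1" using h(2) by simp
  have "(\<integral>z. f z * g z \<partial>\<mu>) = (\<integral>z. complex_of_real (cmod (f z) * cmod (h z)) \<partial>\<mu>)"
    unfolding g_def using phase_mult by (simp add: mult.assoc[symmetric] mult.commute)
  also have "\<dots> = complex_of_real (\<integral>z. cmod (f z) * cmod (h z) \<partial>\<mu>)" by (rule integral_complex_of_real)
  finally have "cmod (\<integral>z. f z * g z \<partial>\<mu>) = (\<integral>z. cmod (f z) * cmod (h z) \<partial>\<mu>)"
    by (simp add: integral_nonneg)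
  then show ?thesis using dual_gauge_upper[OF g \<open>\<alpha> g \<le> 1\<close>, of f] by simp
qed

lemma dual_gauge_eq_cmod:
  assumes f: "f \<in> Linf"
  shows "dual_gauge \<alpha> f = (SUP h \<in> {h \<in> Linf. \<alpha> h \<le> 1}. ennreal (\<integral>z. cmod (f z) * cmod (h z) \<partial>\<mu>))"
proof (rule antisym)
  show "dual_gauge \<alpha> f \<le> (SUP h \<in> {h \<in> Linf. \<alpha> h \<le> 1}. ennreal (\<integral>z. cmod (f z) * cmod (h z) \<partial>\<mu>))"
    unfolding dual_gauge_def
    by (intro SUP_mono) (auto simp flip: norm_mult intro!: ennreal_leI integral_norm_bound)
qed (use dual_gauge_cmod_upper[OF f] in \<open>auto intro: SUP_least\<close>)

end

text \<open>A test function h with \<alpha> h \<le> 1 has \<integral>|h| \<le> 1, so the dual gauge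
  of f is at most its essential supremum. This gives finiteness and, together with the test function
  1, the normalization; a rotation of f is shifted to the test function.\<close>

sublocale cont_gauge \<subseteq> dual: rot_gauge "dual_gauge \<alpha>"
proof
  have bound: "dual_gauge \<alpha> f \<le> ennreal C" if f: "f \<in> Linf" and C: "AE z in \<mu>. cmod (f z) \<le> C" for f C
  proof -
    have "ennreal (\<integral>z. cmod (f z) * cmod (h z) \<partial>\<mu>) \<le> ennreal C" if h: "h \<in> Linf" "\<alpha> h \<le> 1" for h
    proof -
      have "(\<integral>z. cmod (h z) \<partial>\<mu>) \<le> 1" using integral_cmod_le_gauge[OF h(1)] h(2) by (metis ennreal_le_1 order_trans)
      have C0: "0 \<le> C"
      proof -
        have "AE z in \<mu>. 0 \<le> C" using C by eventually_elim (metis norm_ge_zero order_trans)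
        then show ?thesis by simp
      qed
      have "(\<integral>z. cmod (f z) * cmod (h z) \<partial>\<mu>) \<le> (\<integral>z. C * cmod (h z) \<partial>\<mu>)"
      proof (rule integral_mono_AE)
        show "integrable \<mu> (\<lambda>z. cmod (f z) * cmod (h z))"
          using integrable_norm[OF integrable_Linf[OF Linf_mult[OF f h(1)]]] by (simp add: norm_mult)
        show "AE z in \<mu>. cmod (f z) * cmod (h z) \<le> C * cmod (h z)"
          using C by eventually_elim (auto intro: mult_right_mono)
      qed (use integrable_Linf[OF h(1)] in auto)
      also have "\<dots> \<le> C * 1" using \<open>(\<integral>z. cmod (h z) \<partial>\<mu>) \<le> 1\<close> C0 by (simp add: mult_left_le)
      finally show ?thesis by (simp add: ennreal_leI)
    qed
    then show ?thesis unfolding dual_gauge_eq_cmod[OF f] by (auto intro: SUP_least)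
  qed
  have fin: "dual_gauge \<alpha> f < \<infinity>" if f: "f \<in> Linf" for f
    using bound[OF f] LinfE[OF f] by (metis ennreal_less_top infinity_ennreal_def le_less_trans)
  have cong: "dual_gauge \<alpha> f = dual_gauge \<alpha> g" if "f \<in> Linf" "g \<in> Linf" "AE z in \<mu>. f z = g z" for f g
  proof -
    have "(\<integral>z. f z * h z \<partial>\<mu>) = (\<integral>z. g z * h z \<partial>\<mu>)" if "h \<in> Linf" for h
      using that \<open>f \<in> Linf\<close> \<open>g \<in> Linf\<close> \<open>AE z in \<mu>. f z = g z\<close>
      by (intro integral_cong_AE) (auto elim: eventually_mono)
    then show ?thesis unfolding dual_gauge_def by (intro SUP_cong) auto
  qed
  have add: "dual_gauge \<alpha> (\<lambda>z. f z + g z) \<le> dual_gauge \<alpha> f + dual_gauge \<alpha> g" if fg: "f \<in> Linf" "g \<in> Linf" for f g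
    unfolding dual_gauge_def[of \<alpha> "\<lambda>z. f z + g z"]
  proof (rule SUP_least, clarify)
    fix h assume h: "h \<in> Linf" "\<alpha> h \<le> 1"
    have "(\<integral>z. (f z + g z) * h z \<partial>\<mu>) = (\<integral>z. f z * h z \<partial>\<mu>) + (\<integral>z. g z * h z \<partial>\<mu>)"
      using fg h by (simp add: distrib_right)
    then have "ennreal (cmod (\<integral>z. (f z + g z) * h z \<partial>\<mu>)) \<le> ennreal (cmod (\<integral>z. f z * h z \<partial>\<mu>)) + ennreal (cmod (\<integral>z. g z * h z \<partial>\<mu>))"
      by (simp add: norm_triangle_ineq ennreal_leI flip: ennreal_plus)
    also have "\<dots> \<le> dual_gauge \<alpha> f + dual_gauge \<alpha> g" using h by (intro add_mono dual_gauge_upper)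
    finally show "ennreal (cmod (\<integral>z. (f z + g z) * h z \<partial>\<mu>)) \<le> dual_gauge \<alpha> f + dual_gauge \<alpha> g" .
  qed
  have scale: "dual_gauge \<alpha> (\<lambda>z. c * f z) = ennreal (cmod c) * dual_gauge \<alpha> f" for c f
    unfolding dual_gauge_def SUP_mult_left_ennreal
    by (intro SUP_cong) (auto simp: mult.assoc norm_mult ennreal_mult)
  have one: "dual_gauge \<alpha> (\<lambda>z. 1) = 1"
  proof (rule antisym)
    show "dual_gauge \<alpha> (\<lambda>z. 1) \<le> 1" using bound[of "\<lambda>z. 1" 1] by simp
    show "1 \<le> dual_gauge \<alpha> (\<lambda>z. 1)"
      using dual_gauge_upper[of "\<lambda>z. 1" "\<lambda>z. 1"] gauge_one by (simp add: circle.prob_space[simplified])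
  qed
  have cm: "dual_gauge \<alpha> (\<lambda>z. complex_of_real (cmod (f z))) = dual_gauge \<alpha> f" if f: "f \<in> Linf" for f
    using f by (simp add: dual_gauge_eq_cmod)
  have rot: "dual_gauge \<alpha> (\<lambda>z. f (cnj w * z)) = dual_gauge \<alpha> f" if f: "f \<in> Linf" and w: "w \<in> sphere 0 1" for f w
  proof -
    have ww: "cnj w * (w * z) = z" "w * (cnj w * z) = z" for z
      using w complex_norm_square[of w] by (simp_all add: mult.assoc[symmetric] mult.commute)
    have eq: "(\<integral>z. f (cnj w * z) * h z \<partial>\<mu>) = (\<integral>z. f z * h (w * z) \<partial>\<mu>)" if h: "h \<in> Linf" for h
    proof -
      note [measurable] = measurable_rotate[OF w]
      have fm: "f \<in> borel_measurable \<mu>" and hm: "h \<in> borel_measurable \<mu>" using f h by auto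
      have [measurable]: "(\<lambda>z. cnj w * z) \<in> measurable \<mu> \<mu>" using w by (intro measurable_rotate) simp
      have "(\<integral>z. f (cnj w * z) * h z \<partial>\<mu>) = (\<integral>z. f (cnj w * z) * h z \<partial>distr \<mu> \<mu> (\<lambda>z. w * z))"
        using distr_rotate[OF w] by simp
      also have "\<dots> = (\<integral>z. f (cnj w * (w * z)) * h (w * z) \<partial>\<mu>)"
        by (intro integral_distr borel_measurable_times measurable_compose[OF _ fm]) (use hm in measurable)
      finally show ?thesis by (simp only: ww)
    qed
    show ?thesis
    proof (rule antisym)
      show "dual_gauge \<alpha> (\<lambda>z. f (cnj w * z)) \<le> dual_gauge \<alpha> f"
        unfolding dual_gauge_def[of \<alpha> "\<lambda>z. f (cnj w * z)"]
      proof (rule SUP_least, clarify)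
        fix h assume h: "h \<in> Linf" "\<alpha> h \<le> 1"
        have "(\<lambda>z. h (w * z)) \<in> Linf" "\<alpha> (\<lambda>z. h (w * z)) \<le> 1"
          using h w gauge_rotate[OF h(1), of "cnj w"] by auto
        then show "ennreal (cmod (\<integral>z. f (cnj w * z) * h z \<partial>\<mu>)) \<le> dual_gauge \<alpha> f"
          unfolding eq[OF h(1)] by (rule dual_gauge_upper)
      qed
      show "dual_gauge \<alpha> f \<le> dual_gauge \<alpha> (\<lambda>z. f (cnj w * z))"
        unfolding dual_gauge_def[of \<alpha> f]
      proof (rule SUP_least, clarify)
        fix h assume h: "h \<in> Linf" "\<alpha> h \<le> 1"
        have h': "(\<lambda>z. h (cnj w * z)) \<in> Linf" "\<alpha> (\<lambda>z. h (cnj w * z)) \<le> 1"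
          using h w gauge_rotate[OF h(1), of "w"] by auto
        show "ennreal (cmod (\<integral>z. f z * h z \<partial>\<mu>)) \<le> dual_gauge \<alpha> (\<lambda>z. f (cnj w * z))"
          using dual_gauge_upper[OF h', of "\<lambda>z. f (cnj w * z)"] unfolding eq[OF h'(1)] by (simp only: ww)
      qed
    qed
  qed
  show "dual_gauge \<alpha> \<in> rot_sym_seminorms"
    unfolding rot_sym_seminorms_def using cong fin add scale one cm rot by blast
qed

section \<open>The dual space and the second dual gauge\<close>

lemma (in rot_gauge) dual_eq_on_closure:
  assumes A: "A \<subseteq> Linf" and V: "seminormed_functions (gauge_closure \<alpha> A) (gauge_ext \<alpha>)"
    and \<phi>: "\<phi> \<in> dual_space (gauge_closure \<alpha> A) (gauge_ext \<alpha>)"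
    and \<psi>: "\<psi> \<in> dual_space (gauge_closure \<alpha> A) (gauge_ext \<alpha>)"
    and eq: "\<And>f. f \<in> A \<Longrightarrow> \<phi> f = \<psi> f"
  shows "\<phi> = \<psi>"
proof
  fix f
  interpret V: seminormed_functions "gauge_closure \<alpha> A" "gauge_ext \<alpha>" by (rule V)
  show "\<phi> f = \<psi> f"
  proof (cases "f \<in> gauge_closure \<alpha> A")
    case True
    obtain C where C: "0 < C" "\<And>f. f \<in> gauge_closure \<alpha> A \<Longrightarrow> cmod (\<phi> f) \<le> C * enn2real (gauge_ext \<alpha> f)"
      using V.dual_bound[OF \<phi>] by blast
    obtain D where D: "0 < D" "\<And>f. f \<in> gauge_closure \<alpha> A \<Longrightarrow> cmod (\<psi> f) \<le> D * enn2real (gauge_ext \<alpha> f)"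
      using V.dual_bound[OF \<psi>] by blast
    have "cmod (\<phi> f - \<psi> f) \<le> 0"
    proof (rule field_le_epsilon)
      fix e :: real assume e: "0 < e"
      define d where "d = e / (C + D)"
      have d: "0 < d" unfolding d_def using C D e by simp
      obtain g where g: "g \<in> A" "gauge_ext \<alpha> (\<lambda>z. f z - g z) < ennreal d"
        using gauge_closure_approx[OF True d] by blast
      have gV: "g \<in> gauge_closure \<alpha> A" using g gauge_closure_superset[OF A] by blast
      have fg: "(\<lambda>z. f z - g z) \<in> gauge_closure \<alpha> A" using V.diff_closed[OF True gV] .
      have n: "enn2real (gauge_ext \<alpha> (\<lambda>z. f z - g z)) \<le> d"
        using g(2) d by (intro enn2real_leI) auto
      have "\<phi> f - \<psi> f = \<phi> (\<lambda>z. f z - g z) - \<psi> (\<lambda>z. f z - g z)"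
        using V.dual_diff[OF \<phi> True gV] V.dual_diff[OF \<psi> True gV] eq[OF g(1)] by simp
      also have "cmod \<dots> \<le> cmod (\<phi> (\<lambda>z. f z - g z)) + cmod (\<psi> (\<lambda>z. f z - g z))"
        by (rule norm_triangle_ineq4)
      also have "\<dots> \<le> C * enn2real (gauge_ext \<alpha> (\<lambda>z. f z - g z)) + D * enn2real (gauge_ext \<alpha> (\<lambda>z. f z - g z))"
        using C(2)[OF fg] D(2)[OF fg] by (rule add_mono)
      also have "\<dots> = (C + D) * enn2real (gauge_ext \<alpha> (\<lambda>z. f z - g z))" by (simp add: distrib_right)
      also have "\<dots> \<le> (C + D) * d" using n C D by (intro mult_left_mono) auto
      also have "\<dots> = e" using C D by (simp add: d_def)
      finally show "cmod (\<phi> f - \<psi> f) \<le> 0 + e" by simp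
    qed
    then show ?thesis by simp
  qed (use V.dual_outside[OF \<phi>] V.dual_outside[OF \<psi>] in auto)
qed

lemma Linf_truncate:
  assumes "f \<in> borel_measurable \<mu>"
  shows "(\<lambda>z. f z * indicator {z \<in> space \<mu>. cmod (f z) \<le> c} z) \<in> Linf"
proof -
  note [measurable] = assms
  have "{z \<in> space \<mu>. cmod (f z) \<le> c} \<in> sets \<mu>" by measurable
  then have "(\<lambda>z. f z * indicator {z \<in> space \<mu>. cmod (f z) \<le> c} z) \<in> borel_measurable \<mu>" by measurable
  then show ?thesis by (rule LinfI[of _ "max 0 c"]) (auto intro!: AE_I2 split: split_indicator)
qed

section \<open>Hoelder's inequality, the dual of \<open>Lgauge \<alpha>\<close> and the second dual
  gauge\<close>

context cont_gauge
begin

text \<open>If \<alpha> f > 0, then f divided by \<alpha> f is a test function for the dual gauge.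
  If \<alpha> f = 0, normalizing is impossible, but then f vanishes almost everywhere because
  \<alpha> dominates the integral of |f|.\<close>

lemma holder_Linf:
  assumes f: "f \<in> Linf" and h: "h \<in> Linf"
  shows "ennreal (\<integral>z. cmod (f z) * cmod (h z) \<partial>\<mu>) \<le> \<alpha> f * dual_gauge \<alpha> h"
proof (cases "\<alpha> f = 0")
  case True
  note [measurable] = f h
  have "AE z in \<mu>. f z = 0" using True gauge_eq_0_iff[OF f] by simp
  then have "AE z in \<mu>. cmod (f z) * cmod (h z) = 0" by eventually_elim simp
  then have "(\<integral>z. cmod (f z) * cmod (h z) \<partial>\<mu>) = (\<integral>z. 0 \<partial>\<mu>)"
    by (intro integral_cong_AE) auto
  then show ?thesis by simp
next
  case False
  define c where "c = enn2real (\<alpha> f)"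
  have c: "0 < c" "ennreal c = \<alpha> f"
    using False Linf.ennreal_real[OF f] by (auto simp: c_def enn2real_positive_iff gauge_finite[OF f, simplified] zero_less_iff_neq_zero)
  define g where "g z = complex_of_real (1 / c) * f z" for z
  have g: "g \<in> Linf" unfolding g_def using f by (intro Linf_mult Linf_const)
  have "\<alpha> g = ennreal (1 / c) * ennreal c" unfolding g_def gauge_scale[OF f] using c by (simp add: norm_divide)
  also have "\<dots> = 1" using c(1) by (subst ennreal_mult[symmetric]) auto
  finally have \<alpha>g: "\<alpha> g \<le> 1" by simp
  have "(\<integral>z. cmod (f z) * cmod (h z) \<partial>\<mu>) = (\<integral>z. c * (cmod (h z) * cmod (g z)) \<partial>\<mu>)"
    using c(1) by (intro Bochner_Integration.integral_cong) (auto simp: g_def norm_mult norm_divide)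
  also have "\<dots> = c * (\<integral>z. cmod (h z) * cmod (g z) \<partial>\<mu>)" by simp
  finally have "ennreal (\<integral>z. cmod (f z) * cmod (h z) \<partial>\<mu>) = ennreal c * ennreal (\<integral>z. cmod (h z) * cmod (g z) \<partial>\<mu>)"
    using c(1) by (simp add: ennreal_mult integral_nonneg)
  also have "\<dots> \<le> ennreal c * dual_gauge \<alpha> h"
    by (intro mult_left_mono dual_gauge_cmod_upper g h \<alpha>g) simp
  finally show ?thesis using c by simp
qed

text \<open>Truncations are bounded, so the bounded case applies to them, and |\<open>F n\<close>|
  |\<open>H n\<close>| increases to |f h|. No integrability is presupposed, and either gauge may be
  infinite.\<close>

lemma holder:
  assumes f [measurable]: "f \<in> borel_measurable \<mu>" and h [measurable]: "h \<in> borel_measurable \<mu>"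
  shows "(\<integral>\<^sup>+z. ennreal (cmod (f z * h z)) \<partial>\<mu>) \<le> gauge_ext \<alpha> f * gauge_ext (dual_gauge \<alpha>) h"
proof -
  define F where "F n z = f z * indicator {z \<in> space \<mu>. cmod (f z) \<le> real n} z" for n z
  define H where "H n z = h z * indicator {z \<in> space \<mu>. cmod (h z) \<le> real n} z" for n z
  have L: "F n \<in> Linf" "H n \<in> Linf" for n
    unfolding F_def H_def using Linf_truncate f h by blast+
  note [measurable] = L
  have le: "cmod (F n z) \<le> cmod (f z)" "cmod (H n z) \<le> cmod (h z)" for n z
    by (auto simp: F_def H_def split: split_indicator)
  have sup: "(SUP n. ennreal (cmod (F n z) * cmod (H n z))) = ennreal (cmod (f z * h z))" if z: "z \<in> space \<mu>" for z
  proof (rule antisym)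
    show "(SUP n. ennreal (cmod (F n z) * cmod (H n z))) \<le> ennreal (cmod (f z * h z))"
      using le by (auto simp: norm_mult intro!: SUP_least ennreal_leI mult_mono)
    obtain n where "max (cmod (f z)) (cmod (h z)) \<le> real n" using real_arch_simple by blast
    then have "F n z = f z" "H n z = h z" using z by (auto simp: F_def H_def)
    then show "ennreal (cmod (f z * h z)) \<le> (SUP n. ennreal (cmod (F n z) * cmod (H n z)))"
      by (intro SUP_upper2[of n]) (auto simp: norm_mult)
  qed
  have inc: "incseq (\<lambda>n z. ennreal (cmod (F n z) * cmod (H n z)))"
  proof (intro incseq_SucI le_funI ennreal_leI mult_mono)
    show "cmod (F n z) \<le> cmod (F (Suc n) z)" "cmod (H n z) \<le> cmod (H (Suc n) z)" for n z
      by (auto simp: F_def H_def split: split_indicator)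
  qed auto
  have "(\<integral>\<^sup>+z. ennreal (cmod (f z * h z)) \<partial>\<mu>) = (\<integral>\<^sup>+z. (SUP n. ennreal (cmod (F n z) * cmod (H n z))) \<partial>\<mu>)"
    using sup by (intro nn_integral_cong) auto
  also have "\<dots> = (SUP n. \<integral>\<^sup>+z. ennreal (cmod (F n z) * cmod (H n z)) \<partial>\<mu>)"
    by (rule nn_integral_monotone_convergence_SUP[OF inc]) measurable
  also have "\<dots> \<le> gauge_ext \<alpha> f * gauge_ext (dual_gauge \<alpha>) h"
  proof (rule SUP_least)
    fix n
    have "(\<integral>\<^sup>+z. ennreal (cmod (F n z) * cmod (H n z)) \<partial>\<mu>) = ennreal (\<integral>z. cmod (F n z) * cmod (H n z) \<partial>\<mu>)"
      using integrable_norm[OF integrable_Linf[OF Linf_mult[OF L[of n]]]]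
      by (intro nn_integral_eq_integral) (auto simp: norm_mult)
    also have "\<dots> \<le> \<alpha> (F n) * dual_gauge \<alpha> (H n)" by (rule holder_Linf[OF L])
    also have "\<dots> \<le> gauge_ext \<alpha> f * gauge_ext (dual_gauge \<alpha>) h"
      using le by (intro mult_mono gauge_ext_upper dual.gauge_ext_upper L AE_I2) auto
    finally show "(\<integral>\<^sup>+z. ennreal (cmod (F n z) * cmod (H n z)) \<partial>\<mu>) \<le> gauge_ext \<alpha> f * gauge_ext (dual_gauge \<alpha>) h" .
  qed
  finally show ?thesis .
qed

lemma pairing_integrable:
  assumes f: "f \<in> Lcal \<alpha>" and h: "h \<in> Lcal (dual_gauge \<alpha>)"
  shows "integrable \<mu> (\<lambda>z. f z * h z)"
    and "ennreal (cmod (\<integral>z. f z * h z \<partial>\<mu>)) \<le> gauge_ext \<alpha> f * gauge_ext (dual_gauge \<alpha>) h"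
    and "cmod (\<integral>z. f z * h z \<partial>\<mu>) \<le> enn2real (gauge_ext (dual_gauge \<alpha>) h) * enn2real (gauge_ext \<alpha> f)"
proof -
  note m [measurable] = Lcal_measurable[OF f] dual.Lcal_measurable[OF h]
  note ho = holder[OF m]
  have fin: "gauge_ext \<alpha> f * gauge_ext (dual_gauge \<alpha>) h < \<infinity>"
    using Lcal_finite[OF f] dual.Lcal_finite[OF h] by (simp add: ennreal_mult_less_top)
  show i: "integrable \<mu> (\<lambda>z. f z * h z)"
    using ho fin by (intro integrableI_bounded) (auto simp: le_less_trans)
  have "ennreal (cmod (\<integral>z. f z * h z \<partial>\<mu>)) \<le> ennreal (\<integral>z. cmod (f z * h z) \<partial>\<mu>)"
    by (intro ennreal_leI integral_norm_bound)
  also have "\<dots> = (\<integral>\<^sup>+z. ennreal (cmod (f z * h z)) \<partial>\<mu>)"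
    using i by (intro nn_integral_eq_integral[symmetric]) auto
  finally show b: "ennreal (cmod (\<integral>z. f z * h z \<partial>\<mu>)) \<le> gauge_ext \<alpha> f * gauge_ext (dual_gauge \<alpha>) h"
    using ho by simp
  have "gauge_ext \<alpha> f * gauge_ext (dual_gauge \<alpha>) h
      = ennreal (enn2real (gauge_ext (dual_gauge \<alpha>) h) * enn2real (gauge_ext \<alpha> f))"
    using Lcal.ennreal_real[OF f] dual.Lcal.ennreal_real[OF h] by (simp add: ennreal_mult mult.commute)
  with b show "cmod (\<integral>z. f z * h z \<partial>\<mu>) \<le> enn2real (gauge_ext (dual_gauge \<alpha>) h) * enn2real (gauge_ext \<alpha> f)"
    by (simp add: ennreal_le_iff)
qed

lemma integrable_dual_Lcal: "h \<in> Lcal (dual_gauge \<alpha>) \<Longrightarrow> integrable \<mu> h"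
  using pairing_integrable(1)[OF Linf_Lcal[OF Linf_const[of 1]]] by simp

text \<open>Controls an unbounded h by its pairings with bounded functions. For s below |h| the
  integral of |s| |g| is at most that of |h| |g|, which is the pairing of h with u, the phase of h
  times |g|, and u has no larger gauge than g.\<close>

lemma dual_gauge_ext_le:
  assumes h: "integrable \<mu> h"
    and C: "\<And>g. g \<in> Linf \<Longrightarrow> \<alpha> g \<le> 1 \<Longrightarrow> ennreal (cmod (\<integral>z. g z * h z \<partial>\<mu>)) \<le> C"
  shows "gauge_ext (dual_gauge \<alpha>) h \<le> C"
proof (rule dual.gauge_ext_least)
  fix s assume s: "s \<in> Linf" "AE z in \<mu>. cmod (s z) \<le> cmod (h z)"
  show "dual_gauge \<alpha> s \<le> C"
    unfolding dual_gauge_eq_cmod[OF s(1)]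
  proof (rule SUP_least, clarify)
    fix g assume g: "g \<in> Linf" "\<alpha> g \<le> 1"
    have hm [measurable]: "h \<in> borel_measurable \<mu>" using h by simp
    note [measurable] = g(1) s(1)
    define u where "u z = phase (h z) * complex_of_real (cmod (g z))" for z
    have ug: "cmod (u z) \<le> cmod (g z)" for z
      using mult_right_mono[OF cmod_phase norm_ge_zero[of "g z"], of "h z"] by (simp add: u_def norm_mult)
    have "u \<in> borel_measurable \<mu>" unfolding u_def by measurable
    then have u: "u \<in> Linf" using ug by (intro Linf_dominated[OF _ g(1)]) auto
    have "\<alpha> u \<le> \<alpha> g" using ug by (intro gauge_mono u g) auto
    then have \<alpha>u: "\<alpha> u \<le> 1" using g(2) by simp
    have uh: "u z * h z = complex_of_real (cmod (h z) * cmod (g z))" for z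
      unfolding u_def using phase_mult[of "h z"] by (simp add: mult.commute mult.left_commute)
    have ui: "integrable \<mu> (\<lambda>z. cmod (h z) * cmod (g z))"
      using integrable_norm[OF integrable_mult_Linf[OF g(1) h]] by (simp add: norm_mult mult.commute)
    have "(\<integral>z. cmod (s z) * cmod (g z) \<partial>\<mu>) \<le> (\<integral>z. cmod (h z) * cmod (g z) \<partial>\<mu>)"
    proof (rule integral_mono_AE[OF _ ui])
      show "integrable \<mu> (\<lambda>z. cmod (s z) * cmod (g z))"
        using integrable_norm[OF integrable_Linf[OF Linf_mult[OF s(1) g(1)]]] by (simp add: norm_mult)
      show "AE z in \<mu>. cmod (s z) * cmod (g z) \<le> cmod (h z) * cmod (g z)"
        using s(2) by eventually_elim (auto intro: mult_right_mono)
    qed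
    also have "\<dots> = cmod (\<integral>z. u z * h z \<partial>\<mu>)"
      unfolding uh integral_complex_of_real by (simp add: integral_nonneg)
    finally show "ennreal (\<integral>z. cmod (s z) * cmod (g z) \<partial>\<mu>) \<le> C"
      using C[OF u \<alpha>u] ennreal_leI order_trans by blast
  qed
qed

lemma pairing_in_dual_space:
  assumes h: "h \<in> Lcal (dual_gauge \<alpha>)"
  shows "pairing (Lgauge \<alpha>) h \<in> dual_space (Lgauge \<alpha>) (gauge_ext \<alpha>)"
  unfolding pairing_def
proof (rule Lgauge.dual_spaceI)
  note i = pairing_integrable(1)[OF Lgauge_Lcal h]
  show "(\<integral>z. (f z + g z) * h z \<partial>\<mu>) = (\<integral>z. f z * h z \<partial>\<mu>) + (\<integral>z. g z * h z \<partial>\<mu>)"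
    if "f \<in> Lgauge \<alpha>" "g \<in> Lgauge \<alpha>" for f g
    using i[OF that(1)] i[OF that(2)] by (simp add: distrib_right)
  show "(\<integral>z. c * f z * h z \<partial>\<mu>) = c * (\<integral>z. f z * h z \<partial>\<mu>)" for c f
    by (simp add: mult.assoc)
  show "cmod (\<integral>z. f z * h z \<partial>\<mu>) \<le> enn2real (gauge_ext (dual_gauge \<alpha>) h) * enn2real (gauge_ext \<alpha> f)"
    if "f \<in> Lgauge \<alpha>" for f
    by (rule pairing_integrable(3)[OF Lgauge_Lcal[OF that] h])
qed simp

text \<open>One inequality is that of Hoelder; for the other, bounded test functions already detect
  the dual gauge of h.\<close>

lemma dual_norm_pairing:
  assumes h: "h \<in> Lcal (dual_gauge \<alpha>)"
  shows "dual_norm (Lgauge \<alpha>) (gauge_ext \<alpha>) (pairing (Lgauge \<alpha>) h) = gauge_ext (dual_gauge \<alpha>) h"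
proof (rule antisym)
  show "dual_norm (Lgauge \<alpha>) (gauge_ext \<alpha>) (pairing (Lgauge \<alpha>) h) \<le> gauge_ext (dual_gauge \<alpha>) h"
    unfolding dual_norm_def
  proof (rule SUP_least, clarify)
    fix f assume f: "f \<in> Lgauge \<alpha>" "gauge_ext \<alpha> f \<le> 1"
    have "ennreal (cmod (pairing (Lgauge \<alpha>) h f)) \<le> gauge_ext \<alpha> f * gauge_ext (dual_gauge \<alpha>) h"
      using pairing_integrable(2)[OF Lgauge_Lcal[OF f(1)] h] f(1) by (simp add: pairing_def)
    also have "\<dots> \<le> 1 * gauge_ext (dual_gauge \<alpha>) h" using f(2) by (rule mult_right_mono) simp
    finally show "ennreal (cmod (pairing (Lgauge \<alpha>) h f)) \<le> gauge_ext (dual_gauge \<alpha>) h" by simp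
  qed
  show "gauge_ext (dual_gauge \<alpha>) h \<le> dual_norm (Lgauge \<alpha>) (gauge_ext \<alpha>) (pairing (Lgauge \<alpha>) h)"
  proof (rule dual_gauge_ext_le[OF integrable_dual_Lcal[OF h]])
    fix g assume g: "g \<in> Linf" "\<alpha> g \<le> 1"
    then have "ennreal (cmod (pairing (Lgauge \<alpha>) h g)) \<le> dual_norm (Lgauge \<alpha>) (gauge_ext \<alpha>) (pairing (Lgauge \<alpha>) h)"
      unfolding dual_norm_def by (intro SUP_upper) (auto intro: Linf_Lgauge)
    then show "ennreal (cmod (\<integral>z. g z * h z \<partial>\<mu>)) \<le> dual_norm (Lgauge \<alpha>) (gauge_ext \<alpha>) (pairing (Lgauge \<alpha>) h)"
      using g by (simp add: pairing_def Linf_Lgauge)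
  qed
qed

text \<open>Testing with the phase of h - k turns the hypothesis into \<integral>|h - k| =
  0.\<close>

lemma AE_eqI_integrals:
  assumes h: "integrable \<mu> h" and k: "integrable \<mu> k"
    and eq: "\<And>f. f \<in> Linf \<Longrightarrow> (\<integral>z. f z * h z \<partial>\<mu>) = (\<integral>z. f z * k z \<partial>\<mu>)"
  shows "AE z in \<mu>. h z = k z"
proof -
  define d where "d z = h z - k z" for z
  have d: "integrable \<mu> d" unfolding d_def using h k by simp
  have [measurable]: "d \<in> borel_measurable \<mu>" using d by simp
  have p: "(\<lambda>z. phase (d z)) \<in> Linf" using cmod_phase by (intro LinfI[of _ 1]) auto
  have "(\<integral>z. phase (d z) * h z - phase (d z) * k z \<partial>\<mu>) = 0"
    using integrable_mult_Linf[OF p h] integrable_mult_Linf[OF p k] eq[OF p] by simp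
  then have "(\<integral>z. complex_of_real (cmod (d z)) \<partial>\<mu>) = 0"
    using phase_mult[symmetric] by (simp add: d_def right_diff_distrib)
  then have "(\<integral>z. cmod (d z) \<partial>\<mu>) = 0" by (simp add: integral_complex_of_real)
  then have "AE z in \<mu>. cmod (d z) = 0"
    using d by (subst (asm) integral_nonneg_eq_0_iff_AE) auto
  then show ?thesis by eventually_elim (simp add: d_def)
qed

lemma pairing_inject:
  assumes h: "h \<in> Lcal (dual_gauge \<alpha>)" and k: "k \<in> Lcal (dual_gauge \<alpha>)"
    and eq: "pairing (Lgauge \<alpha>) h = pairing (Lgauge \<alpha>) k"
  shows "AE z in \<mu>. h z = k z"
proof (rule AE_eqI_integrals)
  fix f assume "f \<in> Linf"
  then show "(\<integral>z. f z * h z \<partial>\<mu>) = (\<integral>z. f z * k z \<partial>\<mu>)"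
    using fun_cong[OF eq, of f] by (simp add: pairing_def Linf_Lgauge)
qed (use h k integrable_dual_Lcal in auto)

lemma dual_space_Linf_iff: "dual_space Linf (gauge_ext \<alpha>) = dual_space Linf \<alpha>"
  unfolding dual_space_def by simp

text \<open>On \<open>Linf\<close> the functional is integration against some integrable h. Its
  bound puts h into \<open>Lcal (dual_gauge \<alpha>)\<close>, so the pairing with h is itself a
  bounded functional, and it agrees with \<phi> on a dense set.\<close>

lemma dual_representation:
  assumes \<phi>: "\<phi> \<in> dual_space (Lgauge \<alpha>) (gauge_ext \<alpha>)"
  obtains h where "h \<in> Lcal (dual_gauge \<alpha>)" "\<phi> = pairing (Lgauge \<alpha>) h"
proof -
  have "(\<lambda>f. if f \<in> Linf then \<phi> f else 0) \<in> dual_space Linf \<alpha>"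
    unfolding dual_space_Linf_iff[symmetric]
    using Linf_Lgauge Linf.scale_closed by (intro Lgauge.dual_space_restrict[OF \<phi>]) auto
  then obtain h where h: "integrable \<mu> h"
    "\<And>f. f \<in> Linf \<Longrightarrow> (if f \<in> Linf then \<phi> f else 0) = (\<integral>z. f z * h z \<partial>\<mu>)"
    using Linf_functional_integral by blast
  then have \<phi>h: "\<phi> f = (\<integral>z. f z * h z \<partial>\<mu>)" if "f \<in> Linf" for f using that by simp
  obtain C where C: "0 < C" "\<And>f. f \<in> Lgauge \<alpha> \<Longrightarrow> cmod (\<phi> f) \<le> C * enn2real (gauge_ext \<alpha> f)"
    using Lgauge.dual_bound[OF \<phi>] by blast
  have "gauge_ext (dual_gauge \<alpha>) h \<le> ennreal C"
  proof (rule dual_gauge_ext_le[OF h(1)])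
    fix g assume g: "g \<in> Linf" "\<alpha> g \<le> 1"
    have "enn2real (\<alpha> g) \<le> 1" using g(2) by (intro enn2real_leI) auto
    then have "C * enn2real (\<alpha> g) \<le> C" using C(1) by simp
    then show "ennreal (cmod (\<integral>z. g z * h z \<partial>\<mu>)) \<le> ennreal C"
      using C(2)[OF Linf_Lgauge[OF g(1)]] g(1) by (intro ennreal_leI) (simp add: \<phi>h)
  qed
  then have hL: "h \<in> Lcal (dual_gauge \<alpha>)"
    using h(1) by (auto simp: Lcal_def le_less_trans)
  have "\<phi> = pairing (Lgauge \<alpha>) h"
    unfolding Lgauge_def
  proof (rule dual_eq_on_closure[OF order_refl])
    show "seminormed_functions (gauge_closure \<alpha> Linf) (gauge_ext \<alpha>)"
      using Lgauge.seminormed_functions_axioms by (simp add: Lgauge_def)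
    show "\<phi> f = pairing (gauge_closure \<alpha> Linf) h f" if "f \<in> Linf" for f
      using that \<phi>h Linf_Lgauge by (simp add: pairing_def Lgauge_def)
  qed (use \<phi> pairing_in_dual_space[OF hL] in \<open>simp_all add: Lgauge_def\<close>)
  with hL show thesis by (rule that)
qed

text \<open>The lower bound comes from a functional norming f. Its density h may be unbounded and
  then is no test function, but the truncations of h are, and their pairings with f tend to that of
  h by dominated convergence.\<close>

lemma bidual_gauge:
  assumes f: "f \<in> Linf"
  shows "dual_gauge (dual_gauge \<alpha>) f = \<alpha> f"
proof (rule antisym)
  show "dual_gauge (dual_gauge \<alpha>) f \<le> \<alpha> f"
    unfolding dual_gauge_def[of "dual_gauge \<alpha>"]
  proof (rule SUP_least, clarify)
    fix h assume h: "h \<in> Linf" "dual_gauge \<alpha> h \<le> 1"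
    have "ennreal (cmod (\<integral>z. f z * h z \<partial>\<mu>)) \<le> \<alpha> f * dual_gauge \<alpha> h"
      using pairing_integrable(2)[OF Linf_Lcal[OF f] dual.Linf_Lcal[OF h(1)]] f h(1) by simp
    also have "\<dots> \<le> \<alpha> f * 1" using h(2) by (rule mult_left_mono) simp
    finally show "ennreal (cmod (\<integral>z. f z * h z \<partial>\<mu>)) \<le> \<alpha> f" by simp
  qed
  obtain \<phi> where \<phi>: "\<phi> \<in> dual_space Linf \<alpha>" "\<And>g. g \<in> Linf \<Longrightarrow> cmod (\<phi> g) \<le> enn2real (\<alpha> g)"
    "\<phi> f = enn2real (\<alpha> f)"
    using Linf.norming_functional[OF f] by blast
  obtain h where h: "integrable \<mu> h" "\<And>g. g \<in> Linf \<Longrightarrow> \<phi> g = (\<integral>z. g z * h z \<partial>\<mu>)"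
    using Linf_functional_integral[OF \<phi>(1)] by blast
  have hm [measurable]: "h \<in> borel_measurable \<mu>" using h by simp
  have h1: "gauge_ext (dual_gauge \<alpha>) h \<le> 1"
  proof (rule dual_gauge_ext_le[OF h(1)])
    fix g assume g: "g \<in> Linf" "\<alpha> g \<le> 1"
    have "ennreal (cmod (\<phi> g)) \<le> \<alpha> g"
      using \<phi>(2)[OF g(1)] Linf.ennreal_real[OF g(1)] ennreal_leI by metis
    then show "ennreal (cmod (\<integral>z. g z * h z \<partial>\<mu>)) \<le> 1"
      using g(2) unfolding h(2)[OF g(1)] by (rule order_trans)
  qed
  define H where "H n z = h z * indicator {z \<in> space \<mu>. cmod (h z) \<le> real n} z" for n z
  have HL: "H n \<in> Linf" for n unfolding H_def by (rule Linf_truncate[OF hm])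
  note [measurable] = HL f
  have H1: "dual_gauge \<alpha> (H n) \<le> 1" for n
  proof -
    have "dual_gauge \<alpha> (H n) \<le> gauge_ext (dual_gauge \<alpha>) h"
      by (intro dual.gauge_ext_upper HL) (auto simp: H_def split: split_indicator)
    then show ?thesis using h1 by simp
  qed
  have "(\<lambda>n. \<integral>z. f z * H n z \<partial>\<mu>) \<longlonglongrightarrow> (\<integral>z. f z * h z \<partial>\<mu>)"
  proof (rule integral_dominated_convergence)
    show "integrable \<mu> (\<lambda>z. cmod (f z * h z))"
      using integrable_mult_Linf[OF f h(1)] by (rule integrable_norm)
    show "AE z in \<mu>. cmod (f z * H n z) \<le> cmod (f z * h z)" for n
      by (auto simp: H_def split: split_indicator)
    show "AE z in \<mu>. (\<lambda>n. f z * H n z) \<longlonglongrightarrow> f z * h z"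
    proof (rule AE_I2)
      fix z assume z: "z \<in> space \<mu>"
      obtain m where "cmod (h z) \<le> real m" using real_arch_simple by blast
      then have "\<forall>\<^sub>F n in sequentially. f z * H n z = f z * h z"
        using z by (intro eventually_sequentiallyI[of m]) (auto simp: H_def split: split_indicator)
      then show "(\<lambda>n. f z * H n z) \<longlonglongrightarrow> f z * h z" by (rule tendsto_eventually)
    qed
  qed measurable
  then have lim: "(\<lambda>n. ennreal (cmod (\<integral>z. f z * H n z \<partial>\<mu>))) \<longlonglongrightarrow> ennreal (cmod (\<integral>z. f z * h z \<partial>\<mu>))"
    by (intro tendsto_ennrealI tendsto_norm)
  have "ennreal (cmod (\<integral>z. f z * h z \<partial>\<mu>)) \<le> dual_gauge (dual_gauge \<alpha>) f"
    using lim by (rule LIMSEQ_le_const2) (use dual.dual_gauge_upper[OF HL H1] in auto)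
  moreover have "ennreal (cmod (\<integral>z. f z * h z \<partial>\<mu>)) = \<alpha> f"
    unfolding h(2)[OF f, symmetric] \<phi>(3) using Linf.ennreal_real[OF f] by simp
  ultimately show "\<alpha> f \<le> dual_gauge (dual_gauge \<alpha>) f" by simp
qed

lemma gauge_ext_bidual: "gauge_ext (dual_gauge (dual_gauge \<alpha>)) = gauge_ext \<alpha>"
  unfolding gauge_ext_def using bidual_gauge Linf_simple by (intro ext SUP_cong) auto

lemma Lcal_bidual: "Lcal (dual_gauge (dual_gauge \<alpha>)) = Lcal \<alpha>"
  unfolding Lcal_def gauge_ext_bidual ..

lemma pairing_add:
  assumes "h \<in> Lcal (dual_gauge \<alpha>)" "k \<in> Lcal (dual_gauge \<alpha>)"
  shows "pairing (Lgauge \<alpha>) (\<lambda>z. h z + k z) = (\<lambda>f. pairing (Lgauge \<alpha>) h f + pairing (Lgauge \<alpha>) k f)"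
  using assms pairing_integrable(1)[OF Lgauge_Lcal] by (auto simp: pairing_def distrib_left fun_eq_iff)

lemma pairing_scale: "pairing (Lgauge \<alpha>) (\<lambda>z. c * h z) = (\<lambda>f. c * pairing (Lgauge \<alpha>) h f)"
  by (auto simp: pairing_def fun_eq_iff mult.left_commute)

text \<open>The pairing carries \<open>Lcal (dual_gauge \<alpha>)\<close> isometrically onto the
  dual, with kernel the null functions. A functional on the dual is therefore one on this function
  space, and evaluation at f becomes integration against f.\<close>

lemma reflexive_Lgauge_iff:
  "reflexive_space (Lgauge \<alpha>) (gauge_ext \<alpha>) \<longleftrightarrow>
     (\<forall>\<Theta> \<in> dual_space (Lcal (dual_gauge \<alpha>)) (gauge_ext (dual_gauge \<alpha>)).
        \<exists>f \<in> Lgauge \<alpha>. \<forall>h \<in> Lcal (dual_gauge \<alpha>). \<Theta> h = (\<integral>z. f z * h z \<partial>\<mu>))"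
  (is "?R \<longleftrightarrow> ?I")
proof
  let ?P = "pairing (Lgauge \<alpha>)" and ?D = "dual_space (Lgauge \<alpha>) (gauge_ext \<alpha>)"
    and ?n = "dual_norm (Lgauge \<alpha>) (gauge_ext \<alpha>)"
  assume ?I
  show ?R
    unfolding reflexive_space_def
  proof
    fix \<Phi> assume \<Phi>: "\<Phi> \<in> dual_space ?D ?n"
    obtain C :: real where C: "\<And>\<phi>. \<phi> \<in> ?D \<Longrightarrow> ennreal (cmod (\<Phi> \<phi>)) \<le> ennreal C * ?n \<phi>"
      using \<Phi> unfolding dual_space_def[of ?D] by blast
    have \<Phi>_add: "\<Phi> (\<lambda>f. \<phi> f + \<psi> f) = \<Phi> \<phi> + \<Phi> \<psi>" if "\<phi> \<in> ?D" "\<psi> \<in> ?D" for \<phi> \<psi>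
      using \<Phi> that unfolding dual_space_def[of ?D] by blast
    have \<Phi>_scale: "\<Phi> (\<lambda>f. c * \<phi> f) = c * \<Phi> \<phi>" if "\<phi> \<in> ?D" for c \<phi>
      using \<Phi> that unfolding dual_space_def[of ?D] by blast
    define \<Theta> where "\<Theta> h = (if h \<in> Lcal (dual_gauge \<alpha>) then \<Phi> (?P h) else 0)" for h
    have "\<Theta> \<in> dual_space (Lcal (dual_gauge \<alpha>)) (gauge_ext (dual_gauge \<alpha>))"
      unfolding dual_space_def
    proof (intro CollectI conjI ballI allI impI exI[of _ C])
      fix h k assume hk: "h \<in> Lcal (dual_gauge \<alpha>)" "k \<in> Lcal (dual_gauge \<alpha>)"
      show "\<Theta> (\<lambda>x. h x + k x) = \<Theta> h + \<Theta> k"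
        using hk dual.Lcal.add_closed[OF hk] \<Phi>_add[OF pairing_in_dual_space[OF hk(1)] pairing_in_dual_space[OF hk(2)]]
        by (simp add: \<Theta>_def pairing_add)
    next
      fix h c assume h: "h \<in> Lcal (dual_gauge \<alpha>)"
      show "\<Theta> (\<lambda>x. c * h x) = c * \<Theta> h"
        using h dual.Lcal.scale_closed[OF h] \<Phi>_scale[OF pairing_in_dual_space[OF h]]
        by (simp add: \<Theta>_def pairing_scale)
    next
      fix h assume h: "h \<in> Lcal (dual_gauge \<alpha>)"
      show "ennreal (cmod (\<Theta> h)) \<le> ennreal C * gauge_ext (dual_gauge \<alpha>) h"
        using C[OF pairing_in_dual_space[OF h]] h by (simp add: \<Theta>_def dual_norm_pairing)
    qed (simp add: \<Theta>_def)
    then obtain f where f: "f \<in> Lgauge \<alpha>" "\<And>h. h \<in> Lcal (dual_gauge \<alpha>) \<Longrightarrow> \<Theta> h = (\<integral>z. f z * h z \<partial>\<mu>)"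
      using \<open>?I\<close> by blast
    have "\<Phi> \<phi> = \<phi> f" if \<phi>: "\<phi> \<in> ?D" for \<phi>
    proof -
      obtain h where "h \<in> Lcal (dual_gauge \<alpha>)" "\<phi> = ?P h" using dual_representation[OF \<phi>] by blast
      then show ?thesis using f(1) f(2)[of h] by (simp add: \<Theta>_def) (simp add: pairing_def)
    qed
    then show "\<exists>f\<in>Lgauge \<alpha>. \<forall>\<phi>\<in>?D. \<Phi> \<phi> = \<phi> f" using f(1) by blast
  qed
next
  let ?P = "pairing (Lgauge \<alpha>)" and ?D = "dual_space (Lgauge \<alpha>) (gauge_ext \<alpha>)"
    and ?n = "dual_norm (Lgauge \<alpha>) (gauge_ext \<alpha>)"
  assume ?R
  show ?I
  proof
    fix \<Theta> assume \<Theta>: "\<Theta> \<in> dual_space (Lcal (dual_gauge \<alpha>)) (gauge_ext (dual_gauge \<alpha>))"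
    \<comment> \<open>A functional determines its representing function only up to a null set, so
      one is chosen; by \<open>pairing_inject\<close> any other choice differs from it on a null
      set, which \<Theta> does not see.\<close>
    define \<Phi> where "\<Phi> \<phi> = (if \<phi> \<in> ?D then \<Theta> (SOME h. h \<in> Lcal (dual_gauge \<alpha>) \<and> \<phi> = ?P h) else 0)" for \<phi>
    have \<Phi>P: "\<Phi> (?P h) = \<Theta> h" if h: "h \<in> Lcal (dual_gauge \<alpha>)" for h
    proof -
      define k where "k = (SOME k. k \<in> Lcal (dual_gauge \<alpha>) \<and> ?P h = ?P k)"
      have k: "k \<in> Lcal (dual_gauge \<alpha>)" "?P h = ?P k"
        using someI[of "\<lambda>k. k \<in> Lcal (dual_gauge \<alpha>) \<and> ?P h = ?P k" h] h by (auto simp: k_def)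
      have "\<Theta> h = \<Theta> k"
        using \<Theta> h k(1) pairing_inject[OF h k] by (rule dual.dual_space_AE_cong) (rule dual.seminormed_functions_Lcal)
      then show ?thesis using pairing_in_dual_space[OF h] by (simp add: \<Phi>_def k_def)
    qed
    obtain C :: real where C: "\<And>h. h \<in> Lcal (dual_gauge \<alpha>) \<Longrightarrow> ennreal (cmod (\<Theta> h)) \<le> ennreal C * gauge_ext (dual_gauge \<alpha>) h"
      using \<Theta> unfolding dual_space_def by blast
    have "\<Phi> \<in> dual_space ?D ?n"
      unfolding dual_space_def[of ?D]
    proof (intro CollectI conjI ballI allI impI exI[of _ C])
      fix \<phi> \<psi> assume "\<phi> \<in> ?D" "\<psi> \<in> ?D"
      then obtain h k where hk: "h \<in> Lcal (dual_gauge \<alpha>)" "k \<in> Lcal (dual_gauge \<alpha>)" "\<phi> = ?P h" "\<psi> = ?P k"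
        using dual_representation by metis
      show "\<Phi> (\<lambda>x. \<phi> x + \<psi> x) = \<Phi> \<phi> + \<Phi> \<psi>"
        unfolding hk(3,4) pairing_add[OF hk(1,2), symmetric]
        using hk(1,2) dual.Lcal.add_closed[OF hk(1,2)] dual.Lcal.dual_add[OF \<Theta>] by (simp add: \<Phi>P)
    next
      fix \<phi> c assume "\<phi> \<in> ?D"
      then obtain h where h: "h \<in> Lcal (dual_gauge \<alpha>)" "\<phi> = ?P h"
        using dual_representation by metis
      show "\<Phi> (\<lambda>x. c * \<phi> x) = c * \<Phi> \<phi>"
        unfolding h(2) pairing_scale[symmetric]
        using h(1) dual.Lcal.scale_closed[OF h(1)] dual.Lcal.dual_scale[OF \<Theta>] by (simp add: \<Phi>P)
    next
      fix \<phi> assume "\<phi> \<in> ?D"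
      then obtain h where h: "h \<in> Lcal (dual_gauge \<alpha>)" "\<phi> = ?P h"
        using dual_representation by metis
      show "ennreal (cmod (\<Phi> \<phi>)) \<le> ennreal C * ?n \<phi>"
        unfolding h(2) using C[OF h(1)] by (simp add: \<Phi>P[OF h(1)] dual_norm_pairing[OF h(1)])
    qed (simp add: \<Phi>_def)
    then obtain f where f: "f \<in> Lgauge \<alpha>" "\<And>\<phi>. \<phi> \<in> ?D \<Longrightarrow> \<Phi> \<phi> = \<phi> f"
      using \<open>?R\<close> unfolding reflexive_space_def by blast
    have "\<Theta> h = (\<integral>z. f z * h z \<partial>\<mu>)" if h: "h \<in> Lcal (dual_gauge \<alpha>)" for h
      using f(2)[OF pairing_in_dual_space[OF h]] f(1) \<Phi>P[OF h] by (simp add: pairing_def)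
    then show "\<exists>f\<in>Lgauge \<alpha>. \<forall>h\<in>Lcal (dual_gauge \<alpha>). \<Theta> h = (\<integral>z. f z * h z \<partial>\<mu>)" using f(1) by blast
  qed
qed

end

section \<open>Reflexivity\<close>

lemma (in seminormed_functions) dual_norm_upper:
  "f \<in> V \<Longrightarrow> N f \<le> 1 \<Longrightarrow> ennreal (cmod (\<phi> f)) \<le> dual_norm V N \<phi>"
  unfolding dual_norm_def by (intro SUP_upper) auto

lemma (in seminormed_functions) separate_point:
  assumes "W \<subseteq> V" "(\<lambda>_. 0) \<in> W" "\<And>f g. f \<in> W \<Longrightarrow> g \<in> W \<Longrightarrow> (\<lambda>x. f x + g x) \<in> W"
      "\<And>c f. f \<in> W \<Longrightarrow> (\<lambda>x. c * f x) \<in> W"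
    and "f0 \<in> V" "0 < d" "\<And>w. w \<in> W \<Longrightarrow> ennreal d \<le> N (\<lambda>x. f0 x - w x)"
  shows "\<exists>\<phi> \<in> dual_space V N. (\<forall>w \<in> W. \<phi> w = 0) \<and> \<phi> f0 \<noteq> 0"
proof (rule separate_subspace[OF assms(1-5) less_imp_le[OF assms(6)] assms(7)])
  fix \<phi> assume "\<phi> \<in> dual_space V N" "\<And>w. w \<in> W \<Longrightarrow> \<phi> w = 0" "d \<le> Re (\<phi> f0)"
  then show ?thesis using assms(6) by (intro bexI[of _ \<phi>]) auto
qed

lemma (in seminormed_functions) dual_space_add:
  assumes p: "\<phi> \<in> dual_space V N" "\<psi> \<in> dual_space V N"
  shows "(\<lambda>x. \<phi> x + \<psi> x) \<in> dual_space V N"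
proof -
  obtain A where A: "0 < A" "\<And>f. f \<in> V \<Longrightarrow> cmod (\<phi> f) \<le> A * enn2real (N f)"
    using dual_bound[OF p(1)] by blast
  obtain B where B: "0 < B" "\<And>f. f \<in> V \<Longrightarrow> cmod (\<psi> f) \<le> B * enn2real (N f)"
    using dual_bound[OF p(2)] by blast
  have "(\<lambda>f. if f \<in> V then \<phi> f + \<psi> f else 0) \<in> dual_space V N"
  proof (rule dual_spaceI)
    show "cmod (\<phi> f + \<psi> f) \<le> (A + B) * enn2real (N f)" if "f \<in> V" for f
      unfolding distrib_right using A(2)[OF that] B(2)[OF that] by (rule norm_triangle_mono)
  qed (use A(1) B(1) dual_add[OF p(1)] dual_add[OF p(2)] dual_scale[OF p(1)] dual_scale[OF p(2)]
      in \<open>auto simp: algebra_simps\<close>)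
  moreover have "(\<lambda>f. if f \<in> V then \<phi> f + \<psi> f else 0) = (\<lambda>x. \<phi> x + \<psi> x)"
    using dual_outside[OF p(1)] dual_outside[OF p(2)] by (intro ext) auto
  ultimately show ?thesis by simp
qed

lemma (in seminormed_functions) dual_space_scale:
  assumes p: "\<phi> \<in> dual_space V N"
  shows "(\<lambda>x. c * \<phi> x) \<in> dual_space V N"
proof -
  obtain A where A: "0 < A" "\<And>f. f \<in> V \<Longrightarrow> cmod (\<phi> f) \<le> A * enn2real (N f)"
    using dual_bound[OF p] by blast
  have "(\<lambda>f. if f \<in> V then c * \<phi> f else 0) \<in> dual_space V N"
  proof (rule dual_spaceI)
    show "cmod (c * \<phi> f) \<le> (cmod c * A) * enn2real (N f)" if "f \<in> V" for f
      using mult_left_mono[OF A(2)[OF that], of "cmod c"] by (simp add: norm_mult mult.assoc)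
  qed (use A(1) dual_add[OF p] dual_scale[OF p] in \<open>auto simp: algebra_simps\<close>)
  moreover have "(\<lambda>f. if f \<in> V then c * \<phi> f else 0) = (\<lambda>x. c * \<phi> x)"
    using dual_outside[OF p] by (intro ext) auto
  ultimately show ?thesis by simp
qed

text \<open>Composition with the restriction of functionals lifts \<Phi> to the bidual of V, where
  it is evaluation at some f. A functional that vanishes on W restricts to 0 and so vanishes at f;
  as W is closed, f lies in W. Every functional on W is the restriction of one on V, so f represents
  \<Phi> itself.\<close>

lemma (in seminormed_functions) reflexive_closed_subspace:
  assumes refl: "reflexive_space V N"
    and W: "W \<subseteq> V" "(\<lambda>_. 0) \<in> W" "\<And>f g. f \<in> W \<Longrightarrow> g \<in> W \<Longrightarrow> (\<lambda>x. f x + g x) \<in> W"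
      "\<And>c f. f \<in> W \<Longrightarrow> (\<lambda>x. c * f x) \<in> W"
    and closed: "\<And>f. f \<in> V \<Longrightarrow> f \<notin> W \<Longrightarrow> \<exists>e::real > 0. \<forall>w \<in> W. ennreal e \<le> N (\<lambda>x. f x - w x)"
  shows "reflexive_space W N"
  unfolding reflexive_space_def
proof
  let ?DV = "dual_space V N" and ?DW = "dual_space W N"
  fix \<Phi> assume \<Phi>: "\<Phi> \<in> dual_space ?DW (dual_norm W N)"
  have \<Phi>_add: "\<Phi> (\<lambda>f. \<phi> f + \<psi> f) = \<Phi> \<phi> + \<Phi> \<psi>" if "\<phi> \<in> ?DW" "\<psi> \<in> ?DW" for \<phi> \<psi>
    using \<Phi> that unfolding dual_space_def[of ?DW] by blast
  have \<Phi>_scale: "\<Phi> (\<lambda>f. c * \<phi> f) = c * \<Phi> \<phi>" if "\<phi> \<in> ?DW" for c \<phi>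
    using \<Phi> that unfolding dual_space_def[of ?DW] by blast
  obtain C :: real where C: "\<And>\<phi>. \<phi> \<in> ?DW \<Longrightarrow> ennreal (cmod (\<Phi> \<phi>)) \<le> ennreal C * dual_norm W N \<phi>"
    using \<Phi> unfolding dual_space_def[of ?DW] by blast
  define r :: "(('x \<Rightarrow> complex) \<Rightarrow> complex) \<Rightarrow> ('x \<Rightarrow> complex) \<Rightarrow> complex"
    where "r \<phi> = (\<lambda>f. if f \<in> W then \<phi> f else 0)" for \<phi>
  have r: "r \<phi> \<in> ?DW" if "\<phi> \<in> ?DV" for \<phi>
    unfolding r_def by (rule dual_space_restrict[OF that W(1,3,4)])
  have r_norm: "dual_norm W N (r \<phi>) \<le> dual_norm V N \<phi>" for \<phi>
    unfolding dual_norm_def[of W] using W(1) by (intro SUP_least) (auto simp: r_def intro: dual_norm_upper)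
  define \<Psi> where "\<Psi> \<phi> = (if \<phi> \<in> ?DV then \<Phi> (r \<phi>) else 0)" for \<phi>
  have "\<Psi> \<in> dual_space ?DV (dual_norm V N)"
    unfolding dual_space_def[of ?DV]
  proof (intro CollectI conjI ballI allI impI exI[of _ C])
    fix \<phi> \<psi> assume *: "\<phi> \<in> ?DV" "\<psi> \<in> ?DV"
    have "r (\<lambda>x. \<phi> x + \<psi> x) = (\<lambda>x. r \<phi> x + r \<psi> x)" by (auto simp: r_def)
    then show "\<Psi> (\<lambda>x. \<phi> x + \<psi> x) = \<Psi> \<phi> + \<Psi> \<psi>"
      using * dual_space_add[OF *] \<Phi>_add[OF r r] by (simp add: \<Psi>_def)
  next
    fix \<phi> c assume *: "\<phi> \<in> ?DV"
    have "r (\<lambda>x. c * \<phi> x) = (\<lambda>x. c * r \<phi> x)" by (auto simp: r_def)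
    then show "\<Psi> (\<lambda>x. c * \<phi> x) = c * \<Psi> \<phi>"
      using * dual_space_scale[OF *] \<Phi>_scale[OF r] by (simp add: \<Psi>_def)
  next
    fix \<phi> assume *: "\<phi> \<in> ?DV"
    have "ennreal (cmod (\<Phi> (r \<phi>))) \<le> ennreal C * dual_norm W N (r \<phi>)" by (rule C[OF r[OF *]])
    also have "\<dots> \<le> ennreal C * dual_norm V N \<phi>" using r_norm by (rule mult_left_mono) simp
    finally show "ennreal (cmod (\<Psi> \<phi>)) \<le> ennreal C * dual_norm V N \<phi>" using * by (simp add: \<Psi>_def)
  qed (simp add: \<Psi>_def)
  then obtain f where f: "f \<in> V" "\<And>\<phi>. \<phi> \<in> ?DV \<Longrightarrow> \<Psi> \<phi> = \<phi> f"
    using refl unfolding reflexive_space_def by blast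
  have "f \<in> W"
  proof (rule ccontr)
    assume "f \<notin> W"
    then obtain e :: real where e: "0 < e" "\<And>w. w \<in> W \<Longrightarrow> ennreal e \<le> N (\<lambda>x. f x - w x)"
      using closed[OF f(1)] by blast
    have "\<exists>\<phi> \<in> ?DV. (\<forall>w \<in> W. \<phi> w = 0) \<and> \<phi> f \<noteq> 0"
      by (rule separate_point[of W f e]) (fact W f e)+
    then obtain \<phi> where \<phi>: "\<phi> \<in> ?DV" "\<And>w. w \<in> W \<Longrightarrow> \<phi> w = 0" "\<phi> f \<noteq> 0"
      by blast
    have "r \<phi> = (\<lambda>x. 0 * r \<phi> x)" using \<phi>(2) by (auto simp: r_def)
    then have "\<Phi> (r \<phi>) = 0" using \<Phi>_scale[OF r[OF \<phi>(1)], of 0] by simp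
    then show False using f(2)[OF \<phi>(1)] \<phi>(1,3) by (simp add: \<Psi>_def)
  qed
  moreover have "\<Phi> \<psi> = \<psi> f" if \<psi>: "\<psi> \<in> ?DW" for \<psi>
  proof -
    obtain \<phi> where \<phi>: "\<phi> \<in> ?DV" "\<And>w. w \<in> W \<Longrightarrow> \<phi> w = \<psi> w"
      using extend_functional[OF W \<psi>] by blast
    have "\<psi> g = 0" if "g \<notin> W" for g using \<psi> that unfolding dual_space_def by blast
    then have "r \<phi> = \<psi>" using \<phi>(2) by (auto simp: r_def)
    then show ?thesis using f(2)[OF \<phi>(1)] \<phi> \<open>f \<in> W\<close> by (simp add: \<Psi>_def)
  qed
  ultimately show "\<exists>f\<in>W. \<forall>\<psi>\<in>?DW. \<Phi> \<psi> = \<psi> f" by blast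
qed

context rot_gauge
begin

lemma gauge_closure_distance:
  assumes "A \<subseteq> Linf" "f \<in> Lcal \<alpha>" "f \<notin> gauge_closure \<alpha> A"
  obtains e :: real where "0 < e" "\<And>w. w \<in> gauge_closure \<alpha> A \<Longrightarrow> ennreal e \<le> gauge_ext \<alpha> (\<lambda>z. f z - w z)"
proof -
  have "\<exists>e>0. \<forall>w \<in> gauge_closure \<alpha> A. ennreal e \<le> gauge_ext \<alpha> (\<lambda>z. f z - w z)"
  proof (rule ccontr)
    assume "\<not> (\<exists>e>0. \<forall>w \<in> gauge_closure \<alpha> A. ennreal e \<le> gauge_ext \<alpha> (\<lambda>z. f z - w z))"
    then have "\<exists>w \<in> gauge_closure \<alpha> A. gauge_ext \<alpha> (\<lambda>z. f z - w z) < ennreal e" if "0 < e" for e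
      using that by (auto simp: not_le)
    then show False using gauge_closure_closed[OF assms(1,2)] assms(3) by blast
  qed
  then show thesis using that by blast
qed

lemma seminormed_functions_Hgauge: "seminormed_functions (Hgauge \<alpha>) (gauge_ext \<alpha>)"
  and polynomials_Linf: "{p. \<exists>(c :: nat \<Rightarrow> complex) n. p = (\<lambda>z. \<Sum>k<n. c k * z ^ k)} \<subseteq> Linf"
proof -
  let ?P = "{p. \<exists>(c :: nat \<Rightarrow> complex) n. p = (\<lambda>z. \<Sum>k<n. c k * z ^ k)}"
  show PL: "?P \<subseteq> Linf"
  proof clarify
    fix c :: "nat \<Rightarrow> complex" and n
    have [measurable]: "(\<lambda>z. z) \<in> borel_measurable \<mu>"
      unfolding measurable_cong_sets[OF sets_circle refl] by (intro measurable_restrict_space1) simp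
    have "cmod (\<Sum>k<n. c k * z ^ k) \<le> (\<Sum>k<n. cmod (c k))" if "z \<in> space \<mu>" for z
      using that by (intro sum_norm_le) (auto simp: norm_mult norm_power)
    then show "(\<lambda>z. \<Sum>k<n. c k * z ^ k) \<in> Linf"
      by (intro LinfI[of _ "\<Sum>k<n. cmod (c k)"] AE_I2) measurable
  qed
  \<comment> \<open>Zero coefficients bring two polynomials to a common length.\<close>
  have pad: "(\<Sum>k<n. c k * z ^ k) = (\<Sum>k<n + m. (if k < n then c k else 0) * z ^ k)" for c :: "nat \<Rightarrow> complex" and n m z
    by (intro sum.mono_neutral_cong_left) auto
  show "seminormed_functions (Hgauge \<alpha>) (gauge_ext \<alpha>)"
    unfolding Hgauge_def
  proof (rule seminormed_functions_closure[OF PL])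
    show "(\<lambda>_. 0) \<in> ?P" by (auto intro!: exI[of _ 0])
    show "(\<lambda>x. c * f x) \<in> ?P" if "f \<in> ?P" for c f
    proof -
      from that obtain d n where f: "f = (\<lambda>z. \<Sum>k<n. d k * z ^ k)" by blast
      have "(\<lambda>x. c * f x) = (\<lambda>z. \<Sum>k<n. (c * d k) * z ^ k)"
        by (simp add: f sum_distrib_left mult.assoc)
      then show ?thesis by (intro CollectI exI[of _ "\<lambda>k. c * d k"] exI[of _ n])
    qed
    show "(\<lambda>x. f x + g x) \<in> ?P" if "f \<in> ?P" "g \<in> ?P" for f g
    proof -
      from that obtain c n d m where f: "f = (\<lambda>z. \<Sum>k<n. c k * z ^ k)" and g: "g = (\<lambda>z. \<Sum>k<m. d k * z ^ k)"
        by blast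
      have "f z + g z = (\<Sum>k<n + m. ((if k < n then c k else 0) + (if k < m then d k else 0)) * z ^ k)" for z
        unfolding f g using pad[where n = n and m = m and c = c and z = z] pad[where n = m and m = n and c = d and z = z]
        by (simp only: distrib_right sum.distrib add.commute[of m n])
      then show ?thesis
        by (intro CollectI exI[of _ "\<lambda>k. (if k < n then c k else 0) + (if k < m then d k else 0)"] exI[of _ "n + m"] ext)
    qed
  qed
qed

end

context cont_gauge
begin

text \<open>Strong continuity of the dual gauge makes its full space the closure of
  \<open>Linf\<close>, so the representation theorem applies to \<alpha>' as well. It yields a
  function in the full space of \<alpha>'' = \<alpha>, and strong continuity of \<alpha> places it
  in \<open>Lgauge \<alpha>\<close>.\<close>

lemma reflexive_Lgauge_if:
  assumes "strongly_continuous \<alpha>" "strongly_continuous (dual_gauge \<alpha>)"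
  shows "reflexive_space (Lgauge \<alpha>) (gauge_ext \<alpha>)"
  unfolding reflexive_Lgauge_iff
proof
  interpret dual: cont_gauge "dual_gauge \<alpha>"
    using assms(2) by unfold_locales (simp add: strongly_continuous_def)
  fix \<Theta> assume "\<Theta> \<in> dual_space (Lcal (dual_gauge \<alpha>)) (gauge_ext (dual_gauge \<alpha>))"
  then have "\<Theta> \<in> dual_space (Lgauge (dual_gauge \<alpha>)) (gauge_ext (dual_gauge \<alpha>))"
    using assms(2) by (simp add: strongly_continuous_def)
  then obtain f where f: "f \<in> Lcal (dual_gauge (dual_gauge \<alpha>))" "\<Theta> = pairing (Lgauge (dual_gauge \<alpha>)) f"
    by (rule dual.dual_representation)
  have "f \<in> Lgauge \<alpha>" using f(1) assms(1) by (simp add: Lcal_bidual strongly_continuous_def)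
  moreover have "\<Theta> h = (\<integral>z. f z * h z \<partial>\<mu>)" if "h \<in> Lcal (dual_gauge \<alpha>)" for h
    using f(2) that assms(2) by (simp add: pairing_def strongly_continuous_def mult.commute)
  ultimately show "\<exists>f \<in> Lgauge \<alpha>. \<forall>h \<in> Lcal (dual_gauge \<alpha>). \<Theta> h = (\<integral>z. f z * h z \<partial>\<mu>)" by blast
qed

lemma reflexive_Hgauge:
  assumes "reflexive_space (Lgauge \<alpha>) (gauge_ext \<alpha>)"
  shows "reflexive_space (Hgauge \<alpha>) (gauge_ext \<alpha>)"
proof (rule Lgauge.reflexive_closed_subspace[OF assms])
  interpret H: seminormed_functions "Hgauge \<alpha>" "gauge_ext \<alpha>" by (rule seminormed_functions_Hgauge)
  show "Hgauge \<alpha> \<subseteq> Lgauge \<alpha>"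
    unfolding Hgauge_def Lgauge_def by (rule gauge_closure_mono[OF polynomials_Linf])
  show "(\<lambda>_. 0) \<in> Hgauge \<alpha>" by (rule H.zero_closed)
  show "(\<lambda>x. f x + g x) \<in> Hgauge \<alpha>" if "f \<in> Hgauge \<alpha>" "g \<in> Hgauge \<alpha>" for f g
    using that by (rule H.add_closed)
  show "(\<lambda>x. c * f x) \<in> Hgauge \<alpha>" if "f \<in> Hgauge \<alpha>" for c f
    using that by (rule H.scale_closed)
  show "\<exists>e>0. \<forall>w\<in>Hgauge \<alpha>. ennreal e \<le> gauge_ext \<alpha> (\<lambda>x. f x - w x)" if "f \<in> Lgauge \<alpha>" "f \<notin> Hgauge \<alpha>" for f
    by (rule gauge_closure_distance[OF polynomials_Linf Lgauge_Lcal[OF that(1)] that(2)[unfolded Hgauge_def]])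
      (auto simp: Hgauge_def)
qed

end

section \<open>From reflexivity to strong continuity\<close>

lemma AE_not_in_limit:
  assumes "decseq F" "range F \<subseteq> sets \<mu>" "(\<lambda>n. measure \<mu> (F n)) \<longlonglongrightarrow> 0"
  shows "AE z in \<mu>. \<exists>n. z \<notin> F n"
proof -
  have "(\<lambda>n. measure \<mu> (F n)) \<longlonglongrightarrow> measure \<mu> (\<Inter>n. F n)"
    using assms by (intro circle.finite_Lim_measure_decseq)
  then have "measure \<mu> (\<Inter>n. F n) = 0" using assms(3) LIMSEQ_unique by blast
  moreover have "(\<Inter>n. F n) \<in> sets \<mu>" using assms(2) by auto
  ultimately have "(\<Inter>n. F n) \<in> null_sets \<mu>" by (simp add: null_sets_def circle.emeasure_eq_measure)
  then have "AE z in \<mu>. z \<notin> (\<Inter>n. F n)" by (rule AE_not_in)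
  then show ?thesis by eventually_elim auto
qed

context rot_gauge
begin

text \<open>Sets of measure below (1 / 2) ^ n and gauge at least e need not be nested. Their tail
  unions are; these keep gauge at least e by monotonicity, and their measures are bounded by the
  geometric tails.\<close>

lemma not_continuousE:
  assumes "\<not> gauge_continuous \<alpha>"
  obtains F :: "nat \<Rightarrow> complex set" and e :: real where "0 < e" "decseq F" "range F \<subseteq> sets \<mu>"
    "(\<lambda>n. measure \<mu> (F n)) \<longlonglongrightarrow> 0" "\<And>n. ennreal e \<le> \<alpha> (indicator (F n))"
proof -
  obtain e :: real where e: "0 < e"
    "\<And>d. 0 < d \<Longrightarrow> \<exists>E \<in> sets \<mu>. measure \<mu> E < d \<and> ennreal e \<le> \<alpha> (indicator E)"
    using assms unfolding gauge_continuous_def by (meson not_less)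
  have "\<forall>n. \<exists>E. E \<in> sets \<mu> \<and> measure \<mu> E < (1 / 2) ^ n \<and> ennreal e \<le> \<alpha> (indicator E)"
    using e(2) by (metis zero_less_power zero_less_divide_1_iff zero_less_numeral)
  then obtain E where E: "\<And>n. E n \<in> sets \<mu>" "\<And>n. measure \<mu> (E n) < (1 / 2) ^ n" "\<And>n. ennreal e \<le> \<alpha> (indicator (E n))"
    by metis
  define F where "F n = (\<Union>k. E (n + k))" for n
  have F: "F n \<in> sets \<mu>" for n unfolding F_def using E(1) by blast
  have sums: "(\<lambda>k. (1 / 2) ^ (n + k)) sums (2 * (1 / 2) ^ n :: real)" for n
    using sums_mult[OF geometric_sums[of "1 / 2 :: real"], of "(1 / 2) ^ n"]
    by (simp add: power_add mult.commute)
  have mF: "measure \<mu> (F n) \<le> 2 * (1 / 2) ^ n" for n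
  proof -
    have summ: "summable (\<lambda>k. measure \<mu> (E (n + k)))"
      using E(2) sums_summable[OF sums] by (intro summable_comparison_test'[OF sums_summable[OF sums[of n]]]) (auto intro: less_imp_le)
    have "measure \<mu> (F n) \<le> (\<Sum>k. measure \<mu> (E (n + k)))"
      unfolding F_def using E(1) summ by (intro circle.finite_measure_subadditive_countably) auto
    also have "\<dots> \<le> (\<Sum>k. (1 / 2) ^ (n + k))"
      using summ sums_summable[OF sums[of n]] E(2) by (intro suminf_le) (auto intro: less_imp_le)
    also have "\<dots> = 2 * (1 / 2) ^ n" using sums by (rule sums_unique[symmetric])
    finally show ?thesis .
  qed
  show thesis
  proof (rule that[of e F])
    show "decseq F"
    proof (rule decseq_SucI)
      show "F (Suc n) \<subseteq> F n" for n
      proof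
        fix z assume "z \<in> F (Suc n)"
        then obtain k where "z \<in> E (n + Suc k)" by (auto simp: F_def)
        then show "z \<in> F n" unfolding F_def by blast
      qed
    qed
    have "(\<lambda>n. 2 * (1 / 2) ^ n :: real) \<longlonglongrightarrow> 2 * 0" by (intro tendsto_intros LIMSEQ_power_zero) simp
    then have "(\<lambda>n. 2 * (1 / 2) ^ n :: real) \<longlonglongrightarrow> 0" by simp
    then show "(\<lambda>n. measure \<mu> (F n)) \<longlonglongrightarrow> 0"
      by (rule tendsto_sandwich[OF _ _ tendsto_const, rotated 2]) (use mF in auto)
    show "ennreal e \<le> \<alpha> (indicator (F n))" for n
    proof -
      have "E n \<subseteq> F n" unfolding F_def using UN_upper[of 0 UNIV "\<lambda>k. E (n + k)"] by simp
      then have "\<alpha> (indicator (E n)) \<le> \<alpha> (indicator (F n))"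
        using E(1) F by (intro gauge_mono) (auto split: split_indicator)
      then show ?thesis using E(3)[of n] by simp
    qed
  qed (use e F in auto)
qed

text \<open>The functional is obtained by separating \<open>1\<close> from the functions whose restrictions to the
  sets \<open>F n\<close> tend to \<open>0\<close>.\<close>

lemma singular_functional:
  assumes V: "seminormed_functions V (gauge_ext \<alpha>)" "V \<subseteq> Lcal \<alpha>" "Linf \<subseteq> V"
    and F: "0 < e" "decseq F" "range F \<subseteq> sets \<mu>" "\<And>n. ennreal e \<le> \<alpha> (indicator (F n))"
  obtains \<phi> where "\<phi> \<in> dual_space V (gauge_ext \<alpha>)" "\<phi> (\<lambda>_. 1) \<noteq> 0" "\<And>n. \<phi> (indicator (F n)) = \<phi> (\<lambda>_. 1)"
proof -
  interpret V: seminormed_functions V "gauge_ext \<alpha>" by (rule V(1))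
  have Fs: "F n \<in> sets \<mu>" for n using F(3) by auto
  have m: "f \<in> borel_measurable \<mu>" if "f \<in> V" for f using that V(2) Lcal_measurable by blast
  have mi: "(\<lambda>z. f z * indicator (F n) z) \<in> borel_measurable \<mu>" if "f \<in> V" for f n
    using m[OF that] Fs by measurable
  define W where "W = {f \<in> V. (\<lambda>n. gauge_ext \<alpha> (\<lambda>z. f z * indicator (F n) z)) \<longlonglongrightarrow> 0}"
  have W: "W \<subseteq> V" "(\<lambda>_. 0) \<in> W" "\<And>c f. f \<in> W \<Longrightarrow> (\<lambda>x. c * f x) \<in> W"
    "\<And>f g. f \<in> W \<Longrightarrow> g \<in> W \<Longrightarrow> (\<lambda>x. f x + g x) \<in> W"
  proof -
    show "W \<subseteq> V" by (auto simp: W_def)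
    show "(\<lambda>_. 0) \<in> W" using V.zero_closed by (simp add: W_def gauge_zero)
    show "(\<lambda>x. c * f x) \<in> W" if f: "f \<in> W" for c f
    proof -
      have "(\<lambda>n. ennreal (cmod c) * gauge_ext \<alpha> (\<lambda>z. f z * indicator (F n) z)) \<longlonglongrightarrow> ennreal (cmod c) * 0"
        using f by (intro ennreal_tendsto_cmult) (auto simp: W_def)
      then show ?thesis
        using f V.scale_closed gauge_ext_scale[of c] by (simp add: W_def mult.assoc)
    qed
    show "(\<lambda>x. f x + g x) \<in> W" if f: "f \<in> W" and g: "g \<in> W" for f g
    proof -
      have fV: "f \<in> V" "g \<in> V" using f g by (auto simp: W_def)
      have "(\<lambda>n. gauge_ext \<alpha> (\<lambda>z. f z * indicator (F n) z) + gauge_ext \<alpha> (\<lambda>z. g z * indicator (F n) z)) \<longlonglongrightarrow> 0 + 0"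
        using f g by (intro tendsto_add) (auto simp: W_def)
      then have lim: "(\<lambda>n. gauge_ext \<alpha> (\<lambda>z. f z * indicator (F n) z) + gauge_ext \<alpha> (\<lambda>z. g z * indicator (F n) z)) \<longlonglongrightarrow> 0"
        by simp
      have le: "gauge_ext \<alpha> (\<lambda>z. (f z + g z) * indicator (F n) z)
          \<le> gauge_ext \<alpha> (\<lambda>z. f z * indicator (F n) z) + gauge_ext \<alpha> (\<lambda>z. g z * indicator (F n) z)" for n
        unfolding distrib_right by (intro gauge_ext_add mi fV)
      have "(\<lambda>n. gauge_ext \<alpha> (\<lambda>z. (f z + g z) * indicator (F n) z)) \<longlonglongrightarrow> 0"
        by (rule tendsto_sandwich[OF _ _ tendsto_const lim]) (use le in auto)
      then show ?thesis using V.add_closed[OF fV] by (simp add: W_def)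
    qed
  qed
  have one: "(\<lambda>_. 1) \<in> V" using V(3) by auto
  \<comment> \<open>On F n write 1 = (1 - w) + w: then e is at most the gauge of 1 - w plus a term
    that tends to 0, so the constant 1 has distance at least e from \<open>W\<close>.\<close>
  have dist: "ennreal e \<le> gauge_ext \<alpha> (\<lambda>z. 1 - w z)" if w: "w \<in> W" for w
  proof -
    have wV: "w \<in> V" and lim: "(\<lambda>n. gauge_ext \<alpha> (\<lambda>z. w z * indicator (F n) z)) \<longlonglongrightarrow> 0"
      using w by (auto simp: W_def)
    have le: "ennreal e \<le> gauge_ext \<alpha> (\<lambda>z. 1 - w z) + gauge_ext \<alpha> (\<lambda>z. w z * indicator (F n) z)" for n
    proof -
      have "ennreal e \<le> gauge_ext \<alpha> (indicator (F n))" using F(4) Fs by simp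
      also have "indicator (F n) = (\<lambda>z. (1 - w z) * indicator (F n) z + w z * indicator (F n) z)"
        by (auto split: split_indicator)
      also have "gauge_ext \<alpha> \<dots> \<le> gauge_ext \<alpha> (\<lambda>z. (1 - w z) * indicator (F n) z) + gauge_ext \<alpha> (\<lambda>z. w z * indicator (F n) z)"
        using mi[OF V.diff_closed[OF one wV]] mi[OF wV] by (intro gauge_ext_add)
      also have "\<dots> \<le> gauge_ext \<alpha> (\<lambda>z. 1 - w z) + gauge_ext \<alpha> (\<lambda>z. w z * indicator (F n) z)"
        by (intro add_right_mono gauge_ext_mono) (auto split: split_indicator)
      finally show ?thesis .
    qed
    have "(\<lambda>n. gauge_ext \<alpha> (\<lambda>z. 1 - w z) + gauge_ext \<alpha> (\<lambda>z. w z * indicator (F n) z)) \<longlonglongrightarrow> gauge_ext \<alpha> (\<lambda>z. 1 - w z) + 0"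
      by (intro tendsto_add tendsto_const lim)
    then show ?thesis using le by (intro LIMSEQ_le_const) auto
  qed
  have "\<exists>\<phi> \<in> dual_space V (gauge_ext \<alpha>). (\<forall>w \<in> W. \<phi> w = 0) \<and> \<phi> (\<lambda>_. 1) \<noteq> 0"
    by (rule V.separate_point[of W _ e]) (fact W one F dist)+
  then obtain \<phi> where \<phi>: "\<phi> \<in> dual_space V (gauge_ext \<alpha>)" "\<And>w. w \<in> W \<Longrightarrow> \<phi> w = 0" "\<phi> (\<lambda>_. 1) \<noteq> 0"
    by blast
  show thesis
  proof (rule that[OF \<phi>(1)])
    show "\<phi> (\<lambda>_. 1) \<noteq> 0" by (rule \<phi>(3))
    fix n
    have iV: "indicator (F n) \<in> V" using V(3) Fs by auto
    \<comment> \<open>This function vanishes on F k for all k \<ge> n and hence lies in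
      \<open>W\<close>: the functional lives on every F n.\<close>
    have "(\<lambda>z. 1 - indicator (F n) z) \<in> W"
    proof -
      have "(\<lambda>z. (1 - indicator (F n) z) * indicator (F k) z) = (\<lambda>_. 0 :: complex)" if "n \<le> k" for k
        using decseqD[OF F(2) that] by (intro ext) (auto split: split_indicator)
      then have "\<forall>\<^sub>F k in sequentially. gauge_ext \<alpha> (\<lambda>z. (1 - indicator (F n) z) * indicator (F k) z) = 0"
        by (intro eventually_sequentiallyI[of n]) (simp only: gauge_ext_Linf[OF Linf_const] gauge_zero)
      then show ?thesis using V.diff_closed[OF one iV] by (simp add: W_def tendsto_eventually)
    qed
    then show "\<phi> (indicator (F n)) = \<phi> (\<lambda>_. 1)"
      using \<phi>(2) V.dual_diff[OF \<phi>(1) one iV] by fastforce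
  qed
qed

end

context cont_gauge
begin

lemma integrable_Lcal: "f \<in> Lcal \<alpha> \<Longrightarrow> integrable \<mu> f"
  using pairing_integrable(1)[OF _ dual.Linf_Lcal[OF Linf_const[of 1]]] by simp

text \<open>Three kinds of functionals on the full space of \<alpha>' are tested. Integration
  against f in \<open>Lcal \<alpha>\<close> is represented by a function of the closure, which must
  equal f almost everywhere. A functional concentrated on shrinking sets, and a nonzero one that
  vanishes on bounded functions, cannot be integrals at all.\<close>

lemma reflexive_strongly_continuous:
  assumes refl: "reflexive_space (Lgauge \<alpha>) (gauge_ext \<alpha>)"
  shows "strongly_continuous \<alpha>" "strongly_continuous (dual_gauge \<alpha>)"
proof -
  have rep: "\<exists>f \<in> Lgauge \<alpha>. \<forall>h \<in> Lcal (dual_gauge \<alpha>). \<Theta> h = (\<integral>z. f z * h z \<partial>\<mu>)"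
    if "\<Theta> \<in> dual_space (Lcal (dual_gauge \<alpha>)) (gauge_ext (dual_gauge \<alpha>))" for \<Theta>
    using refl that unfolding reflexive_Lgauge_iff by blast
  have "f \<in> Lgauge \<alpha>" if f: "f \<in> Lcal \<alpha>" for f
  proof -
    note i = pairing_integrable(1)[OF f]
    have "(\<lambda>h. if h \<in> Lcal (dual_gauge \<alpha>) then (\<integral>z. f z * h z \<partial>\<mu>) else 0)
        \<in> dual_space (Lcal (dual_gauge \<alpha>)) (gauge_ext (dual_gauge \<alpha>))"
    proof (rule dual.Lcal.dual_spaceI)
      show "(\<integral>z. f z * (h z + k z) \<partial>\<mu>) = (\<integral>z. f z * h z \<partial>\<mu>) + (\<integral>z. f z * k z \<partial>\<mu>)"
        if "h \<in> Lcal (dual_gauge \<alpha>)" "k \<in> Lcal (dual_gauge \<alpha>)" for h k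
        using i[OF that(1)] i[OF that(2)] by (simp add: distrib_left)
      show "(\<integral>z. f z * (c * h z) \<partial>\<mu>) = c * (\<integral>z. f z * h z \<partial>\<mu>)" for c h
        by (simp add: mult.left_commute)
      show "cmod (\<integral>z. f z * h z \<partial>\<mu>) \<le> enn2real (gauge_ext \<alpha> f) * enn2real (gauge_ext (dual_gauge \<alpha>) h)"
        if "h \<in> Lcal (dual_gauge \<alpha>)" for h
        using pairing_integrable(3)[OF f that] by (simp add: mult.commute)
    qed simp
    from rep[OF this] obtain g where g: "g \<in> Lgauge \<alpha>"
      "\<And>h. h \<in> Lcal (dual_gauge \<alpha>) \<Longrightarrow> (\<integral>z. f z * h z \<partial>\<mu>) = (\<integral>z. g z * h z \<partial>\<mu>)"
      by auto
    have fg: "AE z in \<mu>. f z = g z"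
      using integrable_Lcal[OF f] integrable_Lcal[OF Lgauge_Lcal[OF g(1)]]
    proof (rule AE_eqI_integrals)
      show "(\<integral>z. h z * f z \<partial>\<mu>) = (\<integral>z. h z * g z \<partial>\<mu>)" if "h \<in> Linf" for h
        using g(2)[OF dual.Linf_Lcal[OF that]] by (simp add: mult.commute)
    qed
    have "gauge_ext \<alpha> (\<lambda>z. f z - g z) = gauge_ext \<alpha> (\<lambda>_. 0)"
      using fg by (intro gauge_ext_cong, eventually_elim) simp
    then have "\<exists>g \<in> gauge_closure \<alpha> Linf. gauge_ext \<alpha> (\<lambda>z. f z - g z) < ennreal e" if "0 < e" for e
      using g(1) that by (intro bexI[of _ g]) (auto simp: gauge_zero Lgauge_def)
    then show ?thesis unfolding Lgauge_def by (rule gauge_closure_closed[OF order_refl f])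
  qed
  then show "strongly_continuous \<alpha>"
    using continuous Lgauge_Lcal by (auto simp: strongly_continuous_def)
  have "gauge_continuous (dual_gauge \<alpha>)"
  proof (rule ccontr)
    assume "\<not> gauge_continuous (dual_gauge \<alpha>)"
    then obtain F :: "nat \<Rightarrow> complex set" and e :: real where F: "0 < e" "decseq F" "range F \<subseteq> sets \<mu>"
      "(\<lambda>n. measure \<mu> (F n)) \<longlonglongrightarrow> 0" "\<And>n. ennreal e \<le> dual_gauge \<alpha> (indicator (F n))"
      by (rule dual.not_continuousE) blast
    obtain \<phi> where \<phi>: "\<phi> \<in> dual_space (Lcal (dual_gauge \<alpha>)) (gauge_ext (dual_gauge \<alpha>))"
      "\<phi> (\<lambda>_. 1) \<noteq> 0" "\<And>n. \<phi> (indicator (F n)) = \<phi> (\<lambda>_. 1)"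
      by (rule dual.singular_functional[OF dual.seminormed_functions_Lcal order_refl _ F(1,2,3,5)])
        (use dual.Linf_Lcal in blast)+
    obtain f where f: "f \<in> Lgauge \<alpha>" "\<And>h. h \<in> Lcal (dual_gauge \<alpha>) \<Longrightarrow> \<phi> h = (\<integral>z. f z * h z \<partial>\<mu>)"
      using rep[OF \<phi>(1)] by blast
    note fi = integrable_Lcal[OF Lgauge_Lcal[OF f(1)]]
    have Fs: "F n \<in> sets \<mu>" for n using F(3) by auto
    have [measurable]: "f \<in> borel_measurable \<mu>" using fi by simp
    note [measurable] = Fs
    \<comment> \<open>f is integrable, so its integrals over F n tend to 0, whereas they all equal
      the nonzero value of \<phi> at 1.\<close>
    have "(\<lambda>n. \<integral>z. f z * indicator (F n) z \<partial>\<mu>) \<longlonglongrightarrow> (\<integral>z. 0 \<partial>\<mu>)"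
    proof (rule integral_dominated_convergence[OF _ _ integrable_norm[OF fi]])
      show "AE z in \<mu>. cmod (f z * indicator (F n) z) \<le> cmod (f z)" for n
        by (auto split: split_indicator)
      show "AE z in \<mu>. (\<lambda>n. f z * indicator (F n) z) \<longlonglongrightarrow> 0"
        using AE_not_in_limit[OF F(2,3,4)]
      proof eventually_elim
        case (elim z)
        then obtain m where "z \<notin> F m" by blast
        then have "z \<notin> F n" if "m \<le> n" for n using decseqD[OF F(2) that] by blast
        then have "\<forall>\<^sub>F n in sequentially. f z * indicator (F n) z = 0"
          by (intro eventually_sequentiallyI[of m]) simp
        then show ?case by (rule tendsto_eventually)
      qed
    qed measurable
    then have "(\<lambda>n. \<phi> (indicator (F n))) \<longlonglongrightarrow> 0"
      using f(2)[OF dual.Linf_Lcal[OF Linf_indicator[OF Fs]]] by simp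
    then have "\<phi> (\<lambda>_. 1) = 0" unfolding \<phi>(3) LIMSEQ_const_iff by simp
    then show False using \<phi>(2) by simp
  qed
  moreover have "h \<in> Lgauge (dual_gauge \<alpha>)" if h: "h \<in> Lcal (dual_gauge \<alpha>)" for h
  proof (rule ccontr)
    assume nin: "h \<notin> Lgauge (dual_gauge \<alpha>)"
    obtain e :: real where e: "0 < e"
      "\<And>w. w \<in> Lgauge (dual_gauge \<alpha>) \<Longrightarrow> ennreal e \<le> gauge_ext (dual_gauge \<alpha>) (\<lambda>z. h z - w z)"
      unfolding Lgauge_def
      by (rule dual.gauge_closure_distance[OF order_refl h nin[unfolded Lgauge_def]]) blast
    have sub: "Lgauge (dual_gauge \<alpha>) \<subseteq> Lcal (dual_gauge \<alpha>)" using dual.Lgauge_Lcal by blast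
    have "\<exists>\<phi> \<in> dual_space (Lcal (dual_gauge \<alpha>)) (gauge_ext (dual_gauge \<alpha>)).
        (\<forall>w \<in> Lgauge (dual_gauge \<alpha>). \<phi> w = 0) \<and> \<phi> h \<noteq> 0"
      by (rule dual.Lcal.separate_point[of "Lgauge (dual_gauge \<alpha>)" h e])
        (fact sub h e dual.Lgauge.zero_closed dual.Lgauge.add_closed dual.Lgauge.scale_closed)+
    then obtain \<phi> where \<phi>: "\<phi> \<in> dual_space (Lcal (dual_gauge \<alpha>)) (gauge_ext (dual_gauge \<alpha>))"
      "\<And>w. w \<in> Lgauge (dual_gauge \<alpha>) \<Longrightarrow> \<phi> w = 0" "\<phi> h \<noteq> 0"
      by blast
    obtain f where f: "f \<in> Lgauge \<alpha>" "\<And>h. h \<in> Lcal (dual_gauge \<alpha>) \<Longrightarrow> \<phi> h = (\<integral>z. f z * h z \<partial>\<mu>)"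
      using rep[OF \<phi>(1)] by blast
    \<comment> \<open>\<phi> vanishes on bounded functions, so its representing function is 0,
      although \<phi> h \<noteq> 0.\<close>
    have "AE z in \<mu>. f z = 0"
      using integrable_Lcal[OF Lgauge_Lcal[OF f(1)]]
    proof (rule AE_eqI_integrals)
      show "(\<integral>z. g z * f z \<partial>\<mu>) = (\<integral>z. g z * 0 \<partial>\<mu>)" if "g \<in> Linf" for g
        using f(2)[OF dual.Linf_Lcal[OF that]] \<phi>(2)[OF dual.Linf_Lgauge[OF that]] by (simp add: mult.commute)
    qed simp
    then have "AE z in \<mu>. f z * h z = 0" by eventually_elim simp
    then have "(\<integral>z. f z * h z \<partial>\<mu>) = (\<integral>z. 0 \<partial>\<mu>)"
      using pairing_integrable(1)[OF Lgauge_Lcal[OF f(1)] h] by (intro integral_cong_AE) auto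
    then show False using f(2)[OF h] \<phi>(3) by simp
  qed
  ultimately show "strongly_continuous (dual_gauge \<alpha>)"
    using dual.Lgauge_Lcal by (auto simp: strongly_continuous_def)
qed

end

section \<open>Symmetric gauge seminorms\<close>

lemma unit_cnj_mult: "c \<in> sphere 0 1 \<Longrightarrow> cnj c * (c * z) = z" "c \<in> sphere 0 1 \<Longrightarrow> c * (cnj c * z) = z"
  for c z :: complex
  using complex_norm_square[of c] by (simp_all add: mult.assoc[symmetric] mult.commute)

lemma rotate_vimage_sets:
  "c \<in> sphere 0 1 \<Longrightarrow> E \<in> sets \<mu> \<Longrightarrow> (\<lambda>z. c * z) -` E \<inter> space \<mu> \<in> sets \<mu>"
  using measurable_sets[OF measurable_rotate] by blast

lemma emeasure_rotate_vimage:
  assumes "c \<in> sphere 0 1" "E \<in> sets \<mu>"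
  shows "emeasure \<mu> ((\<lambda>z. c * z) -` E \<inter> space \<mu>) = emeasure \<mu> E"
  using emeasure_distr[OF measurable_rotate[OF assms(1)] assms(2)] distr_rotate[OF assms(1)] by simp

lemma measure_rotate_vimage:
  "c \<in> sphere 0 1 \<Longrightarrow> E \<in> sets \<mu> \<Longrightarrow> measure \<mu> ((\<lambda>z. c * z) -` E \<inter> space \<mu>) = measure \<mu> E"
  by (simp only: measure_def emeasure_rotate_vimage)

text \<open>By \<open>inv\<close> the map is an involution, hence bijective on the whole circle and
  its own inverse. The part of the preimage of E that is rotated by c is a rotated copy of the part
  of E on which v = \<open>cnj c\<close>. Conjugation permutes S, so the countably many measures add
  up to that of E.\<close>

lemma circle_automorphism_rotations:
  fixes v :: "complex \<Rightarrow> complex"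
  assumes S: "countable S" "S \<subseteq> sphere 0 1" "\<And>c. c \<in> S \<Longrightarrow> cnj c \<in> S"
    and v: "\<And>z. z \<in> sphere 0 1 \<Longrightarrow> v z \<in> S"
    and v_sets: "\<And>c. c \<in> S \<Longrightarrow> {z \<in> space \<mu>. v z = c} \<in> sets \<mu>"
    and inv: "\<And>z. z \<in> sphere 0 1 \<Longrightarrow> v (v z * z) = cnj (v z)"
  shows "circle_automorphism (\<lambda>z. v z * z)"
proof -
  define \<phi> where "\<phi> z = v z * z" for z
  define R where "R c E = (\<lambda>z. c * z) -` E \<inter> space \<mu>" for c :: complex and E
  have Ss: "c \<in> sphere 0 1" if "c \<in> S" for c using S(2) that by blast
  have R_sets: "R c E \<in> sets \<mu>" if "c \<in> S" "E \<in> sets \<mu>" for c E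
    unfolding R_def by (rule rotate_vimage_sets[OF Ss[OF that(1)] that(2)])
  have \<phi>_sphere: "\<phi> z \<in> sphere 0 1" if "z \<in> sphere 0 1" for z
    using Ss[OF v[OF that]] that by (simp add: \<phi>_def norm_mult)
  have \<phi>\<phi>: "\<phi> (\<phi> z) = z" if "z \<in> sphere 0 1" for z
    using inv[OF that] unit_cnj_mult(1)[OF Ss[OF v[OF that]]] by (simp add: \<phi>_def)
  have bij: "bij_betw \<phi> (sphere 0 1) (sphere 0 1)"
    by (rule bij_betw_byWitness[of _ \<phi>]) (use \<phi>_sphere \<phi>\<phi> in blast)+
  have vimage: "\<phi> -` E \<inter> space \<mu> = (\<Union>c\<in>S. {z \<in> space \<mu>. v z = c} \<inter> R c E)" for E
    using v by (auto simp: \<phi>_def R_def)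
  have \<phi>_meas: "\<phi> \<in> measurable \<mu> \<mu>"
  proof (rule measurableI)
    show "\<phi> z \<in> space \<mu>" if "z \<in> space \<mu>" for z using \<phi>_sphere that by simp
    show "\<phi> -` E \<inter> space \<mu> \<in> sets \<mu>" if "E \<in> sets \<mu>" for E
      unfolding vimage using v_sets R_sets that S(1) by (intro sets.countable_UN'' sets.Int) auto
  qed
  have piece: "{z \<in> space \<mu>. v z = c} \<inter> R c E = R c (E \<inter> {z \<in> space \<mu>. v z = cnj c})" if c: "c \<in> S" for c E
  proof (intro equalityI subsetI)
    fix z assume "z \<in> {z \<in> space \<mu>. v z = c} \<inter> R c E"
    then have z: "z \<in> sphere 0 1" "v z = c" "c * z \<in> E" by (auto simp: R_def)
    then have "v (c * z) = cnj c" using inv[OF z(1)] by simp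
    then show "z \<in> R c (E \<inter> {z \<in> space \<mu>. v z = cnj c})"
      using z Ss[OF c] by (simp add: R_def norm_mult)
  next
    fix z assume "z \<in> R c (E \<inter> {z \<in> space \<mu>. v z = cnj c})"
    then have z: "z \<in> sphere 0 1" "c * z \<in> sphere 0 1" "c * z \<in> E" "v (c * z) = cnj c"
      by (auto simp: R_def)
    have "v z = c" using inv[OF z(2)] z(4) unit_cnj_mult(1)[OF Ss[OF c]] by simp
    then show "z \<in> {z \<in> space \<mu>. v z = c} \<inter> R c E" using z by (simp add: R_def)
  qed
  have "distr \<mu> \<mu> \<phi> = \<mu>"
  proof (rule measure_eqI)
    fix E assume "E \<in> sets (distr \<mu> \<mu> \<phi>)"
    then have E: "E \<in> sets \<mu>" by simp
    have "emeasure (distr \<mu> \<mu> \<phi>) E = emeasure \<mu> (\<Union>c\<in>S. {z \<in> space \<mu>. v z = c} \<inter> R c E)"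
      using E by (simp add: emeasure_distr[OF \<phi>_meas] vimage del: space_circle)
    also have "\<dots> = (\<integral>\<^sup>+c. emeasure \<mu> ({z \<in> space \<mu>. v z = c} \<inter> R c E) \<partial>count_space S)"
      using v_sets R_sets E S(1) by (intro emeasure_UN_countable) (auto simp: disjoint_family_on_def)
    also have "\<dots> = (\<integral>\<^sup>+c. emeasure \<mu> (E \<inter> {z \<in> space \<mu>. v z = cnj c}) \<partial>count_space S)"
    proof (rule nn_integral_cong)
      fix c assume "c \<in> space (count_space S)"
      then have c: "c \<in> S" by simp
      have "E \<inter> {z \<in> space \<mu>. v z = cnj c} \<in> sets \<mu>" using E v_sets[OF S(3)[OF c]] by blast
      then show "emeasure \<mu> ({z \<in> space \<mu>. v z = c} \<inter> R c E) = emeasure \<mu> (E \<inter> {z \<in> space \<mu>. v z = cnj c})"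
        unfolding piece[OF c] unfolding R_def by (rule emeasure_rotate_vimage[OF Ss[OF c]])
    qed
    also have "\<dots> = (\<integral>\<^sup>+c. emeasure \<mu> (E \<inter> {z \<in> space \<mu>. v z = c}) \<partial>count_space S)"
    proof (rule nn_integral_bij_count_space)
      show "bij_betw cnj S S" by (rule bij_betw_byWitness[of _ cnj]) (use S(3) in auto)
    qed
    also have "\<dots> = emeasure \<mu> (\<Union>c\<in>S. E \<inter> {z \<in> space \<mu>. v z = c})"
      using v_sets E S(1) by (intro emeasure_UN_countable[symmetric]) (auto simp: disjoint_family_on_def)
    also have "(\<Union>c\<in>S. E \<inter> {z \<in> space \<mu>. v z = c}) = E"
      using v sets.sets_into_space[OF E] by auto
    finally show "emeasure (distr \<mu> \<mu> \<phi>) E = emeasure \<mu> E" .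
  qed simp
  moreover have "inv_into (sphere 0 1) \<phi> \<in> measurable \<mu> \<mu>"
  proof -
    have "inv_into (sphere 0 1) \<phi> z = \<phi> z" if "z \<in> space \<mu>" for z
      using bij that \<phi>_sphere \<phi>\<phi> by (intro inv_into_f_eq) (auto simp: bij_betw_def)
    then show ?thesis by (rule measurable_cong[THEN iffD2, OF _ \<phi>_meas])
  qed
  ultimately have "circle_automorphism \<phi>"
    unfolding circle_automorphism_def using bij \<phi>_meas by blast
  then show ?thesis by (simp add: \<phi>_def[abs_def])
qed

text \<open>By Fubini, the mean over \<open>w\<close> of the right hand side is \<open>measure \<mu> A * measure \<mu> B\<close>, so half of
  it is certainly attained.\<close>

lemma exists_rotation_overlap:
  assumes A: "A \<in> sets \<mu>" and B: "B \<in> sets \<mu>"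
  shows "\<exists>w \<in> sphere 0 1. measure \<mu> A * measure \<mu> B / 2 \<le> measure \<mu> (A \<inter> ((\<lambda>z. w * z) -` B \<inter> space \<mu>))"
proof (rule ccontr)
  define c where "c = measure \<mu> A * measure \<mu> B"
  assume "\<not> ?thesis"
  then have less: "measure \<mu> (A \<inter> ((\<lambda>z. w * z) -` B \<inter> space \<mu>)) < c / 2" if "w \<in> sphere 0 1" for w
    using that by (auto simp: c_def not_le)
  \<comment> \<open>At w = 1 the negated claim already yields c > 0.\<close>
  have "(1::complex) \<in> sphere 0 1" by simp
  then have c: "0 < c" using less[of 1] measure_nonneg[of \<mu> "A \<inter> ((\<lambda>z. 1 * z) -` B \<inter> space \<mu>)"] by linarith
  interpret P: pair_sigma_finite \<mu> \<mu> ..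
  define F :: "complex \<times> complex \<Rightarrow> ennreal" where "F p = indicator A (snd p) * indicator B (fst p * snd p)" for p
  have [measurable]: "(\<lambda>p. indicator B (fst p * snd p) :: ennreal) \<in> borel_measurable (\<mu> \<Otimes>\<^sub>M \<mu>)"
    using measurable_compose[OF measurable_mult_circle borel_measurable_indicator[OF B]] by (simp add: split_beta)
  have F: "F \<in> borel_measurable (\<mu> \<Otimes>\<^sub>M \<mu>)" unfolding F_def using A by measurable
  have "ennreal c = emeasure \<mu> A * emeasure \<mu> B"
    by (simp add: c_def circle.emeasure_eq_measure ennreal_mult)
  also have "\<dots> = (\<integral>\<^sup>+z. emeasure \<mu> B * indicator A z \<partial>\<mu>)"
    using A by (subst nn_integral_cmult_indicator) (auto simp: mult.commute)
  also have "\<dots> = (\<integral>\<^sup>+z. (\<integral>\<^sup>+w. F (w, z) \<partial>\<mu>) \<partial>\<mu>)"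
  proof (rule nn_integral_cong)
    fix z assume z: "z \<in> space \<mu>"
    have m: "(\<lambda>w. indicator B (z * w) :: ennreal) \<in> borel_measurable \<mu>"
      using measurable_compose[OF measurable_rotate borel_measurable_indicator[OF B], of z] z by simp
    have "(\<integral>\<^sup>+w. F (w, z) \<partial>\<mu>) = indicator A z * (\<integral>\<^sup>+w. indicator B (z * w) \<partial>\<mu>)"
      unfolding F_def using m by (simp add: nn_integral_cmult mult.commute[of _ z])
    also have "(\<integral>\<^sup>+w. indicator B (z * w) \<partial>\<mu>) = emeasure \<mu> B"
      using B z by (subst nn_integral_rotate) auto
    finally show "emeasure \<mu> B * indicator A z = (\<integral>\<^sup>+w. F (w, z) \<partial>\<mu>)" by (simp add: mult.commute)
  qed
  also have "\<dots> = (\<integral>\<^sup>+w. (\<integral>\<^sup>+z. F (w, z) \<partial>\<mu>) \<partial>\<mu>)" by (rule P.Fubini[OF F])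
  also have "\<dots> \<le> (\<integral>\<^sup>+w. ennreal (c / 2) \<partial>\<mu>)"
  proof (rule nn_integral_mono)
    fix w assume w: "w \<in> space \<mu>"
    let ?X = "A \<inter> ((\<lambda>z. w * z) -` B \<inter> space \<mu>)"
    have X: "?X \<in> sets \<mu>" using A rotate_vimage_sets[of w B] B w by auto
    have "(\<integral>\<^sup>+z. F (w, z) \<partial>\<mu>) = (\<integral>\<^sup>+z. indicator ?X z \<partial>\<mu>)"
      by (intro nn_integral_cong) (auto simp: F_def split: split_indicator)
    also have "\<dots> = ennreal (measure \<mu> ?X)" using X by (simp add: circle.emeasure_eq_measure)
    also have "\<dots> \<le> ennreal (c / 2)" using less[of w] w by (intro ennreal_leI) auto
    finally show "(\<integral>\<^sup>+z. F (w, z) \<partial>\<mu>) \<le> ennreal (c / 2)" .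
  qed
  also have "\<dots> = ennreal (c / 2)" by (simp add: circle.emeasure_space_1[simplified])
  finally show False using c by (simp add: ennreal_le_iff)
qed

text \<open>\<open>F\<close> is exhausted greedily: a rotation moves a fixed fraction of what is left of \<open>F\<close> into the
  unused part of \<open>G\<close>.  The pieces are swapped with their images, which yields a bijection of the
  circle without any exceptional set.\<close>

lemma automorphism_into:
  assumes F: "F \<in> sets \<mu>" and G: "G \<in> sets \<mu>" and disj: "F \<inter> G = {}"
    and large: "measure \<mu> F + 1 / 2 \<le> measure \<mu> G"
  obtains \<phi> where "circle_automorphism \<phi>" "AE z in \<mu>. z \<in> F \<longrightarrow> \<phi> z \<in> G"
proof -
  define R where "R c E = (\<lambda>z. c * z) -` E \<inter> space \<mu>" for c :: complex and E
  define W where "W p = (SOME w. w \<in> sphere 0 1 \<and>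
      measure \<mu> (fst p) * measure \<mu> (snd p) / 2 \<le> measure \<mu> (fst p \<inter> R w (snd p)))" for p
  define Q where "Q p = fst p \<inter> R (W p) (snd p)" for p
  define P where "P = rec_nat (F, G) (\<lambda>n p. (fst p - Q p, snd p - R (cnj (W p)) (Q p)))"
  define Fs where "Fs n = fst (P n)" for n
  define Gs where "Gs n = snd (P n)" for n
  define w where "w n = W (P n)" for n
  define A where "A n = Fs n \<inter> R (w n) (Gs n)" for n
  \<comment> \<open>The preimage of A n under multiplication by \<open>cnj (w n)\<close> is its
    image under multiplication by \<open>w n\<close>.\<close>
  define B where "B n = R (cnj (w n)) (A n)" for n
  have P0: "Fs 0 = F" "Gs 0 = G" by (simp_all add: Fs_def Gs_def P_def)
  have PS: "Fs (Suc n) = Fs n - A n" "Gs (Suc n) = Gs n - B n" for n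
    by (simp_all add: Fs_def Gs_def P_def A_def B_def w_def Q_def)
  have W: "W p \<in> sphere 0 1 \<and> measure \<mu> (fst p) * measure \<mu> (snd p) / 2 \<le> measure \<mu> (fst p \<inter> R (W p) (snd p))"
    if "fst p \<in> sets \<mu>" "snd p \<in> sets \<mu>" for p
    unfolding W_def by (rule someI_ex) (use exists_rotation_overlap[OF that] in \<open>auto simp: R_def\<close>)
  have R_sets: "R c E \<in> sets \<mu>" if "c \<in> sphere 0 1" "E \<in> sets \<mu>" for c E
    unfolding R_def by (rule rotate_vimage_sets[OF that])
  have sets: "Fs n \<in> sets \<mu> \<and> Gs n \<in> sets \<mu>" for n
  proof (induction n)
    case 0
    then show ?case using F G by (simp add: P0)
  next
    case (Suc n)
    then have "w n \<in> sphere 0 1" using W[of "P n"] by (simp add: w_def Fs_def Gs_def)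
    then show ?case unfolding PS A_def B_def
      using Suc by (auto intro!: sets.Diff sets.Int R_sets simp del: mem_sphere_0)
  qed
  have w: "w n \<in> sphere 0 1" "measure \<mu> (Fs n) * measure \<mu> (Gs n) / 2 \<le> measure \<mu> (A n)" for n
    using W[of "P n"] sets[of n] by (simp_all add: w_def Fs_def Gs_def A_def)
  have cw: "cnj (w n) \<in> sphere 0 1" for n using w(1)[of n] by simp
  have A_sets: "A n \<in> sets \<mu>" for n unfolding A_def using sets w(1) by (intro sets.Int R_sets) auto
  have B_sets: "B n \<in> sets \<mu>" for n unfolding B_def by (rule R_sets[OF cw A_sets])
  have AF: "A n \<subseteq> Fs n" for n by (auto simp: A_def)
  have BG: "B n \<subseteq> Gs n" for n
  proof
    fix z assume "z \<in> B n"
    then have "w n * (cnj (w n) * z) \<in> Gs n" by (simp add: A_def B_def R_def)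
    then show "z \<in> Gs n" by (simp only: unit_cnj_mult(2)[OF w(1)])
  qed
  have dec: "decseq Fs" "decseq Gs" by (auto simp: PS intro!: decseq_SucI)
  have AsubF: "A n \<subseteq> F" for n using AF[of n] decseqD[OF dec(1), of 0 n] by (auto simp: P0)
  have BsubG: "B n \<subseteq> G" for n using BG[of n] decseqD[OF dec(2), of 0 n] by (auto simp: P0)
  have Auniq: "m = n" if "z \<in> A m" "z \<in> A n" for m n z
  proof -
    have "\<not> m < n" if "z \<in> A m" "z \<in> A n" for m n
      using that decseqD[OF dec(1), of "Suc m" n] AF[of n] by (auto simp: PS Suc_le_eq)
    then show ?thesis using that by (metis linorder_neqE_nat)
  qed
  have Buniq: "m = n" if "z \<in> B m" "z \<in> B n" for m n z
  proof -
    have "\<not> m < n" if "z \<in> B m" "z \<in> B n" for m n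
      using that decseqD[OF dec(2), of "Suc m" n] BG[of n] by (auto simp: PS Suc_le_eq)
    then show ?thesis using that by (metis linorder_neqE_nat)
  qed
  have mB: "measure \<mu> (B n) = measure \<mu> (A n)" for n
    unfolding B_def R_def by (rule measure_rotate_vimage[OF cw A_sets])
  have mF: "measure \<mu> (Fs (Suc n)) = measure \<mu> (Fs n) - measure \<mu> (A n)" for n
    unfolding PS using sets A_sets AF by (intro circle.finite_measure_Diff) auto
  have mG: "measure \<mu> (Gs (Suc n)) = measure \<mu> (Gs n) - measure \<mu> (A n)" for n
    unfolding PS mB[symmetric] using sets B_sets BG by (intro circle.finite_measure_Diff) auto
  have half: "measure \<mu> (Fs n) + 1 / 2 \<le> measure \<mu> (Gs n)" for n
    by (induction n) (use large in \<open>auto simp: P0 mF mG\<close>)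
  \<comment> \<open>As at least measure 1 / 2 is left of G, each round removes at least a quarter of
    what is left of F; hence the ratio 3 / 4.\<close>
  have small: "measure \<mu> (Fs n) \<le> (3 / 4) ^ n" for n
  proof (induction n)
    case (Suc n)
    have "measure \<mu> (Fs n) * (1 / 2) \<le> measure \<mu> (Fs n) * measure \<mu> (Gs n)"
      using half[of n] measure_nonneg[of \<mu> "Fs n"] by (intro mult_left_mono) linarith+
    then have "measure \<mu> (Fs (Suc n)) \<le> 3 / 4 * measure \<mu> (Fs n)" using w(2)[of n] mF[of n] by simp
    then show ?case using Suc by simp
  qed simp
  have "(\<lambda>n. (3 / 4) ^ n :: real) \<longlonglongrightarrow> 0" by (intro LIMSEQ_power_zero) simp
  then have lim: "(\<lambda>n. measure \<mu> (Fs n)) \<longlonglongrightarrow> 0"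
    by (rule tendsto_sandwich[OF _ _ tendsto_const, rotated 2]) (use small in auto)
  \<comment> \<open>Points of F that are never reached stay fixed. They form a null set, hence the
    almost everywhere conclusion.\<close>
  define v where "v z = (if \<exists>n. z \<in> A n then w (THE n. z \<in> A n)
      else if \<exists>n. z \<in> B n then cnj (w (THE n. z \<in> B n)) else 1)" for z
  have vA: "v z = w n" if "z \<in> A n" for z n
  proof -
    have "(THE n. z \<in> A n) = n" using that Auniq by blast
    then show ?thesis using that by (auto simp: v_def)
  qed
  have vB: "v z = cnj (w n)" if "z \<in> B n" for z n
  proof -
    have "(THE n. z \<in> B n) = n" using that Buniq by blast
    moreover have "z \<notin> A m" for m using that AsubF[of m] BsubG[of n] disj by blast
    ultimately show ?thesis using that by (auto simp: v_def)
  qed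
  have v1: "v z = 1" if "\<And>n. z \<notin> A n" "\<And>n. z \<notin> B n" for z
    using that by (simp add: v_def)
  have AB: "w n * z \<in> B n" if "z \<in> A n" for z n
  proof -
    have "cmod z = 1" using that sets.sets_into_space[OF A_sets[of n]] by auto
    then show ?thesis
      using that w(1)[of n] by (simp add: B_def R_def norm_mult unit_cnj_mult(1)[OF w(1)])
  qed
  have BA: "cnj (w n) * z \<in> A n" if "z \<in> B n" for z n
    using that by (simp add: B_def R_def)
  have "circle_automorphism (\<lambda>z. v z * z)"
  proof (rule circle_automorphism_rotations[of "{1} \<union> range w \<union> cnj ` range w"])
    show "v z \<in> {1} \<union> range w \<union> cnj ` range w" for z
      using vA[of z] vB[of z] v1[of z] by blast
    show "v (v z * z) = cnj (v z)" for z
    proof (cases "\<exists>n. z \<in> A n")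
      case True
      then obtain n where n: "z \<in> A n" ..
      then show ?thesis using vA[OF n] vB[OF AB[OF n]] by simp
    next
      case False
      show ?thesis
      proof (cases "\<exists>n. z \<in> B n")
        case True
        then obtain n where n: "z \<in> B n" ..
        then show ?thesis using vB[OF n] vA[OF BA[OF n]] by simp
      qed (use False v1 in simp)
    qed
    show "{z \<in> space \<mu>. v z = c} \<in> sets \<mu>" for c
    proof -
      have "{z \<in> space \<mu>. v z = c} = (\<Union>n\<in>{n. w n = c}. A n) \<union> (\<Union>n\<in>{n. cnj (w n) = c}. B n)
          \<union> {z \<in> space \<mu> - (\<Union>n. A n) - (\<Union>n. B n). c = 1}" (is "?L = ?R")
      proof (intro equalityI subsetI)
        fix z assume "z \<in> ?L"
        then have z: "z \<in> space \<mu>" "v z = c" by auto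
        consider n where "z \<in> A n" | n where "z \<in> B n" | "\<forall>n. z \<notin> A n \<and> z \<notin> B n" by blast
        then show "z \<in> ?R"
        proof cases
          case (1 n)
          then have "w n = c" using vA z(2) by metis
          then show ?thesis using 1 by blast
        next
          case (2 n)
          then have "cnj (w n) = c" using vB z(2) by metis
          then show ?thesis using 2 by blast
        next
          case 3
          then have "c = 1" using v1 z(2) by metis
          then show ?thesis using 3 z(1) by simp
        qed
      next
        fix z assume z: "z \<in> ?R"
        consider n where "z \<in> A n" "w n = c" | n where "z \<in> B n" "cnj (w n) = c"
          | "c = 1" "z \<in> space \<mu>" "\<forall>n. z \<notin> A n \<and> z \<notin> B n"
          using z by blast
        then show "z \<in> ?L"
        proof cases
          case (1 n)
          then show ?thesis using vA[OF 1(1)] sets.sets_into_space[OF A_sets[of n]] by auto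
        next
          case (2 n)
          then show ?thesis using vB[OF 2(1)] sets.sets_into_space[OF B_sets[of n]] by auto
        next
          case 3
          then show ?thesis using v1[of z] by auto
        qed
      qed
      also have "\<dots> \<in> sets \<mu>" using A_sets B_sets
        by (intro sets.Un sets.countable_UN'' sets.sets_Collect_conj) (auto simp del: space_circle)
      finally show ?thesis .
    qed
    show "{1} \<union> range w \<union> cnj ` range w \<subseteq> sphere 0 1" using w(1) by auto
  qed (auto simp: image_iff)
  moreover have "AE z in \<mu>. z \<in> F \<longrightarrow> v z * z \<in> G"
  proof -
    have "AE z in \<mu>. \<exists>n. z \<notin> Fs n"
      by (rule AE_not_in_limit[OF dec(1) _ lim]) (use sets in auto)
    then show ?thesis
    proof eventually_elim
      case (elim z)
      then obtain n where n: "z \<notin> Fs n" by blast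
      show ?case
      proof
        assume "z \<in> F"
        then have "z \<in> Fs m" if "\<forall>k<m. z \<notin> A k" for m
          using that by (induction m) (auto simp: P0 PS)
        then obtain k where "z \<in> A k" using n by blast
        then show "v z * z \<in> G" using vA AB BsubG by (metis subsetD)
      qed
    qed
  qed
  ultimately show thesis by (rule that)
qed

section \<open>Definiteness of symmetric gauges\<close>

context rot_gauge
begin

lemma null_set_small_complement:
  assumes E: "E \<in> sets \<mu>" "\<alpha> (indicator E) = 0"
  shows "\<exists>G \<in> sets \<mu>. \<alpha> (indicator G) = 0 \<and> measure \<mu> (space \<mu> - G) \<le> (1 - measure \<mu> E / 2) ^ n"
proof (induction n)
  case 0
  show ?case using E circle.prob_le_1 by (intro bexI[of _ E]) auto
next
  case (Suc n)
  then obtain G where G: "G \<in> sets \<mu>" "\<alpha> (indicator G) = 0" "measure \<mu> (space \<mu> - G) \<le> (1 - measure \<mu> E / 2) ^ n"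
    by blast
  let ?F = "space \<mu> - G"
  have F: "?F \<in> sets \<mu>" using G by blast
  obtain w where w: "w \<in> sphere 0 1"
    "measure \<mu> ?F * measure \<mu> E / 2 \<le> measure \<mu> (?F \<inter> ((\<lambda>z. w * z) -` E \<inter> space \<mu>))"
    using exists_rotation_overlap[OF F E(1)] by blast
  define H where "H = (\<lambda>z. w * z) -` E \<inter> space \<mu>"
  have Es: "H \<in> sets \<mu>" unfolding H_def by (rule rotate_vimage_sets[OF w(1) E(1)])
  have "\<alpha> (indicator H) = \<alpha> (\<lambda>z. indicator E (w * z))"
    using Linf_rotate[OF Linf_indicator[OF E(1)] w(1)] Es
    by (intro gauge_cong AE_I2) (auto simp: H_def indicator_def)
  also have "\<dots> = \<alpha> (indicator E)"
    using gauge_rotate[OF Linf_indicator[OF E(1)], of "cnj w"] w(1) by simp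
  finally have \<alpha>E: "\<alpha> (indicator H) = 0" using E(2) by simp
  have "\<alpha> (indicator (G \<union> H)) \<le> \<alpha> (\<lambda>z. indicator G z + indicator H z)"
    using G(1) Es by (intro gauge_mono Linf_add Linf_indicator AE_I2) (auto split: split_indicator)
  also have "\<dots> \<le> \<alpha> (indicator G) + \<alpha> (indicator H)"
    using G(1) Es by (intro gauge_add) auto
  finally have "\<alpha> (indicator (G \<union> H)) = 0" using G(2) \<alpha>E by simp
  moreover have "measure \<mu> (space \<mu> - (G \<union> H)) \<le> (1 - measure \<mu> E / 2) ^ Suc n"
  proof -
    have "measure \<mu> (space \<mu> - (G \<union> H)) = measure \<mu> (?F - (?F \<inter> H))"
      by (intro arg_cong[of _ _ "measure \<mu>"]) auto
    also have "\<dots> = measure \<mu> ?F - measure \<mu> (?F \<inter> H)"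
      using F Es by (intro circle.finite_measure_Diff) auto
    also have "\<dots> \<le> measure \<mu> ?F * (1 - measure \<mu> E / 2)" using w(2)[folded H_def] by (simp add: algebra_simps)
    also have "\<dots> \<le> (1 - measure \<mu> E / 2) ^ n * (1 - measure \<mu> E / 2)"
      by (intro mult_right_mono G(3)) (use circle.prob_le_1[of E] in linarith)
    finally show ?thesis by (simp add: mult.commute)
  qed
  moreover have "G \<union> H \<in> sets \<mu>" using G(1) Es by blast
  ultimately show ?case by blast
qed

end

text \<open>A set of gauge 0 and positive measure would yield one, G, with small complement. An
  automorphism carries this complement into G, so by symmetry it has gauge 0 as well, against the
  value 1 at the constant 1.\<close>

lemma sym_gauge_definite:
  assumes sym: "\<alpha> \<in> sym_gauge_seminorms" and E: "E \<in> sets \<mu>" "\<alpha> (indicator E) = 0"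
  shows "measure \<mu> E = 0"
proof (rule ccontr)
  interpret rot_gauge \<alpha> using sym by unfold_locales (simp add: sym_gauge_seminorms_def)
  assume "measure \<mu> E \<noteq> 0"
  then have "0 \<le> 1 - measure \<mu> E / 2" "1 - measure \<mu> E / 2 < 1"
    using circle.prob_le_1[of E] measure_nonneg[of \<mu> E] by linarith+
  then have "(\<lambda>n. (1 - measure \<mu> E / 2) ^ n) \<longlonglongrightarrow> 0" by (intro LIMSEQ_realpow_zero)
  \<comment> \<open>The bound 1 / 4 meets the requirement of \<open>automorphism_into\<close>: G
    then has measure above 3 / 4, hence exceeds its complement by at least 1 / 2.\<close>
  then have "\<forall>\<^sub>F n in sequentially. (1 - measure \<mu> E / 2) ^ n < 1 / 4"
    by (rule order_tendstoD) simp
  then have "\<exists>n. (1 - measure \<mu> E / 2) ^ n < 1 / 4"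
    by (auto simp: eventually_sequentially)
  then obtain G where G: "G \<in> sets \<mu>" "\<alpha> (indicator G) = 0" "measure \<mu> (space \<mu> - G) < 1 / 4"
    using null_set_small_complement[OF E] by (meson le_less_trans)
  let ?F = "space \<mu> - G"
  have F: "?F \<in> sets \<mu>" using G by blast
  have "measure \<mu> ?F = 1 - measure \<mu> G" using circle.prob_compl[OF G(1)] .
  then have large: "measure \<mu> ?F + 1 / 2 \<le> measure \<mu> G" using G(3) by linarith
  have "?F \<inter> G = {}" by blast
  then obtain \<phi> where \<phi>: "circle_automorphism \<phi>" "AE z in \<mu>. z \<in> ?F \<longrightarrow> \<phi> z \<in> G"
    using automorphism_into[OF F G(1) _ large] by blast
  have \<phi>G: "indicator G \<circ> \<phi> \<in> (Linf :: (complex \<Rightarrow> complex) set)"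
  proof -
    have "\<phi> \<in> measurable \<mu> \<mu>" using \<phi>(1) by (simp add: circle_automorphism_def)
    from measurable_compose[OF this borel_measurable_indicator[OF G(1)]]
    show ?thesis unfolding comp_def by (intro LinfI[of _ 1]) (auto split: split_indicator)
  qed
  have "\<alpha> (indicator ?F) \<le> \<alpha> (indicator G \<circ> \<phi>)"
  proof (rule gauge_mono[OF Linf_indicator[OF F] \<phi>G])
    show "AE z in \<mu>. cmod (indicator ?F z) \<le> cmod ((indicator G \<circ> \<phi>) z)"
      using \<phi>(2) by eventually_elim (auto split: split_indicator)
  qed
  also have "\<dots> = \<alpha> (indicator G)"
    using sym \<phi>(1) Linf_indicator[OF G(1)] unfolding sym_gauge_seminorms_def by blast
  finally have \<alpha>F: "\<alpha> (indicator ?F) = 0" using G(2) by simp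
  have "1 = \<alpha> (\<lambda>z. indicator G z + indicator ?F z)"
    unfolding gauge_one[symmetric]
    using G F by (intro gauge_cong Linf_add Linf_indicator) (auto intro!: AE_I2 split: split_indicator)
  also have "\<dots> \<le> \<alpha> (indicator G) + \<alpha> (indicator ?F)" using G F by (intro gauge_add) auto
  finally show False using G(2) \<alpha>F by simp
qed

section \<open>Continuity from reflexivity\<close>

lemma generalized_limit:
  obtains L :: "(nat \<Rightarrow> complex) \<Rightarrow> complex" and C :: real
  where "\<And>x y. Bseq x \<Longrightarrow> Bseq y \<Longrightarrow> L (\<lambda>n. x n + y n) = L x + L y"
    and "\<And>c x. Bseq x \<Longrightarrow> L (\<lambda>n. c * x n) = c * L x"
    and "0 < C" "\<And>x B. (\<And>n. cmod (x n) \<le> B) \<Longrightarrow> cmod (L x) \<le> C * B"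
    and "\<And>x. x \<longlonglongrightarrow> 0 \<Longrightarrow> L x = 0" and "L (\<lambda>_. 1) \<noteq> 0"
proof -
  define V where "V = {x :: nat \<Rightarrow> complex. Bseq x}"
  define N where "N x = (SUP n. ennreal (cmod (x n)))" for x :: "nat \<Rightarrow> complex"
  have N_le: "N x \<le> ennreal B" if "\<And>n. cmod (x n) \<le> B" for x B
    unfolding N_def using that by (auto intro!: SUP_least ennreal_leI)
  have N_ge: "ennreal (cmod (x n)) \<le> N x" for x n unfolding N_def by (rule SUP_upper) simp
  interpret V: seminormed_functions V N
  proof
    show "N f < \<infinity>" if "f \<in> V" for f
    proof -
      obtain B where "\<And>n. cmod (f n) \<le> B" using \<open>f \<in> V\<close> by (auto simp: V_def Bseq_def)
      then have "N f \<le> ennreal B" by (rule N_le)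
      also have "\<dots> < \<infinity>" by simp
      finally show ?thesis .
    qed
    show "N (\<lambda>n. f n + g n) \<le> N f + N g" for f g
      unfolding N_def[of "\<lambda>n. f n + g n"]
    proof (rule SUP_least)
      fix n
      have "ennreal (cmod (f n + g n)) \<le> ennreal (cmod (f n)) + ennreal (cmod (g n))"
        by (simp add: norm_triangle_ineq ennreal_leI flip: ennreal_plus)
      also have "\<dots> \<le> N f + N g" by (intro add_mono N_ge)
      finally show "ennreal (cmod (f n + g n)) \<le> N f + N g" .
    qed
    show "N (\<lambda>n. c * f n) = ennreal (cmod c) * N f" for c f
      unfolding N_def SUP_mult_left_ennreal by (intro SUP_cong) (auto simp: norm_mult ennreal_mult)
    show "(\<lambda>n. f n + g n) \<in> V" if fg: "f \<in> V" "g \<in> V" for f g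
    proof -
      obtain A B where "\<And>n. cmod (f n) \<le> A" "\<And>n. cmod (g n) \<le> B"
        using fg by (auto simp: V_def Bseq_def)
      then have "Bseq (\<lambda>n. f n + g n)" by (intro BseqI'[of _ "A + B"] norm_triangle_mono)
      then show ?thesis by (simp add: V_def)
    qed
  qed (auto simp: V_def Bseq_mult)
  have "\<exists>L \<in> dual_space V N. (\<forall>x \<in> {x. x \<longlonglongrightarrow> 0}. L x = 0) \<and> L (\<lambda>_. 1) \<noteq> 0"
  \<comment> \<open>The constant 1 has distance at least 1 from the null sequences, since |1 - x n|
    tends to 1.\<close>
  proof (rule V.separate_point[where d = 1])
    show "{x. x \<longlonglongrightarrow> 0} \<subseteq> V" by (auto simp: V_def intro: convergent_imp_Bseq convergentI)
    show "(\<lambda>n. x n + y n) \<in> {x. x \<longlonglongrightarrow> 0}" if "x \<in> {x. x \<longlonglongrightarrow> 0}" "y \<in> {x. x \<longlonglongrightarrow> 0}" for x y :: "nat \<Rightarrow> complex"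
      using that tendsto_add[of x 0 sequentially y 0] by simp
    show "(\<lambda>n. c * x n) \<in> {x. x \<longlonglongrightarrow> 0}" if "x \<in> {x. x \<longlonglongrightarrow> 0}" for c and x :: "nat \<Rightarrow> complex"
      using that tendsto_mult_left[of x 0 sequentially c] by simp
    show "ennreal 1 \<le> N (\<lambda>n. 1 - x n)" if "x \<in> {x. x \<longlonglongrightarrow> 0}" for x
    proof -
      have "(\<lambda>n. ennreal (cmod (1 - x n))) \<longlonglongrightarrow> ennreal (cmod (1 - 0))"
        using that by (intro tendsto_ennrealI tendsto_norm tendsto_diff tendsto_const) simp
      then show ?thesis using N_ge[of "\<lambda>n. 1 - x n"] by (intro LIMSEQ_le_const2[of "\<lambda>n. ennreal (cmod (1 - x n))"]) auto
    qed
  qed (auto simp: V_def)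
  then obtain L where L: "L \<in> dual_space V N" "\<And>x. x \<longlonglongrightarrow> 0 \<Longrightarrow> L x = 0" "L (\<lambda>_. 1) \<noteq> 0"
    by blast
  obtain C where C: "0 < C" "\<And>x. x \<in> V \<Longrightarrow> cmod (L x) \<le> C * enn2real (N x)"
    using V.dual_bound[OF L(1)] by blast
  show thesis
  proof (rule that[of L C])
    show "L (\<lambda>n. x n + y n) = L x + L y" if "Bseq x" "Bseq y" for x y
      using V.dual_add[OF L(1)] that by (simp add: V_def)
    show "L (\<lambda>n. c * x n) = c * L x" if "Bseq x" for c x
      using V.dual_scale[OF L(1)] that by (simp add: V_def)
    show "cmod (L x) \<le> C * B" if x: "\<And>n. cmod (x n) \<le> B" for x B
    proof -
      have "x \<in> V" using x by (auto simp: V_def intro: BseqI')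
      moreover have "0 \<le> B" using x[of 0] norm_ge_zero order_trans by blast
      then have "enn2real (N x) \<le> B" using N_le[OF x] by (intro enn2real_leI)
      then have "C * enn2real (N x) \<le> C * B" using C(1) by simp
      ultimately show ?thesis using C(2) order_trans by blast
    qed
  qed (use L C in auto)
qed

context rot_gauge
begin

text \<open>As in Chebyshev's inequality, c times the indicator of the set where |f| \<ge> c lies
  below |f|. These sets have gauge 0, hence measure 0, for every c = 1 / (n + 1).\<close>

lemma definite_gauge_ext_eq_0:
  assumes definite: "\<And>E. E \<in> sets \<mu> \<Longrightarrow> \<alpha> (indicator E) = 0 \<Longrightarrow> measure \<mu> E = 0"
    and f: "f \<in> borel_measurable \<mu>" "gauge_ext \<alpha> f = 0"
  shows "AE z in \<mu>. f z = 0"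
proof -
  note [measurable] = f(1)
  have "AE z in \<mu>. cmod (f z) < 1 / real (Suc n)" for n
  proof -
    define c where "c = 1 / real (Suc n)"
    have c: "0 < c" by (simp add: c_def)
    let ?E = "{z \<in> space \<mu>. c \<le> cmod (f z)}"
    have E: "?E \<in> sets \<mu>" by measurable
    let ?s = "\<lambda>z. complex_of_real c * indicator ?E z"
    have s: "?s \<in> Linf" using E by (intro Linf_mult Linf_const Linf_indicator)
    have "\<alpha> ?s \<le> gauge_ext \<alpha> f"
      by (rule gauge_ext_upper[OF s]) (use c in \<open>auto intro!: AE_I2 split: split_indicator\<close>)
    then have "ennreal c * \<alpha> (indicator ?E) = 0"
      using gauge_scale[OF Linf_indicator[OF E], of "complex_of_real c"] f(2) c by simp
    then have "\<alpha> (indicator ?E) = 0" using c by simp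
    then have "measure \<mu> ?E = 0" by (rule definite[OF E])
    then have "?E \<in> null_sets \<mu>" using E by (simp add: null_sets_def circle.emeasure_eq_measure)
    then have "AE z in \<mu>. z \<notin> ?E" by (rule AE_not_in)
    then show ?thesis unfolding c_def[symmetric] using AE_space by eventually_elim auto
  qed
  then have "AE z in \<mu>. \<forall>n. cmod (f z) < 1 / real (Suc n)" by (simp add: AE_all_countable)
  then show ?thesis
  proof eventually_elim
    case (elim z)
    then show ?case using reals_Archimedean[of "cmod (f z)"] by (metis inverse_eq_divide less_asym zero_less_norm_iff)
  qed
qed

text \<open>If \<open>\<alpha> (indicator (F n))\<close> stays away from \<open>0\<close> while \<open>F n\<close> shrinks to a null set, a generalized
  limit of the evaluations at \<open>indicator (F n)\<close> is an element of the bidual that could only come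
  from a function vanishing off every \<open>F n\<close>.\<close>

lemma reflexive_continuous:
  assumes definite: "\<And>E. E \<in> sets \<mu> \<Longrightarrow> \<alpha> (indicator E) = 0 \<Longrightarrow> measure \<mu> E = 0"
    and refl: "reflexive_space (Lgauge \<alpha>) (gauge_ext \<alpha>)"
  shows "gauge_continuous \<alpha>"
proof (rule ccontr)
  let ?D = "dual_space (Lgauge \<alpha>) (gauge_ext \<alpha>)" and ?n = "dual_norm (Lgauge \<alpha>) (gauge_ext \<alpha>)"
  assume "\<not> gauge_continuous \<alpha>"
  then obtain F :: "nat \<Rightarrow> complex set" and e :: real where F: "0 < e" "decseq F" "range F \<subseteq> sets \<mu>"
    "(\<lambda>n. measure \<mu> (F n)) \<longlonglongrightarrow> 0" "\<And>n. ennreal e \<le> \<alpha> (indicator (F n))"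
    by (rule not_continuousE) blast
  have Fs: "F n \<in> sets \<mu>" for n using F(3) by auto
  have FV: "indicator (F n) \<in> Lgauge \<alpha>" for n using Fs by (intro Linf_Lgauge Linf_indicator)
  have F1: "gauge_ext \<alpha> (indicator (F n)) \<le> 1" for n
    using gauge_mono[OF Linf_indicator[OF Fs] Linf_const[of 1], of n] Fs[of n] gauge_one
    by (auto split: split_indicator)
  \<comment> \<open>The functional at which the contradiction will appear: it takes the same nonzero
    value at every indicator of F n, so the generalized limit of these values is not 0.\<close>
  obtain \<phi> where \<phi>: "\<phi> \<in> ?D" "\<phi> (\<lambda>_. 1) \<noteq> 0" "\<And>n. \<phi> (indicator (F n)) = \<phi> (\<lambda>_. 1)"
    by (rule singular_functional[OF Lgauge.seminormed_functions_axioms _ _ F(1,2,3,5)])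
      (use Lgauge_Lcal Linf_Lgauge in blast)+
  obtain L :: "(nat \<Rightarrow> complex) \<Rightarrow> complex" and C :: real where
    L_add: "\<And>x y. Bseq x \<Longrightarrow> Bseq y \<Longrightarrow> L (\<lambda>n. x n + y n) = L x + L y" and
    L_scale: "\<And>c x. Bseq x \<Longrightarrow> L (\<lambda>n. c * x n) = c * L x" and
    C: "0 < C" and L_bound: "\<And>x B. (\<And>n. cmod (x n) \<le> B) \<Longrightarrow> cmod (L x) \<le> C * B" and
    L_null: "\<And>x. x \<longlonglongrightarrow> 0 \<Longrightarrow> L x = 0" and L_1: "L (\<lambda>_. 1) \<noteq> 0"
    by (rule generalized_limit) blast
  define E where "E \<psi> n = \<psi> (indicator (F n))" for \<psi> :: "(complex \<Rightarrow> complex) \<Rightarrow> complex" and n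
  have E_norm: "ennreal (cmod (E \<psi> n)) \<le> ?n \<psi>" for \<psi> n
    unfolding E_def by (rule Lgauge.dual_norm_upper[OF FV F1])
  have n_fin: "?n \<psi> < \<infinity>" if \<psi>: "\<psi> \<in> ?D" for \<psi>
  proof -
    obtain B where B: "0 < B" "\<And>f. f \<in> Lgauge \<alpha> \<Longrightarrow> cmod (\<psi> f) \<le> B * enn2real (gauge_ext \<alpha> f)"
      using Lgauge.dual_bound[OF \<psi>] by blast
    have "ennreal (cmod (\<psi> f)) \<le> ennreal B" if "f \<in> Lgauge \<alpha>" "gauge_ext \<alpha> f \<le> 1" for f
    proof -
      have "enn2real (gauge_ext \<alpha> f) \<le> 1" using that(2) by (intro enn2real_leI) auto
      then have "B * enn2real (gauge_ext \<alpha> f) \<le> B" using B(1) by simp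
      then show ?thesis using B(2)[OF that(1)] by (intro ennreal_leI) linarith
    qed
    then have "?n \<psi> \<le> ennreal B" unfolding dual_norm_def by (auto intro: SUP_least)
    then show ?thesis by (simp add: le_less_trans)
  qed
  have E_le: "cmod (E \<psi> n) \<le> enn2real (?n \<psi>)" if "\<psi> \<in> ?D" for \<psi> n
    using enn2real_mono[OF E_norm n_fin[OF that, unfolded infinity_ennreal_def], of n] by simp
  have E_Bseq: "Bseq (E \<psi>)" if "\<psi> \<in> ?D" for \<psi> by (rule BseqI'[OF E_le[OF that]])
  define \<Phi> where "\<Phi> \<psi> = (if \<psi> \<in> ?D then L (E \<psi>) else 0)" for \<psi>
  have "\<Phi> \<in> dual_space ?D ?n"
    unfolding dual_space_def[of ?D]
  proof (intro CollectI conjI ballI allI impI exI[of _ C])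
    fix \<psi> \<eta> assume *: "\<psi> \<in> ?D" "\<eta> \<in> ?D"
    have "E (\<lambda>f. \<psi> f + \<eta> f) = (\<lambda>n. E \<psi> n + E \<eta> n)" by (intro ext) (simp add: E_def)
    then show "\<Phi> (\<lambda>f. \<psi> f + \<eta> f) = \<Phi> \<psi> + \<Phi> \<eta>"
      using * L_add[OF E_Bseq E_Bseq] Lgauge.dual_space_add[OF *] by (simp add: \<Phi>_def)
  next
    fix \<psi> c assume *: "\<psi> \<in> ?D"
    have "E (\<lambda>f. c * \<psi> f) = (\<lambda>n. c * E \<psi> n)" by (intro ext) (simp add: E_def)
    then show "\<Phi> (\<lambda>f. c * \<psi> f) = c * \<Phi> \<psi>"
      using * L_scale[OF E_Bseq] Lgauge.dual_space_scale[OF *] by (simp add: \<Phi>_def)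
  next
    fix \<psi> assume *: "\<psi> \<in> ?D"
    have "ennreal (cmod (L (E \<psi>))) \<le> ennreal (C * enn2real (?n \<psi>))"
      by (intro ennreal_leI L_bound E_le *)
    also have "\<dots> = ennreal C * ?n \<psi>" using C n_fin[OF *] by (simp add: ennreal_mult)
    finally show "ennreal (cmod (\<Phi> \<psi>)) \<le> ennreal C * ?n \<psi>" using * by (simp add: \<Phi>_def)
  qed (simp add: \<Phi>_def)
  then obtain f where f: "f \<in> Lgauge \<alpha>" "\<And>\<psi>. \<psi> \<in> ?D \<Longrightarrow> \<Phi> \<psi> = \<psi> f"
    using refl unfolding reflexive_space_def by blast
  \<comment> \<open>A functional that norms the restriction of f is localized to the complement of F
    n. It kills the indicators of F k for k \<ge> n, so \<Phi> vanishes at it, although its value at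
    f is the gauge of f off F n.\<close>
  have off: "AE z in \<mu>. f z * indicator (space \<mu> - F n) z = 0" for n
  proof (rule definite_gauge_ext_eq_0[OF definite])
    let ?A = "space \<mu> - F n"
    have A: "?A \<in> sets \<mu>" using Fs by blast
    have fA: "(\<lambda>z. f z * indicator ?A z) \<in> Lgauge \<alpha>" by (rule Lgauge_mult_indicator[OF f(1) A])
    then show "(\<lambda>z. f z * indicator ?A z) \<in> borel_measurable \<mu>" using Lgauge_Lcal Lcal_measurable by blast
    obtain \<psi> where \<psi>: "\<psi> \<in> ?D" "\<psi> (\<lambda>z. f z * indicator ?A z) = enn2real (gauge_ext \<alpha> (\<lambda>z. f z * indicator ?A z))"
      using Lgauge.norming_functional[OF fA] by blast
    obtain B where B: "0 < B" "\<And>f. f \<in> Lgauge \<alpha> \<Longrightarrow> cmod (\<psi> f) \<le> B * enn2real (gauge_ext \<alpha> f)"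
      using Lgauge.dual_bound[OF \<psi>(1)] by blast
    define \<psi>' where "\<psi>' g = (if g \<in> Lgauge \<alpha> then \<psi> (\<lambda>z. g z * indicator ?A z) else 0)" for g
    have \<psi>': "\<psi>' \<in> ?D"
      unfolding \<psi>'_def
    proof (rule Lgauge.dual_spaceI)
      note mi = Lgauge_mult_indicator[OF _ A]
      show "\<psi> (\<lambda>z. (g z + h z) * indicator ?A z) = \<psi> (\<lambda>z. g z * indicator ?A z) + \<psi> (\<lambda>z. h z * indicator ?A z)"
        if "g \<in> Lgauge \<alpha>" "h \<in> Lgauge \<alpha>" for g h
        unfolding distrib_right by (rule Lgauge.dual_add[OF \<psi>(1) mi[OF that(1)] mi[OF that(2)]])
      show "\<psi> (\<lambda>z. c * g z * indicator ?A z) = c * \<psi> (\<lambda>z. g z * indicator ?A z)" if "g \<in> Lgauge \<alpha>" for c g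
        unfolding mult.assoc by (rule Lgauge.dual_scale[OF \<psi>(1) mi[OF that]])
      show "cmod (\<psi> (\<lambda>z. g z * indicator ?A z)) \<le> B * enn2real (gauge_ext \<alpha> g)" if g: "g \<in> Lgauge \<alpha>" for g
      proof -
        have "gauge_ext \<alpha> (\<lambda>z. g z * indicator ?A z) \<le> gauge_ext \<alpha> g"
          by (intro gauge_ext_mono) (auto split: split_indicator)
        then have "enn2real (gauge_ext \<alpha> (\<lambda>z. g z * indicator ?A z)) \<le> enn2real (gauge_ext \<alpha> g)"
          using Lgauge.seminorm_finite[OF g] by (intro enn2real_mono) auto
        then have "B * enn2real (gauge_ext \<alpha> (\<lambda>z. g z * indicator ?A z)) \<le> B * enn2real (gauge_ext \<alpha> g)"
          using B(1) by simp
        then show ?thesis using B(2)[OF mi[OF g]] by linarith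
      qed
    qed (use B in simp)
    have "E \<psi>' k = 0" if "n \<le> k" for k
    proof -
      have "(\<lambda>z. indicator (F k) z * indicator ?A z) = (\<lambda>_. 0 :: complex)"
        using decseqD[OF F(2) that] by (intro ext) (auto split: split_indicator)
      then show ?thesis using FV[of k] Lgauge.dual_zero[OF \<psi>(1)] by (simp add: E_def \<psi>'_def)
    qed
    then have "E \<psi>' \<longlonglongrightarrow> 0" by (intro tendsto_eventually eventually_sequentiallyI[of n]) auto
    then have "\<psi>' f = 0" using f(2)[OF \<psi>'] \<psi>' L_null by (simp add: \<Phi>_def)
    then have "enn2real (gauge_ext \<alpha> (\<lambda>z. f z * indicator ?A z)) = 0" using f(1) \<psi>(2) by (simp add: \<psi>'_def)
    then show "gauge_ext \<alpha> (\<lambda>z. f z * indicator ?A z) = 0"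
      using Lgauge.ennreal_real[OF fA] by simp
  qed
  have "AE z in \<mu>. f z = 0"
  proof -
    have "AE z in \<mu>. \<forall>n. f z * indicator (space \<mu> - F n) z = 0"
      unfolding AE_all_countable using off by blast
    then show ?thesis using AE_not_in_limit[OF F(2,3,4)] AE_space
    proof eventually_elim
      case (elim z)
      then obtain n where "z \<notin> F n" by blast
      then show ?case using elim(1,3) by (auto dest: spec[of _ n])
    qed
  qed
  then have "\<phi> f = \<phi> (\<lambda>_. 0)"
    by (intro dual_space_AE_cong[OF \<phi>(1) f(1) Lgauge.zero_closed _ Lgauge.seminormed_functions_axioms])
  then have "\<phi> f = 0" using Lgauge.dual_zero[OF \<phi>(1)] by simp
  \<comment> \<open>The two values of \<phi> f clash: 0, because f vanishes almost everywhere, and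
    the nonzero generalized limit of a constant sequence.\<close>
  moreover have "\<phi> f = \<phi> (\<lambda>_. 1) * L (\<lambda>_. 1)"
  proof -
    have "E \<phi> = (\<lambda>n. \<phi> (\<lambda>_. 1) * 1)" using \<phi>(3) by (auto simp: E_def)
    then have "L (E \<phi>) = \<phi> (\<lambda>_. 1) * L (\<lambda>_. 1)"
      using L_scale[of "\<lambda>_. 1" "\<phi> (\<lambda>_. 1)"] by (simp add: Bseq_def)
    then show ?thesis using f(2)[OF \<phi>(1)] \<phi>(1) by (simp add: \<Phi>_def)
  qed
  ultimately show False using \<phi>(2) L_1 by simp
qed

end

text \<open>Functions are not identified modulo null sets, so uniqueness of h takes the form of an
  almost everywhere equality. Integrability is asserted separately, because the integral of a
  function that is not integrable is 0 by convention.\<close>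

theorem proposition3p2:
  fixes \<alpha> :: "(complex \<Rightarrow> complex) \<Rightarrow> ennreal"
  assumes "\<alpha> \<in> rot_sym_seminorms"
  shows
   "(gauge_continuous \<alpha> \<longrightarrow>
       (\<forall>h \<in> Lcal (dual_gauge \<alpha>).
          (\<forall>f \<in> Lgauge \<alpha>. integrable circle_measure (\<lambda>z. f z * h z)) \<and>
          pairing (Lgauge \<alpha>) h \<in> dual_space (Lgauge \<alpha>) (gauge_ext \<alpha>) \<and>
          dual_norm (Lgauge \<alpha>) (gauge_ext \<alpha>) (pairing (Lgauge \<alpha>) h) = gauge_ext (dual_gauge \<alpha>) h) \<and>
       (\<forall>h \<in> Lcal (dual_gauge \<alpha>). \<forall>k \<in> Lcal (dual_gauge \<alpha>).
          pairing (Lgauge \<alpha>) h = pairing (Lgauge \<alpha>) k \<longrightarrow> (AE z in circle_measure. h z = k z)) \<and>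
       (\<forall>\<phi> \<in> dual_space (Lgauge \<alpha>) (gauge_ext \<alpha>). \<exists>h \<in> Lcal (dual_gauge \<alpha>).
          (\<forall>f \<in> Lgauge \<alpha>. integrable circle_measure (\<lambda>z. f z * h z) \<and>
                          \<phi> f = (\<integral>z. f z * h z \<partial>circle_measure)) \<and>
          dual_norm (Lgauge \<alpha>) (gauge_ext \<alpha>) \<phi> = gauge_ext (dual_gauge \<alpha>) h))
    \<and>
    (gauge_continuous \<alpha> \<longrightarrow>
       (\<forall>f \<in> Linf. dual_gauge (dual_gauge \<alpha>) f = \<alpha> f) \<and>
       (\<forall>f \<in> borel_measurable circle_measure.
          gauge_ext (dual_gauge (dual_gauge \<alpha>)) f = gauge_ext \<alpha> f))
    \<and>
    (strongly_continuous \<alpha> \<and> strongly_continuous (dual_gauge \<alpha>) \<longrightarrow>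
       reflexive_space (Lgauge \<alpha>) (gauge_ext \<alpha>) \<and> reflexive_space (Hgauge \<alpha>) (gauge_ext \<alpha>))
    \<and>
    (\<alpha> \<in> sym_gauge_seminorms \<longrightarrow>
       (reflexive_space (Lgauge \<alpha>) (gauge_ext \<alpha>) \<longleftrightarrow>
          strongly_continuous \<alpha> \<and> strongly_continuous (dual_gauge \<alpha>)))"
proof -
  interpret rot_gauge \<alpha> by unfold_locales (rule assms)
  have cont: "cont_gauge \<alpha>" if "gauge_continuous \<alpha>"
    by unfold_locales (rule that)
  have strong: "cont_gauge \<alpha>" if "strongly_continuous \<alpha>"
    using that by (intro cont) (simp add: strongly_continuous_def)
  \<comment> \<open>Symmetry enters only here, through definiteness, and yields continuity; after
    that the continuous case applies.\<close>
  have sym: "strongly_continuous \<alpha> \<and> strongly_continuous (dual_gauge \<alpha>)"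
    if "\<alpha> \<in> sym_gauge_seminorms" "reflexive_space (Lgauge \<alpha>) (gauge_ext \<alpha>)"
  proof -
    have "cont_gauge \<alpha>"
      by (rule cont[OF reflexive_continuous[OF sym_gauge_definite[OF that(1)] that(2)]])
    then show ?thesis using cont_gauge.reflexive_strongly_continuous[OF _ that(2)] by blast
  qed
  have rep: "\<exists>h \<in> Lcal (dual_gauge \<alpha>).
      (\<forall>f \<in> Lgauge \<alpha>. integrable \<mu> (\<lambda>z. f z * h z) \<and> \<phi> f = (\<integral>z. f z * h z \<partial>\<mu>)) \<and>
      dual_norm (Lgauge \<alpha>) (gauge_ext \<alpha>) \<phi> = gauge_ext (dual_gauge \<alpha>) h"
    if "gauge_continuous \<alpha>" and \<phi>: "\<phi> \<in> dual_space (Lgauge \<alpha>) (gauge_ext \<alpha>)" for \<phi>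
  proof -
    interpret c: cont_gauge \<alpha> by (rule cont[OF that(1)])
    obtain h where h: "h \<in> Lcal (dual_gauge \<alpha>)" "\<phi> = pairing (Lgauge \<alpha>) h"
      using \<phi> by (rule c.dual_representation)
    show ?thesis
      using h c.pairing_integrable(1)[OF Lgauge_Lcal h(1)] c.dual_norm_pairing[OF h(1)]
      by (intro bexI[OF _ h(1)]) (auto simp: pairing_def)
  qed
  show ?thesis
  proof (intro conjI impI ballI iffI; (elim conjE)?)
    assume c: "gauge_continuous \<alpha>"
    fix h assume h: "h \<in> Lcal (dual_gauge \<alpha>)"
    show "integrable circle_measure (\<lambda>z. f z * h z)" if "f \<in> Lgauge \<alpha>" for f
      by (rule cont_gauge.pairing_integrable(1)[OF cont[OF c] Lgauge_Lcal[OF that] h])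
    show "pairing (Lgauge \<alpha>) h \<in> dual_space (Lgauge \<alpha>) (gauge_ext \<alpha>)"
      by (rule cont_gauge.pairing_in_dual_space[OF cont[OF c] h])
    show "dual_norm (Lgauge \<alpha>) (gauge_ext \<alpha>) (pairing (Lgauge \<alpha>) h) = gauge_ext (dual_gauge \<alpha>) h"
      by (rule cont_gauge.dual_norm_pairing[OF cont[OF c] h])
    show "AE z in circle_measure. h z = k z"
      if "k \<in> Lcal (dual_gauge \<alpha>)" "pairing (Lgauge \<alpha>) h = pairing (Lgauge \<alpha>) k" for k
      by (rule cont_gauge.pairing_inject[OF cont[OF c] h that])
  qed (use rep sym cont_gauge.bidual_gauge[OF cont] cont_gauge.gauge_ext_bidual[OF cont]
      cont_gauge.reflexive_Lgauge_if[OF strong] cont_gauge.reflexive_Hgauge[OF strong] in auto)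
qed

end
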